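(* Let $\Omega\subset\mathbb{C}$ be a hyperbolic domain. Then $\Omega$ satisfies Condition 2 if and only if there exists a totally disconnected subset $S\subset\partial\Omega$ (not necessarily closed) such that, for every $p\in\partial\Omega\setminus S$, $\partial\Omega$ is locally connected at $p$ and the connected component of $\partial\Omega$ containing $p$ is not a singleton.
   Context: A domain $\Omega\subset\mathbb{C}$ is hyperbolic if its Kobayashi pseudodistance is a distance (equivalently $\mathbb{C}\setminus\Omega$ has at least two points). $\partial\Omega$ is the boundary in $\mathbb{C}$. $\mathbb{D}$ is the open unit disc. For distinct $x_1,x_2\in\partial\mathbb{D}$ (different from $1$), $Arc(x_1,x_2)$ and $Arc[x_1,x_2]$ denote the open and closed arcs of $\partial\mathbb{D}$ joining $x_1$ and $x_2$ and containing $1$; $[x_1,x_2]_p$ is the Poincaré (hyperbolic) geodesic line in $\mathbb{D}$ with endpoints $x_1,x_2$, together with these endpoints; $Reg(x_1,x_2)$ is the open region bounded by $Arc[x_1,x_2]$ and $[x_1,x_2]_p$. Condition 2: there exists a closed, totally disconnected set $S\subset\partial\Omega$ such that for every $p\in\partial\Omega\setminus S$ and every sequence $(z_n)_{n\ge1}$ in $\Omega$ with $z_n\to p$, there exist a subsequence $(z_{k_n})_{n\ge1}$, an injective holomorphic map $\phi:\mathbb{D}\to\Omega$ that extends continuously to $\overline{\mathbb{D}}$, and an arc $Arc(x_1,x_2)$ containing $1$ such that (1) $\phi(1)=p$ and $\phi(Arc(x_1,x_2))\subset\partial\Omega$; (2) $z_{k_n}\in\phi(Reg(x_1,x_2))$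 for all $n$, and $\phi^{-1}(z_{k_n})\to1$ as $n\to\infty$. *)

theory Defs
  imports "HOL-Analysis.Analysis"
begin

definition poincare_dist :: "complex \<Rightarrow> complex \<Rightarrow> real" where
  "poincare_dist a b = artanh (cmod ((a - b) / (1 - cnj b * a)))"

text \<open>
  The Kobayashi pseudodistance is the infimum of the Poincare lengths of chains of holomorphic
  discs \<open>f i\<close> joining consecutive points \<open>q i\<close>, \<open>q (i + 1)\<close>, with \<open>q 0 = z\<close> and \<open>q n = w\<close>.
  In a domain such chains always exist, so the infimum is over a nonempty set of nonnegative reals.
  The value 0 outside \<open>\<Omega>\<close> is a dummy: the locale \<open>Metric_space\<close> asks for
  nonnegativity and symmetry on the whole type.
\<close>

definition kobayashi_chain_lengths :: "complex set \<Rightarrow> complex \<Rightarrow> complex \<Rightarrow> real set" where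
  "kobayashi_chain_lengths \<Omega> z w =
     {(\<Sum>i<n. poincare_dist (a i) (b i)) | (n::nat) (q::nat \<Rightarrow> complex) (a::nat \<Rightarrow> complex)
        (b::nat \<Rightarrow> complex) (f::nat \<Rightarrow> complex \<Rightarrow> complex).
        q 0 = z \<and> q n = w \<and>
        (\<forall>i<n. f i holomorphic_on ball 0 1 \<and> f i ` ball 0 1 \<subseteq> \<Omega> \<and>
               a i \<in> ball 0 1 \<and> b i \<in> ball 0 1 \<and>
               f i (a i) = q i \<and> f i (b i) = q (Suc i))}"

definition kobayashi_pdist :: "complex set \<Rightarrow> complex \<Rightarrow> complex \<Rightarrow> real" where
  "kobayashi_pdist \<Omega> z w =
     (if z \<in> \<Omega> \<and> w \<in> \<Omega> then Inf (kobayashi_chain_lengths \<Omega> z w) else 0)"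

definition hyperbolic_domain :: "complex set \<Rightarrow> bool" where
  "hyperbolic_domain \<Omega> \<longleftrightarrow>
     open \<Omega> \<and> connected \<Omega> \<and> \<Omega> \<noteq> {} \<and> Metric_space \<Omega> (kobayashi_pdist \<Omega>)"

definition totally_disconnected :: "'a::topological_space set \<Rightarrow> bool" where
  "totally_disconnected S \<longleftrightarrow> (\<forall>x\<in>S. connected_component_set S x = {x})"

text \<open>
  Below, \<open>x1\<close> and \<open>x2\<close> are meant to be distinct points of the unit circle, both different from 1.
\<close>

definition open_arc :: "complex \<Rightarrow> complex \<Rightarrow> complex set" where
  "open_arc x1 x2 = connected_component_set (sphere 0 1 - {x1, x2}) 1"

definition closed_arc :: "complex \<Rightarrow> complex \<Rightarrow> complex set" where
  "closed_arc x1 x2 = open_arc x1 x2 \<union> {x1, x2}"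

text \<open>
  A geodesic line is an isometric embedding of the real line; it is unique, up to
  reparametrisation, once its two endpoints are prescribed.
\<close>

definition poincare_geodesic_line :: "(real \<Rightarrow> complex) \<Rightarrow> complex \<Rightarrow> complex \<Rightarrow> bool" where
  "poincare_geodesic_line \<gamma> x1 x2 \<longleftrightarrow>
     range \<gamma> \<subseteq> ball 0 1 \<and>
     (\<forall>s t. poincare_dist (\<gamma> s) (\<gamma> t) = \<bar>s - t\<bar>) \<and>
     (\<gamma> \<longlongrightarrow> x1) at_bot \<and> (\<gamma> \<longlongrightarrow> x2) at_top"

definition closed_geodesic :: "complex \<Rightarrow> complex \<Rightarrow> complex set" where
  "closed_geodesic x1 x2 =
     {\<gamma> t | \<gamma> t. poincare_geodesic_line \<gamma> x1 x2} \<union> {x1, x2}"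

definition Reg :: "complex \<Rightarrow> complex \<Rightarrow> complex set" where
  "Reg x1 x2 = inside (closed_arc x1 x2 \<union> closed_geodesic x1 x2)"

text \<open>
  The map \<open>\<phi>\<close> stands for both the holomorphic map on the open disc and its continuous extension
  to the closed disc; injectivity is required on the open disc only.
\<close>

definition condition2 :: "complex set \<Rightarrow> bool" where
  "condition2 \<Omega> \<longleftrightarrow>
     (\<exists>S \<subseteq> frontier \<Omega>. closed S \<and> totally_disconnected S \<and>
        (\<forall>p \<in> frontier \<Omega> - S. \<forall>z :: nat \<Rightarrow> complex.
           (\<forall>n. z n \<in> \<Omega>) \<and> z \<longlonglongrightarrow> p \<longrightarrow>
           (\<exists>k :: nat \<Rightarrow> nat. \<exists>\<phi> :: complex \<Rightarrow> complex. \<exists>x1 x2.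
              strict_mono k \<and>
              \<phi> holomorphic_on ball 0 1 \<and> inj_on \<phi> (ball 0 1) \<and> \<phi> ` ball 0 1 \<subseteq> \<Omega> \<and>
              continuous_on (cball 0 1) \<phi> \<and>
              x1 \<in> sphere 0 1 - {1} \<and> x2 \<in> sphere 0 1 - {1} \<and> x1 \<noteq> x2 \<and>
              \<phi> 1 = p \<and> \<phi> ` open_arc x1 x2 \<subseteq> frontier \<Omega> \<and>
              (\<forall>n. z (k n) \<in> \<phi> ` Reg x1 x2) \<and>
              (\<lambda>n. inv_into (ball 0 1) \<phi> (z (k n))) \<longlonglongrightarrow> 1)))"

end

theory Submission
  imports Defs "HOL-Complex_Analysis.Complex_Analysis"
begin

text \<open>Both directions go through connectedness im kleinen of \<open>\<partial>\<Omega>\<close>. Given Condition 2, suppose it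
  fails at \<open>p\<close>: there are boundary points \<open>q n\<close> tending to \<open>p\<close> off the component \<open>C\<close> of \<open>p\<close> in a
  small disc. Choose \<open>z n\<close> in \<open>\<Omega>\<close> much closer to \<open>q n\<close> than \<open>C\<close> is. The image under \<open>\<phi>\<close> of a small
  half-disc at 1 contains some \<open>z n\<close> but not \<open>q n\<close>, and near \<open>p\<close> its frontier lies in \<open>C\<close>, so the
  segment from \<open>z n\<close> to \<open>q n\<close> meets \<open>C\<close>, a contradiction.

  Conversely, the bad points form a closed set, because a failure of connectedness im kleinen
  produces a continuum of such failures. Near a good point \<open>p\<close>, the union \<open>X\<close> of a small circle
  around \<open>p\<close> and the part of \<open>\<partial>\<Omega>\<close> inside it is a locally connected continuum. Infinitely many \<open>z n\<close>
  lie in one complementary component of \<open>X\<close>; it is simply connected, and its Riemann map extends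
  continuously to the closed disc by Caratheodory's argument. Precomposing with a rotation and
  a hyperbolic translation turns this extension into the required \<open>\<phi>\<close> for the arc from \<open>-\<i>\<close> to \<open>\<i>\<close>.\<close>

subsection \<open>Connectedness im kleinen\<close>

text \<open>\<open>locally_connected_at\<close> asks for connected neighbourhoods that are open. At
  a single point connectedness im kleinen is weaker, since \<open>Y\<close> need not be open, but it
  is what the disc argument yields at one point, and on a relatively open set the two notions agree.
  So the closedness of \<open>S\<close> carries one direction, and the other must first replace an
  arbitrary exceptional set by a closed one. The obstacle in both directions is that no Jordan
  curves are at hand: \<open>\<phi>\<close> is injective on the open disc only, and crosscuts are
  not known to have end points. From Condition 2, the frontier of the image of a half-disc takes
  their place. In the converse it is Janiszewski's theorem: a compact and a closed set with
  connected intersection, neither of which separates two given points, do not separate them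
  together. The connected boundary piece given by connectedness im kleinen is what makes that
  intersection connected. The length-area method is run on finite grids with Bloch's lemma, so no
  integral of the derivative occurs.\<close>

definition connected_im_kleinen :: "'a::metric_space set \<Rightarrow> 'a \<Rightarrow> bool" where
  "connected_im_kleinen F s \<longleftrightarrow>
     (\<forall>e>0. \<exists>d>0. \<exists>Y. connected Y \<and> F \<inter> ball s d \<subseteq> Y \<and> Y \<subseteq> F \<inter> ball s e)"

lemma locally_connected_at_imp_nhds:
  fixes F :: "'a::metric_space set"
  assumes "locally_connected_at p (top_of_set F)" "p \<in> F" "e > 0"
  obtains U where "openin (top_of_set F) U" "connected U" "p \<in> U" "U \<subseteq> F \<inter> ball p e"
proof -
  have "openin (top_of_set F) (F \<inter> ball p e) \<and> p \<in> F \<inter> ball p e"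
    using assms by (auto simp: openin_open_Int)
  then obtain U V where "openin (top_of_set F) V" "connectedin (top_of_set F) V"
      "p \<in> U" "U \<subseteq> V" "V \<subseteq> F \<inter> ball p e"
    using assms(1) unfolding locally_connected_at_def neighbourhood_base_at_def by metis
  then show ?thesis
    using that by (metis connectedin_def connectedin_subtopology connectedin_iff_connected subsetD)
qed

lemma connected_im_kleinen_openin:
  assumes "\<And>e. e > 0 \<Longrightarrow> \<exists>U. openin (top_of_set F) U \<and> connected U \<and> p \<in> U \<and> U \<subseteq> F \<inter> ball p e"
  shows "connected_im_kleinen F p"
  unfolding connected_im_kleinen_def
proof (intro allI impI)
  fix e :: real assume "e > 0"
  then obtain U where U: "openin (top_of_set F) U" "connected U" "p \<in> U" "U \<subseteq> F \<inter> ball p e"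
    using assms by meson
  then obtain d where "d > 0" "F \<inter> ball p d \<subseteq> U"
    by (metis Int_commute openin_contains_ball)
  with U show "\<exists>d>0. \<exists>Y. connected Y \<and> F \<inter> ball p d \<subseteq> Y \<and> Y \<subseteq> F \<inter> ball p e" by blast
qed

lemma locally_connected_at_imp_cik:
  assumes "locally_connected_at p (top_of_set F)" "p \<in> F"
  shows "connected_im_kleinen F p"
  using connected_im_kleinen_openin locally_connected_at_imp_nhds[OF assms] by metis

text \<open>The component of \<open>p\<close> in a small relatively open set is itself relatively
  open: the connected \<open>Y\<close> around any of its points \<open>q\<close> is absorbed by it.
  Hence the hypothesis is made at all nearby points and not only at \<open>p\<close>.\<close>

lemma cik_on_open_imp_locally_connected_at:
  fixes F :: "'a::metric_space set"
  assumes "open T" "p \<in> F \<inter> T" and cik: "\<And>q. q \<in> F \<inter> T \<Longrightarrow> connected_im_kleinen F q"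
  shows "locally_connected_at p (top_of_set F)"
  unfolding locally_connected_at_def neighbourhood_base_at_def
proof (intro allI impI)
  fix W assume W: "openin (top_of_set F) W \<and> p \<in> W"
  define V where "V = connected_component_set (W \<inter> T) p"
  have WT: "openin (top_of_set F) (W \<inter> T)"
    by (metis W assms(1) openin_Int_open)
  have sub: "V \<subseteq> W \<inter> T" unfolding V_def by (rule connected_component_subset)
  have "openin (top_of_set F) V"
    unfolding openin_contains_ball
  proof (intro conjI ballI)
    show "V \<subseteq> F" using sub WT openin_imp_subset by blast
    fix q assume q: "q \<in> V"
    then have "q \<in> W \<inter> T" using sub by blast
    then obtain e where e: "e > 0" "F \<inter> ball q e \<subseteq> W \<inter> T"
      using WT unfolding openin_contains_ball by (metis Int_commute)
    have "connected_im_kleinen F q"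
      using cik \<open>q \<in> W \<inter> T\<close> WT openin_imp_subset by blast
    then obtain d Y where dY: "d > 0" "connected Y" "F \<inter> ball q d \<subseteq> Y" "Y \<subseteq> F \<inter> ball q e"
      using e unfolding connected_im_kleinen_def by meson
    have "q \<in> F" using \<open>V \<subseteq> F\<close> q by blast
    then have "q \<in> Y" using dY by auto
    then have "Y \<subseteq> connected_component_set (W \<inter> T) q"
      using dY e by (intro connected_component_maximal) auto
    also have "\<dots> = V" using q unfolding V_def by (metis connected_component_eq)
    finally show "\<exists>e>0. ball q e \<inter> F \<subseteq> V" using dY by blast
  qed
  moreover have "p \<in> V" using W assms(2) by (simp add: V_def)
  moreover have "connected V" by (simp add: V_def)
  ultimately show "\<exists>U V. openin (top_of_set F) U \<and> (openin (top_of_set F) V \<and> connectedin (top_of_set F) V) \<and>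
                  p \<in> U \<and> U \<subseteq> V \<and> V \<subseteq> W"
    using sub by (metis connectedin_subtopology connectedin_iff_connected le_inf_iff openin_imp_subset order_refl)
qed

text \<open>A point at which connectedness im kleinen fails lies on a nondegenerate connected set
  of such points (a continuum of convergence), which a totally disconnected set cannot contain.\<close>

lemma cik_of_totally_disconnected_exceptions:
  fixes F :: "'a::euclidean_space set"
  assumes "closed F" and U: "openin (top_of_set F) U" "connected U" "q \<in> U" "u \<in> U" "u \<noteq> q"
    and td: "totally_disconnected {x \<in> F. \<not> connected_im_kleinen F x}"
  shows "connected_im_kleinen F q"
proof (rule ccontr)
  assume ncik: "\<not> connected_im_kleinen F q"
  then obtain e0 where e0: "e0 > 0"
    and no: "\<And>d Y. d > 0 \<Longrightarrow> connected Y \<Longrightarrow> F \<inter> ball q d \<subseteq> Y \<Longrightarrow> Y \<subseteq> F \<inter> ball q e0 \<Longrightarrow> False"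
    unfolding connected_im_kleinen_def by meson
  have "U \<subseteq> F" using U openin_imp_subset by blast
  then have "q \<in> F" using U by blast
  obtain e1 where e1: "e1 > 0" "F \<inter> ball q e1 \<subseteq> U"
    using U unfolding openin_contains_ball by (metis Int_commute)
  \<comment> \<open>The strict bounds keep \<open>A\<close> inside \<open>U\<close>, inside the ball
    in which \<open>e0\<close> forbids a connected neighbourhood, and away from
    \<open>u\<close>.\<close>
  define r where "r = min (min e0 e1) (dist u q) / 2"
  have r: "r > 0" "r < e0" "r < e1" "r < dist u q"
    using e0 e1 U by (auto simp: r_def min_def)
  define A where "A = F \<inter> cball q r"
  have compA: "compact A" unfolding A_def using assms(1) by (metis Int_commute closed_Int_compact compact_cball)
  have AU: "A \<subseteq> U" using e1 r unfolding A_def by force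
  have "q \<in> A" using \<open>q \<in> F\<close> r by (simp add: A_def)
  define C where "C = connected_component_set A q"
  have CA: "C \<subseteq> A" by (simp add: C_def connected_component_subset)
  have qC: "q \<in> C" using \<open>q \<in> A\<close> by (simp add: C_def)
  have Ccomp: "C \<in> components A" using \<open>q \<in> A\<close> by (auto simp: C_def components_def)
  have closed_comp: "compact D" if "D \<in> components A" for D
    using compact_components compA that by blast
  have "\<exists>x. x \<in> F \<and> x \<in> ball q (min r (1 / Suc n)) \<and> x \<notin> C" for n :: nat
  proof (rule ccontr)
    assume "\<not> ?thesis"
    then have "F \<inter> ball q (min r (1 / Suc n)) \<subseteq> C" by blast
    moreover have "connected C" by (simp add: C_def)
    moreover have "C \<subseteq> F \<inter> ball q e0" using CA r unfolding A_def by auto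
    ultimately show False using no[of "min r (1 / Suc n)" C] r by auto
  qed
  then obtain x where x: "\<And>n::nat. x n \<in> F \<and> x n \<in> ball q (min r (1 / Suc n)) \<and> x n \<notin> C"
    by metis
  have xA: "x n \<in> A" for n using x[of n] by (auto simp: A_def)
  have xlim: "x \<longlonglongrightarrow> q"
  proof -
    have "norm (dist (x n) q) \<le> 1 / Suc n" for n
      using x[of n] by (simp add: dist_commute less_imp_le)
    then have "(\<lambda>n. dist (x n) q) \<longlonglongrightarrow> 0"
      using LIMSEQ_inverse_real_of_nat unfolding inverse_eq_divide
      by (rule Lim_null_comparison[OF always_eventually, OF allI])
    then show ?thesis by (rule tendsto_dist_iff[THEN iffD2])
  qed
  \<comment> \<open>\<open>E\<close> is the part of the component \<open>C\<close> that other
    components of \<open>A\<close> approach. A connected neighbourhood of a point of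
    \<open>E\<close> would attach one of them to \<open>C\<close>, so \<open>E\<close> consists of
    failures; the radius \<open>r / 2\<close> leaves room for that neighbourhood inside
    \<open>A\<close>.\<close>
  define E where "E = closure (A - C) \<inter> C \<inter> cball q (r / 2)"
  have "compact E" unfolding E_def
    by (metis (no_types, lifting) Ccomp closed_closure closed_Int_compact closed_comp compact_Int_closed closed_cball)
  have "q \<in> closure (A - C)"
    using xlim x xA by (metis DiffI closure_sequential)
  then have qE: "q \<in> E" using qC r by (simp add: E_def)
  have Ebad: "E \<subseteq> {x \<in> F. \<not> connected_im_kleinen F x}"
  proof
    fix y assume y: "y \<in> E"
    have "\<not> connected_im_kleinen F y"
    proof
      assume "connected_im_kleinen F y"
      then obtain d Y where dY: "d > 0" "connected Y" "F \<inter> ball y d \<subseteq> Y" "Y \<subseteq> F \<inter> ball y (r/2)"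
        using r unfolding connected_im_kleinen_def by (meson half_gt_zero)
      have yC: "y \<in> C" "dist q y \<le> r/2" using y by (auto simp: E_def)
      then have yF: "y \<in> F" using CA A_def by blast
      have "Y \<subseteq> A"
      proof
        fix v assume v: "v \<in> Y"
        then have "dist y v < r / 2" "v \<in> F" using dY by auto
        then show "v \<in> A" unfolding A_def using dist_triangle[of q v y] yC by auto
      qed
      obtain x' where x': "x' \<in> A - C" "dist x' y < d"
        using y dY(1) closure_approachable[of y "A - C"] unfolding E_def by blast
      have "x' \<in> Y" using x' dY A_def by (auto simp: dist_commute)
      have "y \<in> Y" using yF dY by auto
      have "connected (C \<union> Y)" using \<open>y \<in> Y\<close> yC dY by (intro connected_Un) (auto simp: C_def)
      then have "C \<union> Y \<subseteq> C" unfolding C_def[symmetric]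
        using connected_component_maximal[of q "C \<union> Y" A] qC CA \<open>Y \<subseteq> A\<close> C_def by blast
      then show False using x' \<open>x' \<in> Y\<close> by blast
    qed
    then show "y \<in> {x \<in> F. \<not> connected_im_kleinen F x}" using y CA by (auto simp: E_def A_def)
  qed
  \<comment> \<open>Total disconnectedness makes \<open>{q}\<close> a component of the compact set
    \<open>E\<close>. Sura-Bura then gives a small clopen piece \<open>K\<close> of \<open>E\<close>
    around \<open>q\<close>, and a suitable open \<open>V\<close> around \<open>K\<close> has a
    frontier disjoint from \<open>E\<close>. The contradiction will be a point of \<open>E\<close>
    on that frontier.\<close>
  have "connected_component_set E q \<subseteq> connected_component_set {x \<in> F. \<not> connected_im_kleinen F x} q"
    using Ebad connected_component_mono by blast
  also have "\<dots> = {q}" using td Ebad qE unfolding totally_disconnected_def by blast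
  finally have "connected_component_set E q = {q}" using qE by auto
  then have "{q} \<in> components E" using qE by (auto simp: components_def)
  moreover have "locally compact E" using \<open>compact E\<close> by (simp add: closed_imp_locally_compact compact_imp_closed)
  ultimately obtain K where K: "openin (top_of_set E) K" "compact K" "{q} \<subseteq> K" "K \<subseteq> ball q (r/2)"
    using Sura_Bura_clopen_subset[of E "{q}" "ball q (r/2)"] r by auto
  have "closed (E - K)"
  proof -
    obtain T where "open T" "K = E \<inter> T" using K(1) openin_open by blast
    then have "E - K = E \<inter> (- T)" by blast
    then show ?thesis using \<open>open T\<close> \<open>compact E\<close> by (simp add: compact_imp_closed closed_Int closed_Compl)
  qed
  then have "closed (E - K \<union> - ball q (r/2))" by (intro closed_Un closed_Compl open_ball)
  moreover have "K \<inter> (E - K \<union> - ball q (r/2)) = {}" using K by blast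
  ultimately obtain V W where VW: "open V" "open W" "K \<subseteq> V" "(E - K \<union> - ball q (r/2)) \<subseteq> W" "V \<inter> W = {}"
    using separation_normal[of K] K(2) compact_imp_closed by metis
  have "closure V \<inter> W = {}" using VW open_Int_closure_eq_empty[of W V] by blast
  then have fr: "frontier V \<subseteq> ball q (r/2)" "frontier V \<inter> E = {}" "V \<subseteq> ball q (r/2)"
    using VW by (auto simp: frontier_def interior_open)
  have "q \<in> V" using K VW by blast
  \<comment> \<open>A component of \<open>A\<close> inside \<open>V\<close> would sit in a set
    clopen in \<open>A\<close> and contained in \<open>V\<close>. Away from the rim of
    \<open>cball q r\<close> such a set is also clopen in the connected set \<open>U\<close>, hence
    all of \<open>U\<close>, although \<open>u\<close> lies outside.\<close>
  have ex: "\<exists>y. y \<in> connected_component_set A (x n) \<inter> frontier V" if "x n \<in> V" for n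
  proof -
    let ?D = "connected_component_set A (x n)"
    have Dc: "?D \<in> components A" using xA by (auto simp: components_def)
    have "\<not> ?D \<subseteq> V"
    proof
      assume "?D \<subseteq> V"
      then obtain K' where K': "openin (top_of_set A) K'" "compact K'" "?D \<subseteq> K'" "K' \<subseteq> V"
        using Sura_Bura_clopen_subset[of A ?D V] compA Dc closed_comp VW(1)
        by (metis closed_imp_locally_compact compact_imp_closed)
      obtain T where T: "open T" "K' = A \<inter> T" using K'(1) openin_open by blast
      have "K' = U \<inter> (T \<inter> ball q r)"
      proof
        show "K' \<subseteq> U \<inter> (T \<inter> ball q r)" using T K' AU fr r by fastforce
        show "U \<inter> (T \<inter> ball q r) \<subseteq> K'" using T \<open>U \<subseteq> F\<close> unfolding A_def by auto
      qed
      then have "openin (top_of_set U) K'" using T by (metis openin_open_Int open_Int open_ball)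
      moreover have "closedin (top_of_set U) K'"
        using K' \<open>K' = U \<inter> _\<close> by (metis closed_subset compact_imp_closed inf_le1)
      moreover have "x n \<in> K'" using K' xA by (metis connected_component_refl mem_Collect_eq subsetD)
      ultimately have "K' = U" using U(2) unfolding connected_clopen by blast
      then have "u \<in> ball q (r/2)" using U K' fr by blast
      then show False using r by (auto simp: dist_commute)
    qed
    moreover have "x n \<in> ?D" using xA by simp
    ultimately show ?thesis using connected_Int_frontier[of ?D V] that
      by (metis Diff_eq_empty_iff IntI connected_connected_component emptyE ex_in_conv)
  qed
  have evV: "\<forall>\<^sub>F n in sequentially. x n \<in> V" using xlim VW(1) \<open>q \<in> V\<close> topological_tendstoD by blast
  then obtain N where N: "\<And>n. n \<ge> N \<Longrightarrow> x n \<in> V" unfolding eventually_sequentially by blast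
  then have "\<forall>n. \<exists>y. y \<in> connected_component_set A (x (n + N)) \<inter> frontier V" using ex by simp
  then obtain y where y: "\<And>n. y n \<in> connected_component_set A (x (n + N)) \<inter> frontier V" by metis
  have yA: "y n \<in> A" for n using y connected_component_subset by blast
  have "compact (frontier V)"
    using fr by (metis bounded_ball bounded_subset compact_eq_bounded_closed frontier_closed)
  then obtain l k where lk: "l \<in> frontier V" "strict_mono k" "(y \<circ> k) \<longlonglongrightarrow> l"
    unfolding compact_def using y by (metis IntD2)
  have lA: "l \<in> A" using lk(3) yA compA compact_imp_closed closed_sequentially[of A "y \<circ> k" l] by auto
  have "y n \<notin> C" for n
  proof
    assume "y n \<in> C"
    then have "connected_component A q (y n)" by (simp add: C_def)
    moreover have "connected_component A (x (n+N)) (y n)" using y by blast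
    ultimately have "x (n+N) \<in> C" unfolding C_def
      by (metis connected_component_sym connected_component_trans mem_Collect_eq)
    then show False using x by blast
  qed
  then have lcl: "l \<in> closure (A - C)"
    using lk yA unfolding closure_sequential by (intro exI[of _ "y \<circ> k"]) auto
  \<comment> \<open>The crossing points lie in components of \<open>A\<close> through points tending
    to \<open>q\<close>. A clopen piece of \<open>A\<close> around \<open>C\<close> eventually
    swallows these components whole, so the limit cannot leave \<open>C\<close>.\<close>
  have "l \<in> C"
  proof (rule ccontr)
    assume "l \<notin> C"
    then obtain K2 where K2: "openin (top_of_set A) K2" "compact K2" "C \<subseteq> K2" "K2 \<subseteq> - {l}"
      using Sura_Bura_clopen_subset[of A C "- {l}"] compA Ccomp closed_comp
      by (metis closed_imp_locally_compact compact_imp_closed open_Compl closed_singleton subset_Compl_singleton)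
    obtain T where T: "open T" "K2 = A \<inter> T" using K2(1) openin_open by blast
    have "\<forall>\<^sub>F n in sequentially. x n \<in> T" using xlim T K2 qC topological_tendstoD by blast
    then obtain M where M: "\<And>n. n \<ge> M \<Longrightarrow> x n \<in> K2" unfolding eventually_sequentially using T xA by blast
    have yK2: "y n \<in> K2" if "n \<ge> M" for n
    proof -
      let ?D = "connected_component_set A (x (n+N))"
      have "?D \<subseteq> A" by (simp add: connected_component_subset)
      have "openin (top_of_set ?D) (?D \<inter> K2)"
        using T \<open>?D \<subseteq> A\<close> by (metis Int_assoc inf.absorb1 openin_open_Int)
      moreover have "closedin (top_of_set ?D) (?D \<inter> K2)"
        using K2 compact_imp_closed closedin_closed_Int by blast
      moreover have "x (n+N) \<in> ?D \<inter> K2" using M[of "n+N"] that xA by auto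
      ultimately have "?D \<inter> K2 = ?D" using connected_connected_component[of A "x (n+N)"]
        unfolding connected_clopen by blast
      then show ?thesis using y by blast
    qed
    have "\<forall>\<^sub>F n in sequentially. (y \<circ> k) n \<in> K2"
      unfolding eventually_sequentially comp_def using yK2 lk(2)
      by (meson order_trans seq_suble)
    then have "l \<in> K2" using K2(2) lk(3) compact_imp_closed Lim_in_closed_set[of K2 "y \<circ> k" sequentially l] by auto
    then show False using K2 by blast
  qed
  then have "l \<in> E" using lcl lk fr unfolding E_def by auto
  then show False using fr lk by blast
qed

lemma is_singleton_connected_component:
  assumes "F' \<subseteq> F" "connected F'" "x \<in> F'" "y \<in> F'" "x \<noteq> y"
  shows "\<not> is_singleton (connected_component_set F x)"
  using assms connected_component_maximal[of x F' F] by (metis is_singletonE singletonD subsetD)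

text \<open>The set of all bad points lies in \<open>S\<close> and is already closed. A good point
  has a relatively open connected neighbourhood \<open>U\<close> with a second point, and as
  failures of connectedness im kleinen lie in the totally disconnected \<open>S\<close>, none occurs
  in \<open>U\<close>; so goodness spreads to all of \<open>U\<close>.\<close>

lemma closed_exceptional_set:
  fixes F :: "'a::euclidean_space set"
  assumes "closed F" and S: "totally_disconnected S" "S \<subseteq> F"
    and good: "\<And>p. p \<in> F - S \<Longrightarrow> locally_connected_at p (top_of_set F) \<and>
                     \<not> is_singleton (connected_component_set F p)"
  obtains S' where "S' \<subseteq> S" "closed S'" "totally_disconnected S'"
    and "\<And>p. p \<in> F - S' \<Longrightarrow> connected_im_kleinen F p \<and>
           (\<exists>U. openin (top_of_set F) U \<and> connected U \<and> p \<in> U \<and> (\<exists>u\<in>U. u \<noteq> p))"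
proof -
  define S' where "S' = {p \<in> F. \<not> (locally_connected_at p (top_of_set F) \<and>
                     \<not> is_singleton (connected_component_set F p))}"
  have td_mono: "totally_disconnected B" if "B \<subseteq> S" for B
    unfolding totally_disconnected_def
  proof
    fix x assume "x \<in> B"
    then have "connected_component_set B x \<subseteq> {x}"
      using S that connected_component_mono[OF that] unfolding totally_disconnected_def by (metis subsetD)
    then show "connected_component_set B x = {x}" using \<open>x \<in> B\<close> by auto
  qed
  have "S' \<subseteq> S" using good by (auto simp: S'_def)
  have bad: "totally_disconnected {x \<in> F. \<not> connected_im_kleinen F x}"
    using \<open>S' \<subseteq> S\<close> locally_connected_at_imp_cik by (intro td_mono) (auto simp: S'_def)
  have nhd: "connected_im_kleinen F p \<and>
           (\<exists>U. openin (top_of_set F) U \<and> connected U \<and> p \<in> U \<and> (\<exists>u\<in>U. u \<noteq> p))" if p: "p \<in> F - S'" for p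
  proof -
    have lc: "locally_connected_at p (top_of_set F)" and ns: "\<not> is_singleton (connected_component_set F p)"
      using p by (auto simp: S'_def)
    obtain U where U: "openin (top_of_set F) U" "connected U" "p \<in> U" "U \<subseteq> F \<inter> ball p 1"
      using locally_connected_at_imp_nhds[OF lc, of 1] p by auto
    have "U \<noteq> {p}"
    proof
      assume "U = {p}"
      let ?C = "connected_component_set F p"
      have "openin (top_of_set ?C) {p}"
        using U \<open>U = {p}\<close> p by (metis DiffD1 connected_component_refl connected_component_subset insert_subset mem_Collect_eq openin_subset_trans empty_subsetI)
      moreover have "closedin (top_of_set ?C) {p}"
        using p by (simp add: closed_subset)
      ultimately have "{p} = ?C"
        using connected_connected_component[of F p] unfolding connected_clopen by blast
      then show False using ns by (metis is_singletonI)
    qed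
    then show ?thesis using U lc p locally_connected_at_imp_cik[OF lc] by blast
  qed
  have "openin (top_of_set F) (F - S')"
    unfolding openin_contains_ball
  proof (intro conjI ballI)
    show "F - S' \<subseteq> F" by blast
    fix p assume p: "p \<in> F - S'"
    then obtain U u where U: "openin (top_of_set F) U" "connected U" "p \<in> U" "u \<in> U" "u \<noteq> p"
      using nhd by blast
    obtain T where T: "open T" "U = F \<inter> T" using U(1) openin_open by blast
    have other: "\<exists>v\<in>U. v \<noteq> q" if "q \<in> U" for q using U by metis
    have ck: "connected_im_kleinen F q" if "q \<in> U" for q
      using other[OF that] cik_of_totally_disconnected_exceptions[OF assms(1) U(1,2) that _ _ bad] by blast
    have "q \<in> F - S'" if q: "q \<in> U" for q
    proof -
      have "locally_connected_at q (top_of_set F)"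
        using cik_on_open_imp_locally_connected_at[of T q F] T q ck by blast
      moreover have "\<not> is_singleton (connected_component_set F q)"
        using other[OF q] q U T is_singleton_connected_component[of U F q] by (metis inf_le1)
      ultimately show ?thesis using q T by (simp add: S'_def)
    qed
    then have "U \<subseteq> F - S'" by blast
    then show "\<exists>e>0. ball p e \<inter> F \<subseteq> F - S'"
      using U(1,3) unfolding openin_contains_ball by (meson order_trans)
  qed
  then have "closedin (top_of_set F) S'"
    unfolding closedin_def by (auto simp: S'_def)
  then have "closed S'" using assms(1) closedin_closed_eq by blast
  show ?thesis
    using that[OF \<open>S' \<subseteq> S\<close> \<open>closed S'\<close> td_mono[OF \<open>S' \<subseteq> S\<close>]] nhd by blast
qed

subsection \<open>Hyperbolic translations and geodesics\<close>

text \<open>For \<open>0 \<le> a < 1\<close> this is a disc automorphism fixing \<open>1\<close> and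
  \<open>-1\<close> and taking \<open>0\<close> to \<open>a\<close>. As \<open>a\<close> tends to 1
  it squeezes the right half of the disc into a neighbourhood of 1.\<close>

definition hyp_translation :: "real \<Rightarrow> complex \<Rightarrow> complex" where
  "hyp_translation a z = (z + of_real a) / (1 + of_real a * z)"

context
  fixes a :: real
  assumes a: "0 \<le> a" "a < 1"
begin

lemma hyp_translation_denom: "norm (z::complex) \<le> 1 \<Longrightarrow> 1 + of_real a * z \<noteq> 0"
proof
  assume "norm z \<le> 1" "1 + of_real a * z = 0"
  then have "norm (of_real a * z) = 1" by (metis add_eq_0_iff norm_minus_cancel norm_one)
  moreover have "norm (of_real a * z) \<le> a * 1"
    unfolding norm_mult using a \<open>norm z \<le> 1\<close> by (intro mult_mono) auto
  ultimately show False using a by simp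
qed

lemma hyp_translation_norm:
  assumes "norm z \<le> 1"
  shows "1 - (norm (hyp_translation a z))\<^sup>2 = (1 - a\<^sup>2) * (1 - (norm z)\<^sup>2) / (norm (1 + of_real a * z))\<^sup>2"
proof -
  have "(norm (1 + of_real a * z))\<^sup>2 - (norm (z + of_real a))\<^sup>2 = (1 - a\<^sup>2) * (1 - (norm z)\<^sup>2)"
    by (simp add: cmod_power2) (simp add: power2_eq_square algebra_simps)
  moreover have "norm (1 + of_real a * z) \<noteq> 0" using hyp_translation_denom[OF assms] by simp
  ultimately show ?thesis
    unfolding hyp_translation_def norm_divide power_divide by (simp add: field_simps)
qed

lemma hyp_translation_in_ball:
  assumes "norm z < 1" shows "norm (hyp_translation a z) < 1"
proof -
  have "norm (1 + of_real a * z) > 0" using hyp_translation_denom[of z] assms by simp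
  moreover have "a\<^sup>2 < 1" "(norm z)\<^sup>2 < 1" using a assms by (auto simp: abs_square_less_1)
  ultimately have "1 - (norm (hyp_translation a z))\<^sup>2 > 0"
    using hyp_translation_norm[of z] assms by simp
  then show ?thesis by (simp add: abs_square_less_1)
qed

lemma hyp_translation_in_sphere:
  assumes "norm z = 1" shows "norm (hyp_translation a z) = 1"
proof -
  have "(norm (hyp_translation a z))\<^sup>2 = 1" using hyp_translation_norm[of z] assms by simp
  then show ?thesis by (simp add: power2_eq_1_iff) (smt (verit) norm_ge_zero)
qed

lemma hyp_translation_in_cball:
  "norm z \<le> 1 \<Longrightarrow> norm (hyp_translation a z) \<le> 1"
  using hyp_translation_in_ball hyp_translation_in_sphere by (metis le_less)

lemma hyp_translation_one: "hyp_translation a 1 = 1"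
  using hyp_translation_denom[of 1] by (simp add: hyp_translation_def add.commute)

text \<open>The difference to 1 equals \<open>(1 - a) * (z - 1) / (1 + a * z)\<close>, and
  \<open>Re z \<ge> 0\<close> keeps the denominator at modulus at least 1. This exchanges an
  arbitrarily short arc around 1 for the fixed right half-circle.\<close>

lemma hyp_translation_near_one:
  assumes "norm z \<le> 1" "Re z \<ge> 0"
  shows "norm (hyp_translation a z - 1) \<le> 2 * (1 - a)"
proof -
  have nz: "1 + of_real a * z \<noteq> 0" using hyp_translation_denom assms by blast
  have "hyp_translation a z - 1 = (1 - of_real a) * (z - 1) / (1 + of_real a * z)"
    using nz by (simp add: hyp_translation_def field_simps)
  then have "norm (hyp_translation a z - 1) = norm (1 - complex_of_real a) * norm (z - 1) / norm (1 + of_real a * z)"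
    by (simp add: norm_mult norm_divide)
  also have "norm (1 - complex_of_real a) = 1 - a"
    using a by (metis abs_of_nonneg diff_ge_0_iff_ge less_eq_real_def norm_of_real of_real_1 of_real_diff)
  also have "(1 - a) * norm (z - 1) / norm (1 + of_real a * z) \<le> (1 - a) * 2 / 1"
  proof (rule frac_le)
    show "(1 - a) * norm (z - 1) \<le> (1 - a) * 2"
      using a norm_triangle_ineq4[of z 1] assms by (intro mult_left_mono) auto
    have "1 \<le> Re (1 + of_real a * z)" using a assms by simp
    also have "\<dots> \<le> norm (1 + of_real a * z)" by (rule complex_Re_le_cmod)
    finally show "1 \<le> norm (1 + of_real a * z)" .
  qed (use a in auto)
  finally show ?thesis by (simp add: mult.commute)
qed

lemma hyp_translation_holomorphic: "hyp_translation a holomorphic_on ball 0 1"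
  unfolding hyp_translation_def using hyp_translation_denom
  by (intro holomorphic_intros) auto

lemma hyp_translation_continuous: "continuous_on (cball 0 1) (hyp_translation a)"
  unfolding hyp_translation_def using hyp_translation_denom
  by (intro continuous_intros) auto

end

text \<open>Conjugation with \<open>z \<mapsto> - z\<close> swaps the fixed points \<open>1\<close>
  and \<open>-1\<close>, which inverts the translation while keeping the parameter nonnegative, so
  that the facts about \<open>hyp_translation\<close> carry over.\<close>

definition hyp_translation_inv :: "real \<Rightarrow> complex \<Rightarrow> complex" where
  "hyp_translation_inv a z = - hyp_translation a (- z)"

context
  fixes a :: real
  assumes a: "0 \<le> a" "a < 1"
begin

lemma hyp_translation_inv_alt: "hyp_translation_inv a z = (z - of_real a) / (1 - of_real a * z)"
  by (simp add: hyp_translation_inv_def hyp_translation_def minus_divide_left)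

lemma hyp_translation_inverse:
  assumes "norm z \<le> 1"
  shows "hyp_translation_inv a (hyp_translation a z) = z"
    and "hyp_translation a (hyp_translation_inv a z) = z"
proof -
  have d: "1 + of_real a * z \<noteq> 0" "1 - of_real a * z \<noteq> 0"
    using hyp_translation_denom[OF a, of z] hyp_translation_denom[OF a, of "-z"] assms by auto
  have "a\<^sup>2 \<noteq> 1" using a by (simp add: power2_eq_1_iff)
  then have n: "1 - (complex_of_real a)\<^sup>2 \<noteq> 0" by (metis eq_iff_diff_eq_0 of_real_eq_1_iff of_real_power)
  have "hyp_translation a z - of_real a = z * (1 - (of_real a)\<^sup>2) / (1 + of_real a * z)"
    "1 - of_real a * hyp_translation a z = (1 - (of_real a)\<^sup>2) / (1 + of_real a * z)"
    using d by (auto simp: hyp_translation_def field_simps power2_eq_square)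
  then show "hyp_translation_inv a (hyp_translation a z) = z"
    using d n by (simp add: hyp_translation_inv_alt)
  have "hyp_translation_inv a z + of_real a = z * (1 - (of_real a)\<^sup>2) / (1 - of_real a * z)"
    "1 + of_real a * hyp_translation_inv a z = (1 - (of_real a)\<^sup>2) / (1 - of_real a * z)"
    using d by (auto simp: hyp_translation_inv_alt field_simps power2_eq_square)
  then show "hyp_translation a (hyp_translation_inv a z) = z"
    using d n by (simp add: hyp_translation_def)
qed

lemma hyp_translation_inj: "inj_on (hyp_translation a) (cball 0 1)"
  by (rule inj_on_inverseI[of _ "hyp_translation_inv a"]) (simp add: hyp_translation_inverse)

lemma hyp_translation_inv_in_ball: "norm z < 1 \<Longrightarrow> norm (hyp_translation_inv a z) < 1"
  using hyp_translation_in_ball[OF a, of "-z"] by (simp add: hyp_translation_inv_def)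

lemma hyp_translation_inv_one: "hyp_translation_inv a 1 = 1"
  using hyp_translation_inverse(1)[of 1] hyp_translation_one[OF a] by simp

lemma hyp_translation_inv_continuous: "continuous_on (cball 0 1) (hyp_translation_inv a)"
proof -
  have "continuous_on (cball 0 1) (\<lambda>z. hyp_translation a (- z))"
    by (rule continuous_on_compose2[OF hyp_translation_continuous[OF a]]) (auto intro: continuous_intros)
  then show ?thesis unfolding hyp_translation_inv_def by (rule continuous_on_minus)
qed

end

section \<open>Boundary uniqueness for holomorphic functions on the disc\<close>

text \<open>If \<open>g\<close> is nonzero at a point, it is nonzero on an open set
  \<open>W\<close>, hence zero on the open set \<open>- W\<close>, and the identity theorem makes it
  zero everywhere.\<close>

lemma vanishing_product_on_ball:
  fixes g :: "complex \<Rightarrow> complex"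
  assumes hol: "g holomorphic_on ball 0 1" and prod: "\<And>z. norm z < 1 \<Longrightarrow> g z * g (- z) = 0"
    and z: "norm z < 1"
  shows "g z = 0"
proof (rule ccontr)
  assume nz: "g z \<noteq> 0"
  have cont: "continuous_on (ball 0 1) g" by (simp add: hol holomorphic_on_imp_continuous_on)
  define W where "W = {w \<in> ball 0 1. g w \<noteq> 0}"
  have "W = ball 0 1 \<inter> g -` (- {0})" by (auto simp: W_def)
  then have "open W" using cont by (metis continuous_on_open_vimage open_Compl open_ball closed_singleton Int_commute)
  have "open (uminus ` W)" using \<open>open W\<close> by (rule open_negations)
  moreover have "uminus ` W \<subseteq> ball 0 1" by (auto simp: W_def)
  moreover have "- z \<in> uminus ` W" using nz z by (auto simp: W_def)
  moreover have "g w = 0" if "w \<in> uminus ` W" for w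
    using that prod by (auto simp: W_def)
  ultimately have "g z = 0"
    using analytic_continuation_open[of "uminus ` W" "ball 0 1" g "\<lambda>_. 0" z] hol z by auto
  then show False using nz by blast
qed

text \<open>A translation stretches the short arc to the right half-circle. For the resulting
  \<open>g\<close> the product \<open>g z * g (- z)\<close> vanishes on the whole circle, since
  \<open>z\<close> or \<open>- z\<close> is in the right half, so the maximum principle applies to
  it.\<close>

lemma zero_on_boundary_arc:
  fixes f :: "complex \<Rightarrow> complex"
  assumes cont: "continuous_on (cball 0 1) f" and hol: "f holomorphic_on ball 0 1"
    and d: "d > 0" and zero: "\<And>x. norm x = 1 \<Longrightarrow> dist x 1 < d \<Longrightarrow> f x = 0"
    and z: "norm z < 1"
  shows "f z = 0"
proof -
  \<comment> \<open>The right half-circle lands within \<open>2 * (1 - a)\<close> of 1; the 4 brings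
    this below \<open>d\<close>, and \<open>max\<close> keeps \<open>a\<close> nonnegative for large
    \<open>d\<close>.\<close>
  define a where "a = max 0 (1 - d / 4)"
  have a: "0 \<le> a" "a < 1" "2 * (1 - a) < d" using d by (auto simp: a_def max_def)
  let ?m = "hyp_translation a"
  define g where "g = f \<circ> ?m"
  have "?m ` ball 0 1 \<subseteq> ball 0 1" "?m ` cball 0 1 \<subseteq> cball 0 1"
    using hyp_translation_in_ball[OF a(1,2)] hyp_translation_in_cball[OF a(1,2)] by auto
  then have g: "g holomorphic_on ball 0 1" "continuous_on (cball 0 1) g"
    unfolding g_def using hol cont hyp_translation_holomorphic[OF a(1,2)] hyp_translation_continuous[OF a(1,2)]
    by (blast intro: holomorphic_on_compose_gen, metis continuous_on_compose continuous_on_subset)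
  have g0: "g x = 0" if "norm x = 1" "Re x \<ge> 0" for x
    using that hyp_translation_near_one[OF a(1,2), of x] a(3) hyp_translation_in_sphere[OF a(1,2), of x]
    by (auto simp: g_def dist_norm intro!: zero)
  define h where "h z = g z * g (- z)" for z
  have cm: "continuous_on (cball 0 1) (\<lambda>z. g (- z))"
    by (rule continuous_on_compose2[OF g(2)]) (auto intro: continuous_intros)
  have hm: "(\<lambda>z. g (- z)) holomorphic_on ball 0 1"
  proof -
    have "(g \<circ> uminus) holomorphic_on ball 0 1"
      by (rule holomorphic_on_compose_gen[OF holomorphic_on_minus[OF holomorphic_on_ident] g(1)]) auto
    then show ?thesis by (simp add: o_def)
  qed
  have "h w = 0" if "norm w < 1" for w
  proof -
    have "norm (h w) \<le> 0"
    proof (rule maximum_modulus_frontier[of h "ball 0 1" 0 w])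
      show "h holomorphic_on interior (ball 0 1)" unfolding h_def using g hm by (auto intro: holomorphic_intros)
      show "continuous_on (closure (ball 0 1)) h" unfolding h_def using g cm by (auto intro: continuous_intros)
      fix x :: complex assume "x \<in> frontier (ball 0 1)"
      then have "norm x = 1" by simp
      then have "g x = 0 \<or> g (- x) = 0" using g0[of x] g0[of "-x"] by fastforce
      then show "norm (h x) \<le> 0" by (auto simp: h_def)
    qed (use that in auto)
    then show ?thesis by simp
  qed
  then have gz: "g w = 0" if "norm w < 1" for w
    using vanishing_product_on_ball[OF g(1) _ that] by (simp add: h_def)
  have "f z = g (hyp_translation_inv a z)"
    using hyp_translation_inverse(2)[OF a(1,2), of z] z by (simp add: g_def)
  also have "\<dots> = 0" using gz hyp_translation_inv_in_ball[OF a(1,2) z] by blast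
  finally show ?thesis .
qed

section \<open>The geodesic from \<open>-\<i>\<close> to \<open>\<i>\<close> and its region\<close>

text \<open>With \<open>s\<close> and \<open>t\<close> for the two norms on the right, the
  exponential is \<open>(s + t) / (s - t)\<close>, and \<open>s\<^sup>2 - t\<^sup>2\<close> is the
  product on the left. Cleared of denominators, the identity can be used when a point tends to the
  circle.\<close>

lemma poincare_dist_exp:
  assumes "norm a < 1" "norm b < 1"
  shows "exp (2 * poincare_dist a b) * ((1 - (norm a)\<^sup>2) * (1 - (norm b)\<^sup>2)) =
         (norm (1 - cnj b * a) + norm (a - b))\<^sup>2"
proof -
  define x where "x = norm ((a - b) / (1 - cnj b * a))"
  have id: "(norm (1 - cnj b * a))\<^sup>2 - (norm (a - b))\<^sup>2 = (1 - (norm a)\<^sup>2) * (1 - (norm b)\<^sup>2)"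
    by (simp add: cmod_power2) (simp add: power2_eq_square algebra_simps)
  have pos: "(1 - (norm a)\<^sup>2) * (1 - (norm b)\<^sup>2) > 0"
    using assms by (simp add: abs_square_less_1)
  have "norm (1 - cnj b * a) \<noteq> 0"
    using id pos by (metis diff_gt_0_iff_gt norm_ge_zero not_less power2_less_imp_less power_zero_numeral zero_le_power2)
  then have n: "norm (1 - cnj b * a) > 0" by simp
  have lt: "norm (a - b) < norm (1 - cnj b * a)"
    using id pos by (intro power2_less_imp_less[OF _ norm_ge_zero]) linarith
  have xx: "x = norm (a - b) / norm (1 - cnj b * a)" by (simp add: x_def norm_divide)
  have x: "0 \<le> x" "x < 1" using lt n by (auto simp: xx)
  have "exp (2 * poincare_dist a b) = (1 + x) / (1 - x)"
    unfolding poincare_dist_def x_def[symmetric] artanh_def using x by simp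
  also have "\<dots> = (norm (1 - cnj b * a) + norm (a - b)) / (norm (1 - cnj b * a) - norm (a - b))"
    using n lt by (simp add: xx divide_simps)
  also have "\<dots> * ((1 - (norm a)\<^sup>2) * (1 - (norm b)\<^sup>2)) = (norm (1 - cnj b * a) + norm (a - b))\<^sup>2"
    unfolding id[symmetric] using lt by (simp add: field_simps power2_eq_square)
  finally show ?thesis .
qed

text \<open>Distances add along \<open>A n\<close>, \<open>\<gamma> u\<close>, \<open>B n\<close>.
  In exponential form the factors of \<open>A n\<close> and \<open>B n\<close> that degenerate at
  the circle cancel, and the limit is an equation between
  \<open>norm (w + \<i>) * norm (w - \<i>)\<close> and \<open>1 - (norm w)\<^sup>2\<close>, for
  \<open>w = \<gamma> u\<close>; the squares of the two differ by
  \<open>4 * (Re w)\<^sup>2\<close>.\<close>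

lemma poincare_geodesic_line_on_imaginary_axis:
  assumes "poincare_geodesic_line \<gamma> (-\<i>) \<i>"
  shows "Re (\<gamma> u) = 0"
proof -
  let ?w = "\<gamma> u"
  have ball: "norm (\<gamma> t) < 1" for t
    using assms unfolding poincare_geodesic_line_def by (metis mem_ball_0 rangeI subsetD)
  have dist: "poincare_dist (\<gamma> s) (\<gamma> t) = \<bar>s - t\<bar>" for s t
    using assms unfolding poincare_geodesic_line_def by blast
  have lim: "(\<gamma> \<longlongrightarrow> -\<i>) at_bot" "(\<gamma> \<longlongrightarrow> \<i>) at_top"
    using assms unfolding poincare_geodesic_line_def by auto
  define E where "E a b = (norm (1 - cnj b * a) + norm (a - b))\<^sup>2" for a b :: complex
  define A where "A n = \<gamma> (- real n)" for n
  define B where "B n = \<gamma> (real n)" for n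
  have limA: "A \<longlonglongrightarrow> -\<i>" unfolding A_def
    by (rule filterlim_compose[OF lim(1)]) (intro filterlim_uminus_at_bot_at_top[THEN filterlim_compose] filterlim_real_sequentially)
  have limB: "B \<longlonglongrightarrow> \<i>" unfolding B_def by (rule filterlim_compose[OF lim(2)]) (rule filterlim_real_sequentially)
  have ev: "E (A n) ?w * E ?w (B n) = E (A n) (B n) * (1 - (norm ?w)\<^sup>2)\<^sup>2" if "real n \<ge> \<bar>u\<bar>" for n
  proof -
    have 1: "exp (2 * (u + n)) * ((1 - (norm (A n))\<^sup>2) * (1 - (norm ?w)\<^sup>2)) = E (A n) ?w"
      using poincare_dist_exp[OF ball ball, of "-real n" u] dist[of "-real n" u] that by (simp add: E_def A_def)
    have 2: "exp (2 * (n - u)) * ((1 - (norm ?w)\<^sup>2) * (1 - (norm (B n))\<^sup>2)) = E ?w (B n)"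
      using poincare_dist_exp[OF ball ball, of u "real n"] dist[of u "real n"] that by (simp add: E_def B_def)
    have 3: "exp (2 * (2 * n)) * ((1 - (norm (A n))\<^sup>2) * (1 - (norm (B n))\<^sup>2)) = E (A n) (B n)"
      using poincare_dist_exp[OF ball ball, of "-real n" "real n"] dist[of "-real n" "real n"] by (simp add: E_def A_def B_def)
    have "exp (2 * (u + n)) * exp (2 * (n - u)) = exp (2 * (2 * real n))"
      by (simp add: exp_add[symmetric] algebra_simps)
    then show ?thesis unfolding 1[symmetric] 2[symmetric] 3[symmetric] by (simp add: power2_eq_square algebra_simps)
  qed
  have l1: "(\<lambda>n. E (A n) ?w * E ?w (B n)) \<longlonglongrightarrow> E (-\<i>) ?w * E ?w \<i>"
    unfolding E_def by (intro tendsto_intros limA limB)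
  have l2: "(\<lambda>n. E (A n) (B n) * (1 - (norm ?w)\<^sup>2)\<^sup>2) \<longlonglongrightarrow> E (-\<i>) \<i> * (1 - (norm ?w)\<^sup>2)\<^sup>2"
    unfolding E_def by (intro tendsto_intros limA limB)
  have "\<forall>\<^sub>F n in sequentially. E (A n) (B n) * (1 - (norm ?w)\<^sup>2)\<^sup>2 = E (A n) ?w * E ?w (B n)"
    using ev by (intro eventually_sequentiallyI[of "nat \<lceil>\<bar>u\<bar>\<rceil>"]) (simp add: nat_ceiling_le_eq)
  then have "(\<lambda>n. E (A n) ?w * E ?w (B n)) \<longlonglongrightarrow> E (-\<i>) \<i> * (1 - (norm ?w)\<^sup>2)\<^sup>2"
    by (rule Lim_transform_eventually[OF l2])
  then have eq: "E (-\<i>) ?w * E ?w \<i> = E (-\<i>) \<i> * (1 - (norm ?w)\<^sup>2)\<^sup>2"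
    using l1 LIMSEQ_unique by blast
  have n1: "norm (1 + cnj ?w * \<i>) = norm (?w + \<i>)"
    by (simp add: cmod_def power2_eq_square algebra_simps)
  have n2: "norm (1 + \<i> * ?w) = norm (?w - \<i>)"
    by (simp add: cmod_def power2_eq_square algebra_simps)
  have n3: "norm (- \<i> - ?w) = norm (?w + \<i>)" by (metis minus_add_distrib norm_minus_cancel add.commute diff_conv_add_uminus)
  have e1: "E (-\<i>) ?w = 4 * (norm (?w + \<i>))\<^sup>2" unfolding E_def using n1 n3 by (simp add: power2_eq_square)
  have e2: "E ?w \<i> = 4 * (norm (?w - \<i>))\<^sup>2" unfolding E_def using n2 by (simp add: power2_eq_square)
  have "- \<i> - \<i> = -2 * \<i>" by simp
  then have "norm (- \<i> - \<i>) = 2" by (metis norm_ii norm_minus_cancel norm_mult norm_numeral mult_minus_left mult.right_neutral)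
  then have e3: "E (-\<i>) \<i> = 16" unfolding E_def by simp
  have "(norm (?w + \<i>))\<^sup>2 * (norm (?w - \<i>))\<^sup>2 = (1 - (norm ?w)\<^sup>2)\<^sup>2" using eq unfolding e1 e2 e3 by simp
  moreover have "(norm (?w + \<i>))\<^sup>2 * (norm (?w - \<i>))\<^sup>2 = (1 - (norm ?w)\<^sup>2)\<^sup>2 + 4 * (Re ?w)\<^sup>2"
    by (simp add: cmod_power2) (simp add: power2_eq_square algebra_simps)
  ultimately show ?thesis by simp
qed

lemma tanh_diff_real: "(tanh (s::real) - tanh t) / (1 - tanh s * tanh t) = tanh (s - t)"
  using tanh_add[of s "-t"] cosh_real_nonzero by (simp add: tanh_minus)

lemma poincare_geodesic_line_tanh: "poincare_geodesic_line (\<lambda>t. \<i> * of_real (tanh t)) (-\<i>) \<i>"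
  unfolding poincare_geodesic_line_def
proof (intro conjI allI)
  show "range (\<lambda>t. \<i> * of_real (tanh t)) \<subseteq> ball 0 1"
    by (auto simp: norm_mult abs_less_iff tanh_real_lt_1 tanh_real_gt_neg1 minus_less_iff)
  fix s t :: real
  have "(\<i> * of_real (tanh s) - \<i> * of_real (tanh t)) / (1 - cnj (\<i> * of_real (tanh t)) * (\<i> * of_real (tanh s)))
      = \<i> * of_real ((tanh s - tanh t) / (1 - tanh s * tanh t))"
    by (simp add: algebra_simps diff_divide_distrib)
  then have "norm ((\<i> * of_real (tanh s) - \<i> * of_real (tanh t)) / (1 - cnj (\<i> * of_real (tanh t)) * (\<i> * of_real (tanh s))))
      = \<bar>tanh (s - t)\<bar>"
    unfolding tanh_diff_real by (simp add: norm_mult)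
  also have "\<dots> = tanh \<bar>s - t\<bar>" using tanh_minus[of "s - t"] by (auto simp: abs_if)
  finally show "poincare_dist (\<i> * of_real (tanh s)) (\<i> * of_real (tanh t)) = \<bar>s - t\<bar>"
    unfolding poincare_dist_def by (metis artanh_tanh_real)
next
  have "((\<lambda>t. \<i> * complex_of_real (tanh t)) \<longlongrightarrow> \<i> * complex_of_real (-1)) at_bot"
    by (rule tendsto_mult[OF tendsto_const tendsto_of_real[OF tanh_real_at_bot]])
  then show "((\<lambda>t. \<i> * complex_of_real (tanh t)) \<longlongrightarrow> -\<i>) at_bot" by simp
  have "((\<lambda>t. \<i> * complex_of_real (tanh t)) \<longlongrightarrow> \<i> * complex_of_real 1) at_top"
    by (rule tendsto_mult[OF tendsto_const tendsto_of_real[OF tanh_real_at_top]])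
  then show "((\<lambda>t. \<i> * complex_of_real (tanh t)) \<longlongrightarrow> \<i>) at_top" by simp
qed

text \<open>\<open>closed_geodesic\<close> collects the points of all geodesic lines with these
  ends. So one inclusion is about an arbitrary line, and the other exhibits the explicit line
  \<open>\<i> * tanh t\<close>.\<close>

lemma closed_geodesic_i: "closed_geodesic (-\<i>) \<i> = {z. Re z = 0 \<and> norm z \<le> 1}"
proof
  show "closed_geodesic (-\<i>) \<i> \<subseteq> {z. Re z = 0 \<and> norm z \<le> 1}"
    using poincare_geodesic_line_on_imaginary_axis
    unfolding closed_geodesic_def poincare_geodesic_line_def by (auto simp: subset_iff less_imp_le)
  show "{z. Re z = 0 \<and> norm z \<le> 1} \<subseteq> closed_geodesic (-\<i>) \<i>"
  proof
    fix z assume "z \<in> {z. Re z = 0 \<and> norm z \<le> 1}"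
    then have z: "z = \<i> * of_real (Im z)" "\<bar>Im z\<bar> \<le> 1"
      using abs_Im_le_cmod[of z] by (auto simp: complex_eq_iff)
    show "z \<in> closed_geodesic (-\<i>) \<i>"
    proof (cases "\<bar>Im z\<bar> = 1")
      case True
      then have "z = \<i> \<or> z = -\<i>" using z(1) by (metis abs_if minus_equation_iff mult.right_neutral mult_minus_right of_real_1 of_real_minus)
      then show ?thesis by (auto simp: closed_geodesic_def)
    next
      case False
      then have lt: "1 + Im z > 0" "1 - Im z > 0" using z(2) by auto
      have "exp (- 2 * artanh (Im z)) = (1 - Im z) / (1 + Im z)"
        using lt by (simp add: artanh_def exp_minus)
      then have "tanh (artanh (Im z)) = (1 - (1 - Im z) / (1 + Im z)) / (1 + (1 - Im z) / (1 + Im z))"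
        unfolding tanh_real_altdef by simp
      also have "\<dots> = Im z" using lt by (simp add: divide_simps)
      finally have "tanh (artanh (Im z)) = Im z" .
      then have "z = (\<lambda>t. \<i> * of_real (tanh t)) (artanh (Im z))" using z(1) by simp
      then have "\<exists>\<gamma> t. z = \<gamma> t \<and> poincare_geodesic_line \<gamma> (-\<i>) \<i>"
        using poincare_geodesic_line_tanh by (intro exI conjI)
      then show ?thesis by (simp add: closed_geodesic_def)
    qed
  qed
qed

text \<open>On a connected set, \<open>Re\<close> would have to pass through 0 to leave the right
  half-circle, and on the circle it is 0 only at the two removed points.\<close>

lemma open_arc_i:
  assumes "z \<in> open_arc (-\<i>) \<i>" shows "norm z = 1 \<and> Re z > 0"
proof -
  let ?A = "open_arc (-\<i>) \<i>"
  have sub: "?A \<subseteq> sphere 0 1 - {-\<i>, \<i>}" unfolding open_arc_def by (rule connected_component_subset)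
  have re: "Re w \<noteq> 0" if "w \<in> ?A" for w
  proof
    assume "Re w = 0"
    moreover have "norm w = 1" using that sub by auto
    ultimately have "\<bar>Im w\<bar> = 1" by (simp add: cmod_def)
    then have "w = \<i> \<or> w = -\<i>" using \<open>Re w = 0\<close> by (auto simp: complex_eq_iff abs_if split: if_splits)
    then show False using sub that by blast
  qed
  have "connected ?A" by (simp add: open_arc_def)
  have "(1::complex) \<in> ?A" unfolding open_arc_def
    by (simp add: complex_eq_iff)
  have "Re z > 0"
  proof (rule ccontr)
    assume "\<not> Re z > 0"
    have "connected (Re ` ?A)"
      using \<open>connected ?A\<close> by (intro connected_continuous_image continuous_intros)
    moreover have "Re z \<in> Re ` ?A" "Re 1 \<in> Re ` ?A" using assms \<open>1 \<in> ?A\<close> by blast+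
    ultimately have "0 \<in> Re ` ?A"
      using connectedD_interval[of "Re ` ?A" "Re z" "Re 1" 0] \<open>\<not> Re z > 0\<close> by simp
    then show False using re by auto
  qed
  then show ?thesis using assms sub by auto
qed

text \<open>The frontier of the half-disc is contained in the curve \<open>?K\<close>, so a
  complementary component that starts in the half-disc stays there and is bounded.\<close>

lemma half_disc_subset_Reg:
  assumes "norm z < 1" "Re z > 0" shows "z \<in> Reg (-\<i>) \<i>"
proof -
  let ?K = "closed_arc (-\<i>) \<i> \<union> closed_geodesic (-\<i>) \<i>"
  have arc: "x \<in> open_arc (-\<i>) \<i>" if x: "norm x = 1" "Re x > 0" for x
  proof -
    let ?H = "sphere 0 1 \<inter> {w. Re w > 0} :: complex set"
    have "?H = (\<lambda>t. exp (\<i> * of_real t)) ` {-pi/2<..<pi/2}"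
    proof
      show "?H \<subseteq> (\<lambda>t. exp (\<i> * of_real t)) ` {-pi/2<..<pi/2}"
      proof
        fix w assume "w \<in> ?H"
        then have w: "norm w = 1" "Re w > 0" "w \<noteq> 0" by auto
        have "exp (\<i> * of_real (Im (Ln w))) = w"
          using w by (metis Re_Ln add_0 complex_eq exp_Ln ln_one mult.commute of_real_0)
        moreover have "\<bar>Im (Ln w)\<bar> < pi/2" using Re_Ln_pos_lt_imp w by blast
        ultimately show "w \<in> (\<lambda>t. exp (\<i> * of_real t)) ` {-pi/2<..<pi/2}"
          by (intro image_eqI[of _ _ "Im (Ln w)"]) auto
      qed
      show "(\<lambda>t. exp (\<i> * of_real t)) ` {-pi/2<..<pi/2} \<subseteq> ?H"
        by (auto simp: Re_exp cos_gt_zero_pi)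
    qed
    moreover have "connected ((\<lambda>t. exp (\<i> * of_real t)) ` {-pi/2<..<pi/2::real})"
      by (intro connected_continuous_image continuous_intros connected_Ioo)
    ultimately have "connected ?H" by simp
    then have "?H \<subseteq> open_arc (-\<i>) \<i>" unfolding open_arc_def
      by (intro connected_component_maximal) (auto)
    then show ?thesis using x by auto
  qed
  let ?U = "ball 0 1 \<inter> {w. Re w > 0} :: complex set"
  have K: "?K \<inter> ?U = {}"
    unfolding closed_geodesic_i closed_arc_def using open_arc_i by auto
  have "frontier ?U \<subseteq> ?K"
  proof
    fix x assume x: "x \<in> frontier ?U"
    have "open ?U" by (intro open_Int open_ball open_halfspace_Re_gt)
    then have "x \<notin> ?U" using x frontier_disjoint_eq by blast
    have "closure ?U \<subseteq> cball 0 1 \<inter> {w. Re w \<ge> 0}"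
      by (rule closure_minimal) (auto intro!: closed_Int closed_halfspace_Re_ge)
    then have "norm x \<le> 1" "Re x \<ge> 0" using x by (auto simp: frontier_def)
    with \<open>x \<notin> ?U\<close> have "Re x = 0 \<or> norm x = 1 \<and> Re x > 0" by auto
    then show "x \<in> ?K" using arc \<open>norm x \<le> 1\<close> unfolding closed_geodesic_i closed_arc_def by auto
  qed
  have zU: "z \<in> ?U" using assms by auto
  let ?C = "connected_component_set (- ?K) z"
  have "?C \<subseteq> ?U"
  proof (rule ccontr)
    assume "\<not> ?C \<subseteq> ?U"
    moreover have "z \<in> ?C" using zU K by auto
    ultimately have "?C \<inter> ?U \<noteq> {}" "?C - ?U \<noteq> {}" using zU by blast+
    then have "?C \<inter> frontier ?U \<noteq> {}"
      by (rule connected_Int_frontier[OF connected_connected_component])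
    then obtain x where "x \<in> ?C" "x \<in> ?K" using \<open>frontier ?U \<subseteq> ?K\<close> by auto
    then show False using connected_component_subset[of "- ?K" z] by auto
  qed
  then have "bounded ?C" by (meson bounded_Int bounded_ball bounded_subset)
  moreover have "z \<notin> ?K" using zU K by blast
  ultimately show ?thesis unfolding Reg_def inside_def by blast
qed

text \<open>From a point off the open ball and off \<open>K\<close> the outward radial ray avoids
  \<open>K\<close> and is unbounded.\<close>

lemma inside_subset_ball:
  fixes K :: "'a::euclidean_space set"
  assumes "K \<subseteq> cball 0 1"
  shows "inside K \<subseteq> ball 0 1"
proof
  fix z assume z: "z \<in> inside K"
  show "z \<in> ball 0 1"
  proof (rule ccontr)
    assume "z \<notin> ball 0 1"
    then have nz: "norm z \<ge> 1" by simp
    let ?R = "(\<lambda>t. t *\<^sub>R z) ` {1..}"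
    have "connected ?R" by (intro connected_continuous_image continuous_intros connected_Ici)
    have "z \<notin> K" using z inside_no_overlap by blast
    have "?R \<subseteq> - K"
    proof
      fix y assume "y \<in> ?R"
      then obtain t where t: "t \<ge> 1" "y = t *\<^sub>R z" by auto
      show "y \<in> - K"
      proof (cases "t = 1")
        case False
        then have "1 * 1 < t * norm z" using t nz by (intro mult_less_le_imp_less) auto
        then show ?thesis using t assms by auto
      qed (use t \<open>z \<notin> K\<close> in auto)
    qed
    moreover have "z \<in> ?R" by (rule image_eqI[of _ _ 1]) auto
    ultimately have "?R \<subseteq> connected_component_set (- K) z"
      using \<open>connected ?R\<close> by (intro connected_component_maximal)
    moreover have "bounded (connected_component_set (- K) z)" using z by (simp add: inside_def)
    ultimately have "bounded ?R" by (rule bounded_subset[rotated])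
    then obtain M where M: "\<And>t. t \<ge> 1 \<Longrightarrow> norm (t *\<^sub>R z) \<le> M" unfolding bounded_iff by auto
    have "(\<bar>M\<bar> + 1) * 1 \<le> (\<bar>M\<bar> + 1) * norm z" using nz by (intro mult_left_mono) auto
    then show False using M[of "\<bar>M\<bar> + 1"] by auto
  qed
qed

text \<open>For arbitrary end points this puts the \<open>z n\<close> of Condition 2 into the image
  of the open disc, where \<open>inv_into\<close> is a genuine inverse of
  \<open>\<phi>\<close>.\<close>

lemma Reg_subset_ball:
  assumes "norm x1 = 1" "norm x2 = 1"
  shows "Reg x1 x2 \<subseteq> ball 0 1"
  unfolding Reg_def
proof (rule inside_subset_ball)
  have "open_arc x1 x2 \<subseteq> sphere 0 1"
    unfolding open_arc_def using connected_component_subset by blast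
  then show "closed_arc x1 x2 \<union> closed_geodesic x1 x2 \<subseteq> cball 0 1"
    using assms unfolding closed_arc_def closed_geodesic_def poincare_geodesic_line_def
    by (auto simp: subset_iff less_imp_le)
qed

subsection \<open>The trace of the boundary on a small disc\<close>

lemma cik_locally_connected:
  fixes S :: "'a::metric_space set"
  assumes "locally connected S" "s \<in> S"
  shows "connected_im_kleinen S s"
proof (rule connected_im_kleinen_openin)
  fix e :: real assume "e > 0"
  then have "openin (top_of_set S) (S \<inter> ball s e)" "s \<in> S \<inter> ball s e"
    using assms(2) by (auto simp: openin_open_Int)
  then show "\<exists>U. openin (top_of_set S) U \<and> connected U \<and> s \<in> U \<and> U \<subseteq> S \<inter> ball s e"
    using assms(1) unfolding locally_connected by metis
qed

text \<open>Closures of connected sets are connected, so the neighbourhood can be taken closed, as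
  Janiszewski's theorem demands.\<close>

lemma connected_im_kleinen_closedE:
  fixes X :: "'a::heine_borel set"
  assumes "connected_im_kleinen X s" "closed X" "e > 0"
  obtains d Y where "d > 0" "d \<le> e" "closed Y" "connected Y" "X \<inter> ball s d \<subseteq> Y" "Y \<subseteq> X" "Y \<subseteq> cball s e"
proof -
  obtain d Y where Y: "d > 0" "connected Y" "X \<inter> ball s d \<subseteq> Y" "Y \<subseteq> X \<inter> ball s e"
    using assms unfolding connected_im_kleinen_def by meson
  have "closure Y \<subseteq> X" using Y assms(2) by (meson closure_minimal le_inf_iff)
  moreover have "closure Y \<subseteq> cball s e" using Y ball_subset_cball by (intro closure_minimal) auto
  moreover have "X \<inter> ball s (min d e) \<subseteq> closure Y" using Y closure_subset by fastforce
  ultimately show ?thesis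
    using that[of "min d e" "closure Y"] Y assms(3) connected_imp_connected_closure[OF Y(2)] by simp
qed

text \<open>The circle is added to make the trace connected. Nearest-point
  projection onto the disc maps small connected subsets of \<open>F\<close> to small connected subsets of it.\<close>

definition disc_trace :: "complex set \<Rightarrow> complex \<Rightarrow> real \<Rightarrow> complex set" where
  "disc_trace F p r = F \<inter> cball p r \<union> sphere p r"

lemma compact_disc_trace: "closed F \<Longrightarrow> compact (disc_trace F p r)"
  unfolding disc_trace_def by (intro compact_Un closed_Int_compact) auto

lemma closest_point_sphere:
  fixes p :: "'a::euclidean_space"
  assumes "r > 0" "x \<notin> ball p r"
  shows "closest_point (cball p r) x \<in> sphere p r"
proof (cases "x \<in> cball p r")
  case True
  then show ?thesis using assms by (simp add: closest_point_self)
next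
  case False
  then show ?thesis
    using closest_point_in_rel_frontier[of "cball p r" x] assms
    by (simp add: affine_hull_nonempty_interior rel_interior_nonempty_interior)
qed

lemma closest_point_disc_trace:
  assumes "r > 0" "x \<in> F"
  shows "closest_point (cball p r) x \<in> disc_trace F p r"
proof (cases "x \<in> cball p r")
  case True
  then show ?thesis using assms by (simp add: closest_point_self disc_trace_def)
next
  case False
  then show ?thesis using closest_point_sphere[OF assms(1), of x p] by (auto simp: disc_trace_def)
qed

lemma connected_closest_point_image:
  fixes p :: "'a::euclidean_space"
  assumes "r > 0" "connected Y"
  shows "connected (closest_point (cball p r) ` Y)"
proof (rule connected_continuous_image)
  show "continuous_on Y (closest_point (cball p r))"
    using assms by (intro continuous_on_closest_point) auto
qed (rule assms)

text \<open>The projection of the connected set \<open>U\<close> meets the circle because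
  \<open>u\<close> is not in the open disc; together with the circle this projection is the whole
  trace.\<close>

lemma connected_disc_trace:
  assumes "r > 0" "connected U" "F \<inter> cball p r \<subseteq> U" "U \<subseteq> F" "u \<in> U" "u \<notin> ball p r"
  shows "connected (disc_trace F p r)"
proof -
  let ?\<rho> = "closest_point (cball p r)"
  have "disc_trace F p r = ?\<rho> ` U \<union> sphere p r"
  proof
    show "disc_trace F p r \<subseteq> ?\<rho> ` U \<union> sphere p r"
    proof
      fix x assume "x \<in> disc_trace F p r"
      then show "x \<in> ?\<rho> ` U \<union> sphere p r"
        using assms(3) closest_point_self[of x "cball p r"] unfolding disc_trace_def by (metis IntD2 Un_iff image_eqI subsetD)
    qed
    show "?\<rho> ` U \<union> sphere p r \<subseteq> disc_trace F p r"
    proof -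
      have "?\<rho> ` U \<subseteq> disc_trace F p r"
        using closest_point_disc_trace[OF assms(1)] assms(4) by blast
      then show ?thesis by (auto simp: disc_trace_def)
    qed
  qed
  moreover have "connected (?\<rho> ` U \<union> sphere p r)"
  proof (rule connected_Un)
    show "connected (?\<rho> ` U)" using connected_closest_point_image assms by blast
    show "connected (sphere p r)" by (rule connected_sphere) simp
    show "?\<rho> ` U \<inter> sphere p r \<noteq> {}" using closest_point_sphere[OF assms(1,6)] assms(5) by blast
  qed
  ultimately show ?thesis by simp
qed

text \<open>Inside the disc the trace is locally \<open>F\<close>, and at a point of the circle off
  \<open>F\<close> it is locally the circle. At a common point \<open>s\<close>, an arc of the
  circle and the projection of a connected piece of \<open>F\<close> are joined at \<open>s\<close>;
  the projection is 1-Lipschitz and fixes \<open>s\<close>, so the union remains small.\<close>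

lemma cik_disc_trace:
  assumes "closed F" "r > 0" and cik: "\<And>q. q \<in> F \<inter> cball p r \<Longrightarrow> connected_im_kleinen F q"
    and s: "s \<in> disc_trace F p r"
  shows "connected_im_kleinen (disc_trace F p r) s"
  unfolding connected_im_kleinen_def
proof (intro allI impI)
  fix e :: real assume e: "e > 0"
  let ?X = "disc_trace F p r" and ?\<rho> = "closest_point (cball p r)"
  have \<rho>: "?\<rho> x = x" if "x \<in> cball p r" for x using that by (rule closest_point_self)
  have scb: "s \<in> cball p r" using s by (auto simp: disc_trace_def)
  show "\<exists>d>0. \<exists>Y. connected Y \<and> ?X \<inter> ball s d \<subseteq> Y \<and> Y \<subseteq> ?X \<inter> ball s e"
  proof (cases "s \<in> sphere p r")
    case False
    then have sF: "s \<in> F" and "dist p s < r" using s by (auto simp: disc_trace_def)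
    define e' where "e' = min e (r - dist p s)"
    have e': "e' > 0" "e' \<le> e" "e' \<le> r - dist p s" using e \<open>dist p s < r\<close> by (auto simp: e'_def)
    have sub: "ball s e' \<subseteq> ball p r"
    proof
      fix x assume "x \<in> ball s e'"
      then show "x \<in> ball p r" using dist_triangle[of p x s] e' by auto
    qed
    obtain d Y where Y: "d > 0" "connected Y" "F \<inter> ball s d \<subseteq> Y" "Y \<subseteq> F \<inter> ball s e'"
      using cik[of s] sF scb e' unfolding connected_im_kleinen_def by (meson IntI)
    have "?X \<inter> ball s (min d e') \<subseteq> Y" using Y sub by (auto simp: disc_trace_def)
    moreover have "Y \<subseteq> ?X \<inter> ball s e" using Y sub e' by (fastforce simp: disc_trace_def)
    ultimately show ?thesis using Y e' by (intro exI[of _ "min d e'"]) auto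
  next
    case True
    then obtain d1 Y1 where Y1: "d1 > 0" "connected Y1" "sphere p r \<inter> ball s d1 \<subseteq> Y1" "Y1 \<subseteq> sphere p r \<inter> ball s e"
      using cik_locally_connected[OF locally_connected_sphere True] e unfolding connected_im_kleinen_def by meson
    have sY1: "s \<in> Y1" using Y1 True by auto
    show ?thesis
    proof (cases "s \<in> F")
      case False
      then obtain d2 where d2: "d2 > 0" "ball s d2 \<subseteq> - F"
        using \<open>closed F\<close> by (metis ComplI open_Compl open_contains_ball)
      have "?X \<inter> ball s (min d1 d2) \<subseteq> Y1" using Y1 d2 by (fastforce simp: disc_trace_def)
      moreover have "Y1 \<subseteq> ?X \<inter> ball s e" using Y1 by (auto simp: disc_trace_def)
      ultimately show ?thesis using Y1 d2 by (intro exI[of _ "min d1 d2"]) auto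
    next
      case sF: True
      obtain d2 Y2 where Y2: "d2 > 0" "connected Y2" "F \<inter> ball s d2 \<subseteq> Y2" "Y2 \<subseteq> F \<inter> ball s e"
        using cik[of s] sF scb e unfolding connected_im_kleinen_def by (meson IntI)
      have "s \<in> Y2" using Y2 sF by auto
      then have s\<rho>: "s \<in> ?\<rho> ` Y2" using \<rho>[OF scb] by (metis image_eqI)
      have "connected (?\<rho> ` Y2 \<union> Y1)"
        using connected_closest_point_image[OF assms(2) Y2(2)] Y1(2) s\<rho> sY1 by (intro connected_Un) auto
      moreover have "?X \<inter> ball s (min d1 d2) \<subseteq> ?\<rho> ` Y2 \<union> Y1"
      proof
        fix x assume x: "x \<in> ?X \<inter> ball s (min d1 d2)"
        show "x \<in> ?\<rho> ` Y2 \<union> Y1"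
        proof (cases "x \<in> sphere p r")
          case True
          then show ?thesis using x Y1 by auto
        next
          case False
          then have "x \<in> F" "x \<in> cball p r" using x by (auto simp: disc_trace_def)
          then have "x \<in> Y2" using x Y2 by auto
          then show ?thesis using \<rho>[OF \<open>x \<in> cball p r\<close>] by (metis UnI1 image_eqI)
        qed
      qed
      moreover have "?\<rho> ` Y2 \<union> Y1 \<subseteq> ?X \<inter> ball s e"
      proof -
        have "?\<rho> y \<in> ball s e" if "y \<in> Y2" for y
        proof -
          have "dist (?\<rho> s) (?\<rho> y) \<le> dist s y"
            using assms(2) by (intro closest_point_lipschitz) auto
          then show ?thesis using \<rho>[OF scb] that Y2 by auto
        qed
        moreover have "?\<rho> y \<in> ?X" if "y \<in> Y2" for y
          using closest_point_disc_trace[OF assms(2)] that Y2 by blast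
        moreover have "Y1 \<subseteq> ?X" using Y1 by (auto simp: disc_trace_def)
        ultimately show ?thesis using Y1 by blast
      qed
      ultimately show ?thesis using Y1 Y2 by (intro exI[of _ "min d1 d2"] conjI exI[of _ "?\<rho> ` Y2 \<union> Y1"]) auto
    qed
  qed
qed

section \<open>Separation in the plane by small sets\<close>

text \<open>The complement of a disc is connected, so a set \<open>T\<close> inside the disc does
  not separate points outside. In applications \<open>T\<close> is a small cut together with a
  connected piece of \<open>X\<close> that contains all points where the cut meets
  \<open>X\<close>.\<close>

lemma Janiszewski_small:
  fixes X :: "complex set"
  assumes "compact X" "closed T" "connected (X \<inter> T)" "T \<subseteq> cball s e"
    and "u \<notin> cball s e" "v \<notin> cball s e" "connected_component (- X) u v"
  shows "connected_component (- (X \<union> T)) u v"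
proof (rule Janiszewski[OF assms(1,2,3,7)])
  have "connected (- cball s e)" by (rule connected_complement_bounded_convex) auto
  then show "connected_component (- T) u v"
    using assms(4-6) unfolding connected_component_def by (intro exI[of _ "- cball s e"]) auto
qed

text \<open>Connectedness of \<open>X\<close> makes the complement of \<open>G\<close> connected,
  and it is unbounded, so \<open>G\<close> has no holes. Being homeomorphic to the plane,
  \<open>G\<close> inherits the separation theorems of the plane.\<close>

lemma component_simply_connected:
  fixes X :: "complex set"
  assumes "closed X" "connected X" "G \<in> components (- X)" "bounded G"
  shows "open G" "connected G" "simply_connected G" "G homeomorphic (UNIV :: complex set)" "closure G \<subseteq> G \<union> X"
proof -
  show oG: "open G" using assms open_components by blast
  show cG: "connected G" using assms in_components_connected by blast
  have "connected (- G)" using component_complement_connected assms by blast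
  moreover have "\<not> bounded (- G)" using assms(4) cobounded_imp_unbounded by fastforce
  ultimately have "\<forall>C \<in> components (- G). \<not> bounded C"
    by (metis components_eq_sing_iff components_empty empty_iff singletonD)
  then show sc: "simply_connected G"
    using simply_connected_eq_unbounded_complement_components[OF oG] cG by blast
  have "G \<noteq> {}" using assms(3) in_components_nonempty by blast
  then have "G homeomorphic ball (0::complex) 1"
    using sc simply_connected_eq_homeomorphic_to_disc[OF oG] by blast
  then show "G homeomorphic (UNIV :: complex set)"
    using homeomorphic_ball_UNIV[of 1 "0::complex"] homeomorphic_trans by (metis zero_less_one)
  have "closedin (top_of_set (- X)) G" using assms(3) closedin_component by blast
  then obtain T where "closed T" "G = - X \<inter> T" unfolding closedin_closed by blast
  then have "closure G \<subseteq> T" by (simp add: closure_minimal)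
  then show "closure G \<subseteq> G \<union> X" using \<open>G = _\<close> by blast
qed

text \<open>In the plane, some component of a closed separating set already separates the two
  points; the homeomorphism carries this over, with closedness understood relative to
  \<open>G\<close>.\<close>

lemma connected_separator:
  fixes G :: "'a::real_normed_vector set"
  assumes hom: "G homeomorphic (UNIV :: complex set)" and S: "closedin (top_of_set G) S"
    and uv: "u \<in> G" "v \<in> G" and sep: "\<not> connected_component (G - S) u v"
  obtains C where "connected C" "C \<subseteq> S" "closedin (top_of_set G) C" "\<not> connected_component (G - C) u v"
proof -
  obtain h k where hk: "homeomorphism G (UNIV :: complex set) h k" using hom unfolding homeomorphic_def by blast
  have cont: "continuous_on G h" "continuous_on UNIV k" and kh: "\<And>x. x \<in> G \<Longrightarrow> k (h x) = x" "\<And>y. h (k y) = y" "\<And>y. k y \<in> G"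
    using hk unfolding homeomorphism_def by auto
  have SG: "S \<subseteq> G" using S closedin_imp_subset by blast
  have "closed (h ` S)"
    using homeomorphism_imp_closed_map[OF hk S] by simp
  moreover have "\<not> connected_component (- h ` S) (h u) (h v)"
  proof
    assume "connected_component (- h ` S) (h u) (h v)"
    then obtain W where W: "connected W" "W \<subseteq> - h ` S" "h u \<in> W" "h v \<in> W" unfolding connected_component_def by blast
    have "connected (k ` W)" using W(1) cont(2) by (meson connected_continuous_image continuous_on_subset subset_UNIV)
    moreover have "k ` W \<subseteq> G - S"
    proof
      fix x assume "x \<in> k ` W"
      then obtain w where w: "w \<in> W" "x = k w" by blast
      then have "h x \<notin> h ` S" using W(2) kh(2) by auto
      then show "x \<in> G - S" using w kh(3) by blast
    qed
    moreover have "u \<in> k ` W" "v \<in> k ` W" using W(3,4) kh(1) uv by (auto intro: rev_image_eqI)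
    ultimately show False using sep unfolding connected_component_def by blast
  qed
  ultimately obtain D where D: "D \<in> components (h ` S)" "\<not> connected_component (- D) (h u) (h v)"
    using separation_by_component_closed_pointwise by blast
  have DS: "D \<subseteq> h ` S" using D(1) in_components_subset by blast
  have "closed D" using D(1) \<open>closed (h ` S)\<close> closed_components by blast
  show ?thesis
  proof
    show "connected (k ` D)" using in_components_connected[OF D(1)] cont(2)
      by (meson connected_continuous_image continuous_on_subset subset_UNIV)
    show "k ` D \<subseteq> S" using DS SG kh(1) by force
    show "closedin (top_of_set G) (k ` D)"
      using homeomorphism_imp_closed_map[OF homeomorphism_symD[OF hk], of D] \<open>closed D\<close> by simp
    show "\<not> connected_component (G - k ` D) u v"
    proof
      assume "connected_component (G - k ` D) u v"
      then obtain W where W: "connected W" "W \<subseteq> G - k ` D" "u \<in> W" "v \<in> W" unfolding connected_component_def by blast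
      have "connected (h ` W)" using W cont(1) by (intro connected_continuous_image) (auto intro: continuous_on_subset)
      moreover have "h ` W \<subseteq> - D"
      proof
        fix y assume "y \<in> h ` W"
        then obtain w where w: "w \<in> W" "y = h w" by blast
        then have "k y \<notin> k ` D" using W(2) kh(1) by auto
        then show "y \<in> - D" by blast
      qed
      ultimately show False using D(2) W unfolding connected_component_def by blast
    qed
  qed
qed

text \<open>For a common point \<open>z\<close>, the number \<open>(z - p) * cnj (s - p)\<close> has
  a fixed modulus and, by the law of cosines, a fixed real part, which leaves two values.\<close>

lemma finite_sphere_inter:
  fixes p s :: complex
  assumes "p \<noteq> s"
  shows "finite (sphere p R \<inter> sphere s d)"
proof -
  define a where "a = s - p"
  have a: "a \<noteq> 0" using assms by (simp add: a_def)
  define c where "c = (R\<^sup>2 + (norm a)\<^sup>2 - d\<^sup>2) / 2"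
  define y where "y = sqrt (R\<^sup>2 * (norm a)\<^sup>2 - c\<^sup>2)"
  have "sphere p R \<inter> sphere s d \<subseteq> (\<lambda>w. p + w / cnj a) ` {Complex c y, Complex c (- y)}"
  proof
    fix z assume "z \<in> sphere p R \<inter> sphere s d"
    then have R: "norm (z - p) = R" and d: "norm (z - s) = d" by (auto simp: dist_norm norm_minus_commute)
    define w where "w = (z - p) * cnj a"
    have "d\<^sup>2 = (norm ((z - p) - a))\<^sup>2" using d by (simp add: a_def)
    also have "\<dots> = R\<^sup>2 + (norm a)\<^sup>2 - 2 * Re w"
      unfolding R[symmetric] w_def by (simp add: cmod_power2) (simp add: power2_eq_square algebra_simps)
    finally have Re: "Re w = c" by (simp add: c_def)
    have "norm w = R * norm a" using R by (simp add: w_def norm_mult)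
    then have "(Re w)\<^sup>2 + (Im w)\<^sup>2 = R\<^sup>2 * (norm a)\<^sup>2" by (metis cmod_power2 power_mult_distrib)
    then have "(Im w)\<^sup>2 = R\<^sup>2 * (norm a)\<^sup>2 - c\<^sup>2" using Re by simp
    then have "\<bar>Im w\<bar> = y" unfolding y_def by (metis real_sqrt_abs)
    then have "w = Complex c y \<or> w = Complex c (- y)" using Re by (auto simp: complex_eq_iff)
    moreover have "z = p + w / cnj a" using a by (simp add: w_def)
    ultimately show "z \<in> (\<lambda>w. p + w / cnj a) ` {Complex c y, Complex c (- y)}" by blast
  qed
  then show ?thesis by (rule finite_subset) simp
qed

text \<open>The ball comes before \<open>\<Omega>\<close>, because the trace contains the frontier
  of \<open>\<Omega>\<close> only inside the closed disc.\<close>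

lemma component_subset_domain:
  fixes \<Omega> :: "complex set"
  assumes "open \<Omega>" "r > 0" "G \<in> components (- disc_trace (frontier \<Omega>) p r)" "w \<in> G" "w \<in> \<Omega>" "w \<in> ball p r"
  shows "G \<subseteq> \<Omega>" "G \<subseteq> ball p r"
proof -
  have cG: "connected G" using assms in_components_connected by blast
  have sub: "G \<subseteq> - disc_trace (frontier \<Omega>) p r" using assms in_components_subset by blast
  have "G \<inter> frontier (ball p r) = {}" using sub assms(2) by (auto simp: disc_trace_def)
  then show *: "G \<subseteq> ball p r" using connected_Int_frontier[OF cG, of "ball p r"] assms(4,6) by blast
  then have "G \<inter> frontier \<Omega> = {}" using sub by (force simp: disc_trace_def)
  then show "G \<subseteq> \<Omega>" using connected_Int_frontier[OF cG, of \<Omega>] assms(4,5) by blast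
qed

text \<open>If infinitely many components of the complement of the trace had points near the centre,
  then each would be crossed by a connected piece of the circle of radius \<open>r/2\<close>; such pieces
  accumulate at a point where the trace is connected im kleinen, contradicting Janiszewski.\<close>

lemma infinitely_many_in_one_component:
  fixes \<Omega> :: "complex set"
  assumes \<Omega>: "open \<Omega>" "connected \<Omega>" "\<not> \<Omega> \<subseteq> cball p r" and r: "r > 0"
    and conn: "connected (disc_trace (frontier \<Omega>) p r)"
    and cik: "\<And>s. s \<in> disc_trace (frontier \<Omega>) p r \<Longrightarrow> connected_im_kleinen (disc_trace (frontier \<Omega>) p r) s"
    and z: "\<And>n::nat. z n \<in> \<Omega>" "z \<longlonglongrightarrow> p"
  obtains G where "G \<in> components (- disc_trace (frontier \<Omega>) p r)" "G \<subseteq> \<Omega>" "G \<subseteq> ball p r" "infinite {n. z n \<in> G}"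
proof -
  define X where "X = disc_trace (frontier \<Omega>) p r"
  have compX: "compact X" by (simp add: X_def compact_disc_trace)
  then have clX: "closed X" by (rule compact_imp_closed)
  have "\<forall>\<^sub>F n in sequentially. z n \<in> ball p (r/4)"
    using z(2) r by (intro topological_tendstoD) auto
  then obtain N where N: "\<And>n. n \<ge> N \<Longrightarrow> z n \<in> ball p (r/4)" unfolding eventually_sequentially by blast
  define comp where "comp n = connected_component_set (- X) (z n)" for n
  have zX: "z n \<in> - X" if "n \<ge> N" for n
  proof -
    have "z n \<notin> frontier \<Omega>" using z(1) \<Omega>(1) by (auto simp: frontier_def interior_open)
    moreover have "z n \<notin> sphere p r" using N[OF that] r by auto
    ultimately show ?thesis by (auto simp: X_def disc_trace_def)
  qed
  have zcomp: "z n \<in> comp n" "comp n \<in> components (- X)" if "n \<ge> N" for n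
    using zX[OF that] by (auto simp: comp_def components_def)
  have rr: "z n \<in> ball p r" if "n \<ge> N" for n using N[OF that] r by auto
  have sub: "comp n \<subseteq> \<Omega>" "comp n \<subseteq> ball p r" if "n \<ge> N" for n
    using component_subset_domain[OF \<Omega>(1) r, of "comp n" p "z n"] zcomp[OF that] rr[OF that] z(1) unfolding X_def by auto
  have fin: "finite (comp ` {N..})"
  proof (rule ccontr)
    assume inf: "infinite (comp ` {N..})"
    define \<G> where "\<G> = comp ` {N..}"
    let ?S = "sphere p (r/2)"
    have Gcomp: "G \<in> components (- X)" if "G \<in> \<G>" for G using that zcomp by (auto simp: \<G>_def)
    have Gsub: "G \<subseteq> \<Omega>" "G \<subseteq> ball p r" if "G \<in> \<G>" for G using that sub by (auto simp: \<G>_def)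
    have Gprops: "open G" "connected G" "G homeomorphic (UNIV::complex set)" "closure G \<subseteq> G \<union> X" if "G \<in> \<G>" for G
    proof -
      have "connected X" "bounded G" using conn bounded_subset[OF bounded_ball Gsub(2)[OF that]] by (auto simp: X_def)
      then show "open G" "connected G" "G homeomorphic (UNIV::complex set)" "closure G \<subseteq> G \<union> X"
        using component_simply_connected[OF clX _ Gcomp[OF that]] by blast+
    qed
    have Gin: "connected_component_set (- X) x = G" if "G \<in> \<G>" "x \<in> G" for x G
      using Gcomp[OF that(1)] that(2) by (metis connected_component_eq components_iff)
    have "\<exists>a b C i. a \<in> G \<and> b \<in> G \<and> a \<in> ball p (r/4) \<and> b \<notin> cball p (3*r/4) \<and> connected C \<and> C \<subseteq> G \<inter> ?S \<and>
        closedin (top_of_set G) C \<and> \<not> connected_component (G - C) a b \<and> i \<in> C" if G: "G \<in> \<G>" for G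
    proof -
      obtain n where n: "n \<ge> N" "G = comp n" using G by (auto simp: \<G>_def)
      then have a: "z n \<in> G" "z n \<in> ball p (r/4)" using zcomp N by auto
      \<comment> \<open>Otherwise the closure of \<open>G\<close> would miss the outer circle and
        meet \<open>\<Omega>\<close> only in \<open>G\<close>; then \<open>G\<close> would be clopen
        in \<open>\<Omega>\<close> and equal to it, although \<open>\<Omega>\<close> leaves the
        disc.\<close>
      have "\<not> G \<subseteq> cball p (3*r/4)"
      proof
        assume *: "G \<subseteq> cball p (3*r/4)"
        have "closure G \<subseteq> cball p (3*r/4)" using * by (simp add: closure_minimal)
        then have "closure G \<inter> sphere p r = {}" using r by auto
        then have "closure G \<inter> \<Omega> \<subseteq> G"
          using Gprops(4)[OF G] \<Omega>(1) unfolding X_def disc_trace_def by (auto simp: frontier_def interior_open)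
        then have "G = \<Omega> \<inter> closure G" using Gsub(1)[OF G] closure_subset by blast
        then have "closedin (top_of_set \<Omega>) G" by (metis closed_closure closedin_closed_Int)
        moreover have "openin (top_of_set \<Omega>) G"
          using Gprops(1)[OF G] Gsub(1)[OF G] by (simp add: open_subset)
        ultimately have "G = \<Omega>" using \<Omega>(2) a(1) unfolding connected_clopen by blast
        then show False using \<Omega>(3) Gsub(2)[OF G] by auto
      qed
      then obtain b where b: "b \<in> G" "b \<notin> cball p (3*r/4)" by blast
      have "closedin (top_of_set G) (G \<inter> ?S)" by (simp add: closedin_closed_Int)
      moreover have "\<not> connected_component (G - G \<inter> ?S) (z n) b"
      proof
        assume "connected_component (G - G \<inter> ?S) (z n) b"
        then obtain W where W: "connected W" "W \<subseteq> G - G \<inter> ?S" "z n \<in> W" "b \<in> W"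
          unfolding connected_component_def by blast
        have "z n \<in> W \<inter> ball p (r/2)" "b \<in> W - ball p (r/2)" using W a b r by auto
        then have "W \<inter> frontier (ball p (r/2)) \<noteq> {}" using W(1) by (intro connected_Int_frontier) auto
        then show False using W r by auto
      qed
      ultimately obtain C where C: "connected C" "C \<subseteq> G \<inter> ?S" "closedin (top_of_set G) C" "\<not> connected_component (G - C) (z n) b"
        using connected_separator[OF Gprops(3)[OF G]] a b by metis
      have "C \<noteq> {}" using C(4) Gprops(2)[OF G] a b unfolding connected_component_def by auto
      then show ?thesis using a b C by blast
    qed
    then obtain A B C i where ABC: "\<And>G. G \<in> \<G> \<Longrightarrow> A G \<in> G \<and> B G \<in> G \<and> A G \<in> ball p (r/4) \<and> B G \<notin> cball p (3*r/4) \<and>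
        connected (C G) \<and> C G \<subseteq> G \<inter> ?S \<and> closedin (top_of_set G) (C G) \<and>
        \<not> connected_component (G - C G) (A G) (B G) \<and> i G \<in> C G"
      by metis
    have iG: "i G \<in> G" "i G \<in> ?S" if "G \<in> \<G>" for G using ABC[OF that] by auto
    have inj: "inj_on i \<G>" by (rule inj_onI) (metis Gin iG(1))
    then have "infinite (i ` \<G>)" using inf unfolding \<G>_def by (simp add: finite_image_iff)
    moreover have "i ` \<G> \<subseteq> ?S" using iG by blast
    ultimately obtain s where s: "s \<in> ?S" "s islimpt (i ` \<G>)"
      using Heine_Borel_imp_Bolzano_Weierstrass[OF compact_sphere] by metis
    \<comment> \<open>A disc around \<open>s\<close> that avoids \<open>X\<close> would lie in a
      single component, but infinitely many components have their marked point \<open>i G\<close> in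
      it.\<close>
    have sX: "s \<in> X"
    proof (rule ccontr)
      assume "s \<notin> X"
      then obtain e where e: "e > 0" "ball s e \<subseteq> - X" using clX by (metis ComplI open_Compl open_contains_ball)
      have inf': "infinite (i ` \<G> \<inter> ball s e)" using s e unfolding islimpt_eq_infinite_ball by blast
      have "G = connected_component_set (- X) s" if "G \<in> \<G>" "i G \<in> ball s e" for G
      proof -
        have "connected_component (- X) s (i G)"
          unfolding connected_component_def using e that by (intro exI[of _ "ball s e"]) auto
        then show ?thesis using Gin[OF that(1) iG(1)[OF that(1)]] connected_component_eq by blast
      qed
      then have "i ` \<G> \<inter> ball s e \<subseteq> {i (connected_component_set (- X) s)}" by blast
      then show False using inf' by (meson finite.emptyI finite.insertI finite_subset)
    qed
    \<comment> \<open>As \<open>s\<close> is at distance \<open>r/2\<close> from \<open>p\<close>,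
      the radius \<open>r/8\<close> keeps the disc around \<open>s\<close> away from all
      \<open>A G\<close> and all \<open>B G\<close>.\<close>
    obtain d Y where Y: "d > 0" "d \<le> r/8" "closed Y" "connected Y" "X \<inter> ball s d \<subseteq> Y" "Y \<subseteq> X" "Y \<subseteq> cball s (r/8)"
      using connected_im_kleinen_closedE[OF cik[of s] _ ] sX clX r unfolding X_def by (metis divide_pos_pos zero_less_numeral)
    \<comment> \<open>A connected piece of the circle that leaves \<open>ball s (d/2)\<close> passes
      through one of the finitely many points of \<open>P\<close>, and each of these lies in at most
      one component. So infinitely many separators stay in that ball, and one of them
      suffices.\<close>
    define P where "P = ?S \<inter> sphere s (d/2)"
    have "p \<noteq> s" using s r by auto
    then have "finite P" unfolding P_def by (rule finite_sphere_inter)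
    have finP: "finite {G \<in> \<G>. C G \<inter> P \<noteq> {}}"
    proof (rule finite_subset)
      show "{G \<in> \<G>. C G \<inter> P \<noteq> {}} \<subseteq> (\<lambda>x. connected_component_set (- X) x) ` P"
      proof
        fix G assume "G \<in> {G \<in> \<G>. C G \<inter> P \<noteq> {}}"
        then obtain x where "G \<in> \<G>" "x \<in> C G" "x \<in> P" by blast
        then show "G \<in> (\<lambda>x. connected_component_set (- X) x) ` P"
          using Gin ABC by (metis IntD1 image_eqI subsetD)
      qed
    qed (simp add: \<open>finite P\<close>)
    have "infinite (i ` \<G> \<inter> ball s (d/2))" using s Y unfolding islimpt_eq_infinite_ball by simp
    moreover have "i ` \<G> \<inter> ball s (d/2) \<subseteq> i ` {G \<in> \<G>. i G \<in> ball s (d/2)}" by blast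
    ultimately have "infinite {G \<in> \<G>. i G \<in> ball s (d/2)}" by (meson finite_imageI finite_subset)
    then have "infinite ({G \<in> \<G>. i G \<in> ball s (d/2)} - {G \<in> \<G>. C G \<inter> P \<noteq> {}})"
      by (rule Diff_infinite_finite[OF finP])
    then obtain G where G: "G \<in> \<G>" "i G \<in> ball s (d/2)" "C G \<inter> P = {}"
      using infinite_imp_nonempty by blast
    note g = ABC[OF G(1)]
    have "C G \<inter> frontier (ball s (d/2)) = {}" using g G(3) Y(1) unfolding P_def by auto
    then have "C G \<subseteq> ball s (d/2)" using connected_Int_frontier[of "C G" "ball s (d/2)"] g G(2) by blast
    then have cC: "closure (C G) \<subseteq> cball s (d/2)" using ball_subset_cball by (intro closure_minimal) auto
    define T where "T = Y \<union> closure (C G)"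
    have "closed T" using Y by (simp add: T_def closed_Un)
    have "X \<inter> T = Y"
    proof
      have "X \<inter> closure (C G) \<subseteq> X \<inter> ball s d" using cC Y(1) by auto
      then show "X \<inter> T \<subseteq> Y" using Y(5) unfolding T_def by blast
    qed (use Y in \<open>auto simp: T_def\<close>)
    have Tc: "T \<subseteq> cball s (r/8)" using Y cC subset_cball[of "d/2" "r/8" s] unfolding T_def by auto
    have ds: "dist p s = r/2" using s by simp
    have aout: "A G \<notin> cball s (r/8)"
      using g ds r dist_triangle[of p s "A G"] by (auto simp: dist_commute)
    have bout: "B G \<notin> cball s (r/8)"
      using g ds r dist_triangle[of p "B G" s] by auto
    have "G \<subseteq> - X" using Gcomp[OF G(1)] in_components_subset by blast
    then have "connected_component (- X) (A G) (B G)"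
      using g Gprops(2)[OF G(1)] unfolding connected_component_def by blast
    then have "connected_component (- (X \<union> T)) (A G) (B G)"
      using Janiszewski_small[OF compX \<open>closed T\<close> _ Tc aout bout] \<open>X \<inter> T = Y\<close> Y by simp
    then obtain W where W: "connected W" "W \<subseteq> - (X \<union> T)" "A G \<in> W" "B G \<in> W" unfolding connected_component_def by blast
    have "W \<subseteq> connected_component_set (- X) (A G)" using W by (intro connected_component_maximal) auto
    then have "W \<subseteq> G" using Gin[OF G(1)] g by simp
    moreover have "W \<inter> C G = {}" using W closure_subset unfolding T_def by blast
    ultimately have "connected_component (G - C G) (A G) (B G)"
      using W unfolding connected_component_def by blast
    then show False using g by blast
  qed
  have "infinite {N..}" by (rule infinite_Ici)
  then obtain n0 where n0: "n0 \<ge> N" "infinite {n \<in> {N..}. comp n = comp n0}"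
    using pigeonhole_infinite[OF _ fin] by auto
  have "{n \<in> {N..}. comp n = comp n0} \<subseteq> {n. z n \<in> comp n0}" using zcomp by auto
  then have "infinite {n. z n \<in> comp n0}" using n0 finite_subset by blast
  then show ?thesis using that[of "comp n0"] zcomp[OF n0(1)] sub[OF n0(1)] unfolding X_def by blast
qed

subsection \<open>The Caratheodory extension theorem\<close>

text \<open>Areas of disjoint discs add up, and the area of the unit disc cancels as a common
  factor.\<close>

lemma sum_squares_disjoint_balls:
  fixes w :: "'i \<Rightarrow> complex"
  assumes "finite I" "\<And>i. i \<in> I \<Longrightarrow> r i \<ge> 0" "M \<ge> 0"
    and disj: "disjoint_family_on (\<lambda>i. ball (w i) (r i)) I"
    and sub: "\<And>i. i \<in> I \<Longrightarrow> ball (w i) (r i) \<subseteq> ball c M"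
  shows "(\<Sum>i\<in>I. (r i)\<^sup>2) \<le> M\<^sup>2"
proof -
  let ?u = "measure lborel (ball (0::complex) 1)"
  have "(\<Sum>i\<in>I. (r i)\<^sup>2) * ?u = (\<Sum>i\<in>I. measure lborel (ball (w i) (r i)))"
    unfolding sum_distrib_right using assms(2)
    by (intro sum.cong refl) (simp add: content_ball_conv_unit_ball[of "r _"])
  also have "\<dots> = measure lborel (\<Union>i\<in>I. ball (w i) (r i))"
    using assms(1) disj emeasure_bounded_finite[OF bounded_ball]
    by (intro measure_finite_Union[symmetric]) (auto simp: top.not_eq_extremum)
  also have "\<dots> \<le> measure lborel (ball c M)"
    using sub emeasure_bounded_finite[OF bounded_ball] assms(1)
    by (intro measure_mono_fmeasurable) (auto intro!: fmeasurableI sets.finite_UN)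
  also have "\<dots> = M\<^sup>2 * ?u" using content_ball_conv_unit_ball[OF assms(3), of c] by simp
  finally show ?thesis using content_ball_pos[of 1 "0::complex"] by simp
qed

text \<open>The factor in \<open>Bloch_lemma\<close>: if the derivative on a disc is at most twice
  its value at the centre, the image contains a disc around the image of the centre whose radius is
  this factor times the radius times the modulus of that derivative.\<close>

definition bloch_const :: real where "bloch_const = 3 - 2 * sqrt 2"

lemma bloch_const_pos: "bloch_const > 0"
proof -
  have "sqrt 2 < 3/2" by (rule real_less_lsqrt) (auto simp: power2_eq_square)
  then show ?thesis by (simp add: bloch_const_def)
qed

text \<open>An injective holomorphic map has a nonvanishing derivative. Where the derivative varies
  by less than a third of a reference value, two of its moduli are in a ratio of at most
  \<open>(4/3) / (2/3) = 2\<close>, the factor that Bloch's lemma allows; a Lebesgue number makes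
  the radius uniform.\<close>

lemma derivative_comparable_on_compact:
  fixes F :: "complex \<Rightarrow> complex"
  assumes F: "F holomorphic_on S" "open S" "inj_on F S" and K: "compact K" "K \<subseteq> S"
  obtains \<rho> where "\<rho> > 0" "\<And>z. z \<in> K \<Longrightarrow> cball z \<rho> \<subseteq> S"
    "\<And>z w. z \<in> K \<Longrightarrow> w \<in> cball z \<rho> \<Longrightarrow> norm (deriv F w) \<le> 2 * norm (deriv F z)"
proof -
  let ?D = "deriv F"
  have cont: "continuous_on S ?D"
    using F(1,2) by (intro holomorphic_on_imp_continuous_on holomorphic_deriv)
  define \<G> where "\<G> = {ball z e | z e. z \<in> K \<and> e > 0 \<and> ball z e \<subseteq> S \<and>
    (\<forall>w\<in>ball z e. norm (?D w - ?D z) < norm (?D z) / 3)}"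
  have "K \<subseteq> \<Union>\<G>"
  proof
    fix z assume z: "z \<in> K"
    then have zS: "z \<in> S" using K by blast
    then have "?D z \<noteq> 0" using F holomorphic_injective_imp_regular by blast
    then have "norm (?D z) / 3 > 0" by simp
    then obtain d where d: "d > 0" "\<And>w. w \<in> S \<Longrightarrow> dist w z < d \<Longrightarrow> dist (?D w) (?D z) < norm (?D z) / 3"
      using cont zS unfolding continuous_on_iff by meson
    obtain e where e: "e > 0" "ball z e \<subseteq> S" using F(2) zS open_contains_ball by blast
    have "ball z (min d e) \<in> \<G>"
      unfolding \<G>_def using z d e by (auto simp: dist_norm norm_minus_commute subset_iff intro!: exI[of _ z] exI[of _ "min d e"])
    moreover have "z \<in> ball z (min d e)" using d e by simp
    ultimately show "z \<in> \<Union>\<G>" by blast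
  qed
  moreover have "open G" if "G \<in> \<G>" for G using that by (auto simp: \<G>_def)
  ultimately obtain \<epsilon> where eps: "0 < \<epsilon>" "\<And>x. x \<in> K \<Longrightarrow> \<exists>G \<in> \<G>. ball x \<epsilon> \<subseteq> G"
    using Heine_Borel_lemma[OF K(1)] by metis
  have sub: "cball x (\<epsilon>/2) \<subseteq> ball x \<epsilon>" for x :: complex using eps(1) by auto
  show ?thesis
  proof
    show "\<epsilon>/2 > 0" using eps by simp
    fix z assume z: "z \<in> K"
    then obtain G where G: "G \<in> \<G>" "ball z \<epsilon> \<subseteq> G" using eps by blast
    then obtain x e where x: "G = ball x e" "ball x e \<subseteq> S" "\<And>w. w \<in> ball x e \<Longrightarrow> norm (?D w - ?D x) < norm (?D x) / 3"
      unfolding \<G>_def by blast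
    show "cball z (\<epsilon>/2) \<subseteq> S" using sub G x by blast
    fix w assume "w \<in> cball z (\<epsilon>/2)"
    then have "w \<in> ball z \<epsilon>" "z \<in> ball z \<epsilon>" using sub[of z] eps(1) by auto
    then have "w \<in> ball x e" "z \<in> ball x e" using G(2) x(1) by blast+
    then have "norm (?D w - ?D x) < norm (?D x) / 3" "norm (?D z - ?D x) < norm (?D x) / 3" using x by blast+
    then show "norm (?D w) \<le> 2 * norm (?D z)"
      using norm_triangle_ineq2[of "?D w" "?D x"] norm_triangle_ineq2[of "?D x" "?D z"] norm_minus_commute[of "?D z" "?D x"]
      by linarith
  qed
qed

lemma exists_below_average:
  fixes f :: "nat \<Rightarrow> real"
  assumes "(\<Sum>j<m. f j) \<le> B" "m > 0"
  shows "\<exists>j<m. f j \<le> B / real m"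
proof (rule ccontr)
  assume "\<not> ?thesis"
  then have "(\<Sum>j<m. B / real m) < (\<Sum>j<m. f j)"
    using assms(2) by (intro sum_strict_mono) (auto simp: not_le)
  then show False using assms by simp
qed

text \<open>The length-area estimate, on a grid of squares of side \<open>h\<close>: the discs inscribed in the
  squares have disjoint images, each containing a disc of radius comparable to the derivative
  times \<open>h\<close> by Bloch's lemma; so the squares of these radii have bounded sum, and some column of
  the grid carries at most the average share.\<close>

lemma short_vertical_segment:
  fixes F :: "complex \<Rightarrow> complex"
  assumes F: "F holomorphic_on S" "open S" "inj_on F S" "F ` S \<subseteq> ball c M"
    and L: "L > (0::nat)" and ab: "a < b"
    and R: "cbox (Complex A a) (Complex (A + L * (b - a)) b) \<subseteq> S"
  shows "\<exists>u\<in>{A..A + L * (b - a)}. \<forall>\<theta>\<in>{a..b}.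
    norm (F (Complex u \<theta>) - F (Complex u a)) \<le> 4 * M / (bloch_const * sqrt L)"
proof -
  let ?R = "cbox (Complex A a) (Complex (A + L * (b - a)) b)"
  let ?D = "\<lambda>z. norm (deriv F z)"
  have \<beta>: "bloch_const > 0" by (rule bloch_const_pos)
  obtain \<rho> where \<rho>: "\<rho> > 0" "\<And>z. z \<in> ?R \<Longrightarrow> cball z \<rho> \<subseteq> S"
    "\<And>z w. z \<in> ?R \<Longrightarrow> w \<in> cball z \<rho> \<Longrightarrow> ?D w \<le> 2 * ?D z"
    using derivative_comparable_on_compact[OF F(1-3) compact_cbox R] by blast
  obtain n0 :: nat where n0: "(b - a) / \<rho> < real n0" using reals_Archimedean2 by blast
  \<comment> \<open>The choice gives \<open>h \<le> \<rho>\<close>, so Bloch's lemma applies on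
    every inscribed disc. The rectangle splits into \<open>L * n\<close> columns of \<open>n\<close>
    squares.\<close>
  define n where "n = Suc n0"
  define h where "h = (b - a) / real n"
  have h: "h > 0" "h * real n = b - a" using ab by (auto simp: h_def n_def)
  have "(b - a) / \<rho> < real n" using n0 by (simp add: n_def)
  then have "h \<le> \<rho>" using \<rho>(1) unfolding h_def by (simp add: n_def field_simps)
  then have h2: "h / 2 \<le> \<rho>" using h by simp
  define z where "z i = Complex (A + (real (fst i) + 1/2) * h) (a + (real (snd i) + 1/2) * h)" for i :: "nat \<times> nat"
  define I where "I = {..<L * n} \<times> {..<n}"
  have cell: "0 \<le> (real k + 1/2) * h" "(real k + 1/2) * h \<le> real m * h" if "k < m" for k m
  proof -
    show "0 \<le> (real k + 1/2) * h" using h(1) by simp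
    have "real k + 1/2 \<le> real m" using that by linarith
    then show "(real k + 1/2) * h \<le> real m * h" using h(1) by (intro mult_right_mono) auto
  qed
  have zR: "z i \<in> ?R" if iI: "i \<in> I" for i
  proof -
    obtain j k where i: "i = (j, k)" "j < L * n" "k < n" using iI by (cases i) (auto simp: I_def)
    have "real (L * n) * h = L * (h * real n)" by simp
    then have "real (L * n) * h = L * (b - a)" using h(2) by simp
    then show ?thesis
      using cell[OF i(2)] cell[OF i(3)] h(2) i(1)
      by (auto simp: in_cbox_complex_iff z_def algebra_simps)
  qed
  have apart: "ball (z i) (h/2) \<inter> ball (z i') (h/2) = {}" if "i \<noteq> i'" for i i'
  proof (rule disjoint_ballI)
    have *: "h \<le> \<bar>(real j - real j') * h\<bar>" if "j \<noteq> j'" for j j' :: nat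
    proof -
      have "1 \<le> \<bar>real j - real j'\<bar>" using that by linarith
      then have "1 * h \<le> \<bar>real j - real j'\<bar> * h" using h(1) by (intro mult_right_mono) auto
      then show ?thesis using h(1) by (simp add: abs_mult)
    qed
    have "Re (z i - z i') = (real (fst i) - real (fst i')) * h" "Im (z i - z i') = (real (snd i) - real (snd i')) * h"
      by (simp_all add: z_def algebra_simps)
    then have "h \<le> \<bar>Re (z i - z i')\<bar> \<or> h \<le> \<bar>Im (z i - z i')\<bar>"
      using * that by (metis prod_eqI)
    then have "h \<le> norm (z i - z i')"
      using abs_Re_le_cmod[of "z i - z i'"] abs_Im_le_cmod[of "z i - z i'"] by linarith
    then show "h/2 + h/2 \<le> dist (z i) (z i')" by (simp add: dist_norm)
  qed
  have cbS: "cball (z i) (h/2) \<subseteq> S" if "i \<in> I" for i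
    using \<rho>(2)[OF zR[OF that]] h2 by (meson order_trans subset_cball)
  then have bS: "ball (z i) (h/2) \<subseteq> S" if "i \<in> I" for i
    using that ball_subset_cball by (meson order_trans)
  have Dle: "?D w \<le> 2 * ?D (z i)" if "i \<in> I" "w \<in> cball (z i) (h/2)" for i w
    using \<rho>(3)[OF zR[OF that(1)], of w] that(2) h2 by auto
  have bloch: "ball (F (z i)) (bloch_const * (h/2) * ?D (z i)) \<subseteq> F ` ball (z i) (h/2)" if i: "i \<in> I" for i
    unfolding bloch_const_def
  proof (rule Bloch_lemma)
    show "F holomorphic_on cball (z i) (h/2)" using F(1) cbS[OF i] holomorphic_on_subset by blast
    show "0 < h/2" using h by simp
    fix w assume "w \<in> ball (z i) (h/2)"
    then show "?D w \<le> 2 * ?D (z i)" using Dle[OF i] ball_subset_cball by blast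
  qed
  have M: "M \<ge> 0"
  proof -
    have "(0, 0) \<in> I" using L by (simp add: I_def n_def)
    then have "z (0, 0) \<in> S" using zR R by blast
    then show ?thesis using F(4) by (metis ball_empty empty_iff image_subset_iff le_cases)
  qed
  have "(\<Sum>i\<in>I. (bloch_const * (h/2) * ?D (z i))\<^sup>2) \<le> M\<^sup>2"
  proof (rule sum_squares_disjoint_balls)
    show "disjoint_family_on (\<lambda>i. ball (F (z i)) (bloch_const * (h/2) * ?D (z i))) I"
      unfolding disjoint_family_on_def
    proof (intro ballI impI)
      fix i i' assume i: "i \<in> I" "i' \<in> I" "i \<noteq> i'"
      have "F ` ball (z i) (h/2) \<inter> F ` ball (z i') (h/2) = {}"
        using inj_on_image_Int[OF F(3) bS[OF i(1)] bS[OF i(2)]] apart[OF i(3)] by simp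
      then show "ball (F (z i)) (bloch_const * (h/2) * ?D (z i)) \<inter> ball (F (z i')) (bloch_const * (h/2) * ?D (z i')) = {}"
        using bloch[OF i(1)] bloch[OF i(2)] by blast
    qed
    show "ball (F (z i)) (bloch_const * (h/2) * ?D (z i)) \<subseteq> ball c M" if "i \<in> I" for i
      using bloch[OF that] bS[OF that] F(4) by blast
  qed (use \<beta> h M in \<open>auto simp: I_def\<close>)
  then have "(bloch_const / 2)\<^sup>2 * (\<Sum>i\<in>I. (h * ?D (z i))\<^sup>2) \<le> M\<^sup>2"
    unfolding sum_distrib_left by (simp add: power_mult_distrib power_divide mult.assoc)
  then have "(\<Sum>i\<in>I. (h * ?D (z i))\<^sup>2) \<le> (2 * M / bloch_const)\<^sup>2"
    using \<beta> by (simp add: field_simps power_divide power_mult_distrib)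
  then have "(\<Sum>j<L * n. \<Sum>k<n. (h * ?D (z (j, k)))\<^sup>2) \<le> (2 * M / bloch_const)\<^sup>2"
    unfolding I_def sum.cartesian_product by (simp add: case_prod_unfold)
  then obtain j where j: "j < L * n" "(\<Sum>k<n. (h * ?D (z (j, k)))\<^sup>2) \<le> (2 * M / bloch_const)\<^sup>2 / real (L * n)"
    using exists_below_average[of _ "L * n"] L by (auto simp: n_def)
  have jI: "(j, k) \<in> I" if "k < n" for k using that j by (simp add: I_def)
  define D where "D k = h * ?D (z (j, k))" for k
  have D0: "D k \<ge> 0" for k using h by (simp add: D_def)
  \<comment> \<open>The \<open>n\<close> from Cauchy-Schwarz cancels the \<open>n\<close> in the
    number of columns, so the bound is independent of the mesh and depends on the shape of the
    rectangle only through \<open>L\<close>.\<close>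
  have "(\<Sum>k<n. 1 * D k)\<^sup>2 \<le> (\<Sum>k<n. (1::real)\<^sup>2) * (\<Sum>k<n. (D k)\<^sup>2)" by (rule Cauchy_Schwarz_ineq_sum)
  also have "\<dots> = real n * (\<Sum>k<n. (D k)\<^sup>2)" by simp
  also have "\<dots> \<le> real n * ((2 * M / bloch_const)\<^sup>2 / real (L * n))"
    using j(2) unfolding D_def by (intro mult_left_mono) auto
  also have "\<dots> = (2 * M / (bloch_const * sqrt L))\<^sup>2"
  proof -
    have "n > 0" by (simp add: n_def)
    then show ?thesis using L by (simp add: power_divide power_mult_distrib)
  qed
  finally have "(\<Sum>k<n. D k)\<^sup>2 \<le> (2 * M / (bloch_const * sqrt L))\<^sup>2" by simp
  moreover have "0 \<le> 2 * M / (bloch_const * sqrt L)" using M \<beta> by simp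
  ultimately have sumD: "(\<Sum>k<n. D k) \<le> 2 * M / (bloch_const * sqrt L)" by (rule power2_le_imp_le)
  \<comment> \<open>This is the abscissa of the centres in column \<open>j\<close>, so in each
    square the segment is a vertical diameter of the inscribed disc.\<close>
  define u where "u = A + (real j + 1/2) * h"
  have step: "norm (F (Complex u \<theta>) - F (Complex u \<theta>')) \<le> 2 * D k"
    if k: "k < n" and t: "\<theta> \<in> {a + k * h..a + (real k + 1) * h}" "\<theta>' \<in> {a + k * h..a + (real k + 1) * h}" for k \<theta> \<theta>'
  proof -
    let ?C = "cball (z (j, k)) (h/2)"
    have inC: "Complex u t \<in> ?C" if "t \<in> {a + k * h..a + (real k + 1) * h}" for t
    proof -
      have "z (j, k) - Complex u t = \<i> * of_real (a + (real k + 1/2) * h - t)"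
        by (simp add: complex_eq_iff z_def u_def)
      then have "norm (z (j, k) - Complex u t) = \<bar>a + (real k + 1/2) * h - t\<bar>" by (simp only: norm_mult norm_of_real norm_ii mult_1)
      also have "\<dots> \<le> h/2"
      proof -
        define q where "q = a + real k * h"
        have q: "a + (real k + 1/2) * h = q + h/2" by (simp add: q_def algebra_simps)
        have "q \<le> t" "t \<le> q + h" using that by (simp_all add: q_def algebra_simps)
        then show ?thesis unfolding q abs_le_iff by (simp add: field_simps)
      qed
      finally show ?thesis by (simp add: dist_norm)
    qed
    have "norm (F (Complex u \<theta>) - F (Complex u \<theta>')) \<le> (2 * ?D (z (j, k))) * norm (Complex u \<theta> - Complex u \<theta>')"
    proof (rule field_differentiable_bound[of ?C F "deriv F"])
      fix w assume w: "w \<in> ?C"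
      then have "w \<in> S" using cbS jI[OF k] by blast
      then have "(F has_field_derivative deriv F w) (at w)" using F(1,2) holomorphic_derivI by blast
      then show "(F has_field_derivative deriv F w) (at w within ?C)" by (rule has_field_derivative_at_within)
      show "?D w \<le> 2 * ?D (z (j, k))" using Dle[OF jI[OF k] w] .
    qed (use inC t in auto)
    also have "norm (Complex u \<theta> - Complex u \<theta>') = \<bar>\<theta> - \<theta>'\<bar>" by (simp add: cmod_def)
    also have "2 * ?D (z (j, k)) * \<bar>\<theta> - \<theta>'\<bar> \<le> 2 * ?D (z (j, k)) * h"
      using t by (intro mult_left_mono) (auto simp: abs_le_iff algebra_simps)
    finally show ?thesis by (simp add: D_def algebra_simps)
  qed
  have node: "norm (F (Complex u (a + m * h)) - F (Complex u a)) \<le> (\<Sum>k<m. 2 * D k)" if "m \<le> n" for m :: nat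
    using that
  proof (induction m)
    case (Suc m)
    have "norm (F (Complex u (a + Suc m * h)) - F (Complex u (a + m * h))) \<le> 2 * D m"
      using Suc.prems h by (intro step) (auto simp: algebra_simps)
    moreover have "norm (F (Complex u (a + m * h)) - F (Complex u a)) \<le> (\<Sum>k<m. 2 * D k)"
      using Suc by simp
    ultimately show ?case
      using norm_triangle_ineq[of "F (Complex u (a + Suc m * h)) - F (Complex u (a + m * h))" "F (Complex u (a + m * h)) - F (Complex u a)"]
      by simp
  qed simp
  have "norm (F (Complex u \<theta>) - F (Complex u a)) \<le> 4 * M / (bloch_const * sqrt L)" if \<theta>: "\<theta> \<in> {a..b}" for \<theta>
  proof -
    obtain k where k: "k < n" "\<theta> \<in> {a + k * h..a + (real k + 1) * h}"
    \<comment> \<open>For the top end \<open>b\<close> the floor would give the nonexistent square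
      \<open>n\<close>; it belongs to the last square, \<open>n0\<close>.\<close>
    proof (cases "\<theta> = b")
      case True
      then show ?thesis using that[of n0] h \<theta> by (simp add: n_def algebra_simps)
    next
      case False
      define k where "k = nat \<lfloor>(\<theta> - a) / h\<rfloor>"
      have "0 \<le> (\<theta> - a) / h" using \<theta> h by simp
      then have k1: "real k \<le> (\<theta> - a) / h" "(\<theta> - a) / h < real k + 1" unfolding k_def by linarith+
      then have k2: "real k * h \<le> \<theta> - a" "\<theta> - a < (real k + 1) * h" using h(1) by (auto simp: field_simps)
      have "\<theta> - a < real n * h" using False \<theta> h(2) by (simp add: mult.commute)
      then have "real k * h < real n * h" using k2 by linarith
      then have "k < n" using h(1) by simp
      then show ?thesis using that[of k] k2 by auto
    qed
    have "a + real k * h \<in> {a + k * h..a + (real k + 1) * h}" using h(1) by (simp add: algebra_simps)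
    then have "norm (F (Complex u \<theta>) - F (Complex u (a + k * h))) \<le> 2 * D k" using step k by blast
    moreover have "norm (F (Complex u (a + k * h)) - F (Complex u a)) \<le> (\<Sum>i<k. 2 * D i)" using node k by simp
    ultimately have "norm (F (Complex u \<theta>) - F (Complex u a)) \<le> (\<Sum>i<Suc k. 2 * D i)"
      using norm_triangle_ineq[of "F (Complex u \<theta>) - F (Complex u (a + k * h))" "F (Complex u (a + k * h)) - F (Complex u a)"]
      by simp
    also have "\<dots> \<le> (\<Sum>i<n. 2 * D i)" using k D0 by (intro sum_mono2) auto
    also have "\<dots> = 2 * (\<Sum>i<n. D i)" by (simp add: sum_distrib_left)
    finally show ?thesis using sumD by simp
  qed
  moreover have "u \<in> {A..A + L * (b - a)}"
  proof -
    have "real (L * n) * h = L * (h * real n)" by simp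
    then have eq: "real (L * n) * h = L * (b - a)" using h(2) by simp
    show ?thesis using cell[OF j(1)] unfolding eq by (simp add: u_def)
  qed
  ultimately show ?thesis by blast
qed

text \<open>Rectangles of heights from \<open>\<tau> n\<close> to \<open>pi - \<tau> n\<close>
  exhaust the strip, and the bound for their short segments does not depend on \<open>n\<close>. The
  abscissae stay in a compact interval, and at a limit \<open>u\<close> of them the bound persists
  for each fixed pair of heights by continuity.\<close>

lemma short_crosscut_in_strip:
  fixes F :: "complex \<Rightarrow> complex"
  assumes F: "F holomorphic_on {z. 0 < Im z \<and> Im z < pi}" "inj_on F {z. 0 < Im z \<and> Im z < pi}"
      "F ` {z. 0 < Im z \<and> Im z < pi} \<subseteq> ball c M"
    and e: "e > 0"
  obtains u where "u \<le> u0" "\<And>s t. s \<in> {0<..<pi} \<Longrightarrow> t \<in> {0<..<pi} \<Longrightarrow> norm (F (Complex u s) - F (Complex u t)) \<le> e"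
proof -
  let ?S = "{z. 0 < Im z \<and> Im z < pi}"
  have "?S = {z. Im z > 0} \<inter> {z. Im z < pi}" by auto
  then have oS: "open ?S" by (simp add: open_Int open_halfspace_Im_gt open_halfspace_Im_lt)
  have cont: "continuous_on ?S F" using F(1) by (rule holomorphic_on_imp_continuous_on)
  \<comment> \<open>8 is twice the 4 of the segment estimate, as both heights are compared with the
    foot of the segment. \<open>L\<close> is then taken so large that
    \<open>K / sqrt L \<le> e\<close>.\<close>
  define K where "K = 8 * M / bloch_const"
  obtain L :: nat where L0: "(K / e)\<^sup>2 < real L" using reals_Archimedean2 by blast
  then have L: "L > 0" by (metis not_gr_zero of_nat_0 not_less zero_le_power2)
  have "K / e \<le> sqrt L" using L0 by (meson less_eq_real_def real_le_rsqrt)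
  then have "K \<le> sqrt L * e" using e by (simp add: pos_divide_le_eq)
  then have KL: "K / sqrt L \<le> e" using L by (simp add: pos_divide_le_eq mult.commute)
  define \<tau> where "\<tau> n = 1 / (real n + 2)" for n :: nat
  have \<tau>: "0 < \<tau> n" "\<tau> n \<le> 1/2" for n by (auto simp: \<tau>_def field_simps)
  then have \<tau>pi: "\<tau> n < pi - \<tau> n" for n using pi_gt3 \<tau>[of n] by linarith
  have \<tau>lim: "\<tau> \<longlonglongrightarrow> 0"
    unfolding \<tau>_def using LIMSEQ_ignore_initial_segment[OF LIMSEQ_inverse_real_of_nat, of 1]
    by (simp add: inverse_eq_divide algebra_simps)
  let ?A = "\<lambda>n. u0 - L * ((pi - \<tau> n) - \<tau> n)"
  have "\<exists>v\<in>{?A n..u0}. \<forall>\<theta>\<in>{\<tau> n..pi - \<tau> n}. norm (F (Complex v \<theta>) - F (Complex v (\<tau> n))) \<le> 4 * M / (bloch_const * sqrt L)" for n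
  proof -
    have "cbox (Complex (?A n) (\<tau> n)) (Complex (?A n + L * ((pi - \<tau> n) - \<tau> n)) (pi - \<tau> n)) \<subseteq> ?S"
      using \<tau>[of n] by (auto simp: in_cbox_complex_iff)
    from short_vertical_segment[OF F(1) oS F(2,3) L \<tau>pi this] show ?thesis by simp
  qed
  then obtain v where v: "\<And>n. v n \<in> {?A n..u0}"
     "\<And>n \<theta>. \<theta> \<in> {\<tau> n..pi - \<tau> n} \<Longrightarrow> norm (F (Complex (v n) \<theta>) - F (Complex (v n) (\<tau> n))) \<le> 4 * M / (bloch_const * sqrt L)"
    by metis
  have "v n \<in> {u0 - L * pi..u0}" for n
  proof -
    have "L * ((pi - \<tau> n) - \<tau> n) \<le> L * pi" using \<tau>[of n] by (intro mult_left_mono) auto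
    then show ?thesis using v(1)[of n] by auto
  qed
  then obtain u k where u: "u \<in> {u0 - L * pi..u0}" "strict_mono k" "(v \<circ> k) \<longlonglongrightarrow> u"
    using compact_Icc[of "u0 - L * pi" u0] unfolding compact_def by metis
  show ?thesis
  proof (rule that[of u])
    show "u \<le> u0" using u by simp
    fix s t :: real assume st: "s \<in> {0<..<pi}" "t \<in> {0<..<pi}"
    have lim: "(\<lambda>n. F (Complex ((v \<circ> k) n) \<theta>)) \<longlonglongrightarrow> F (Complex u \<theta>)" if "\<theta> \<in> {0<..<pi}" for \<theta>
    proof (rule continuous_on_tendsto_compose[OF cont])
      show "(\<lambda>n. Complex ((v \<circ> k) n) \<theta>) \<longlonglongrightarrow> Complex u \<theta>" using u(3) by (intro tendsto_Complex tendsto_const)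
    qed (use that in auto)
    have ev: "\<forall>\<^sub>F n in sequentially. \<theta> \<in> {\<tau> (k n)..pi - \<tau> (k n)}" if "\<theta> \<in> {0<..<pi}" for \<theta>
    proof -
      have "(\<tau> \<circ> k) \<longlonglongrightarrow> 0" using \<tau>lim u(2) by (rule LIMSEQ_subseq_LIMSEQ)
      moreover have "0 < min \<theta> (pi - \<theta>)" using that by simp
      ultimately have "\<forall>\<^sub>F n in sequentially. (\<tau> \<circ> k) n < min \<theta> (pi - \<theta>)" by (rule order_tendstoD)
      then show ?thesis by eventually_elim auto
    qed
    have "\<forall>\<^sub>F n in sequentially. norm (F (Complex ((v \<circ> k) n) s) - F (Complex ((v \<circ> k) n) t)) \<le> e"
      using ev[OF st(1)] ev[OF st(2)]
    proof eventually_elim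
      case (elim n)
      let ?g = "\<lambda>\<theta>. F (Complex (v (k n)) \<theta>)"
      have "norm (?g s - ?g (\<tau> (k n))) \<le> 4 * M / (bloch_const * sqrt L)"
           "norm (?g t - ?g (\<tau> (k n))) \<le> 4 * M / (bloch_const * sqrt L)" using v(2) elim by blast+
      then have "norm (?g s - ?g t) \<le> 8 * M / (bloch_const * sqrt L)"
        using norm_triangle_ineq4[of "?g s - ?g (\<tau> (k n))" "?g t - ?g (\<tau> (k n))"] by simp
      also have "\<dots> \<le> e" using KL by (simp add: K_def divide_divide_eq_left)
      finally show ?case by simp
    qed
    moreover have "(\<lambda>n. norm (F (Complex ((v \<circ> k) n) s) - F (Complex ((v \<circ> k) n) t))) \<longlonglongrightarrow> norm (F (Complex u s) - F (Complex u t))"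
      by (intro tendsto_intros lim st)
    ultimately show "norm (F (Complex u s) - F (Complex u t)) \<le> e"
      by (intro tendsto_upperbound[where F = sequentially]) auto
  qed
qed

text \<open>\<open>strip_to_disc\<close> maps the strip \<open>0 < Im w < pi\<close> conformally onto the disc; vertical segments
  go to the crosscuts \<open>norm (z - 1) = c * norm (z + 1)\<close> around 1.\<close>

definition strip_to_disc :: "complex \<Rightarrow> complex" where
  "strip_to_disc w = (\<i> - exp w) / (\<i> + exp w)"

lemma strip_exp_Im: "0 < Im w \<Longrightarrow> Im w < pi \<Longrightarrow> 0 < Im (exp w)"
  by (simp add: Im_exp sin_gt_zero)

lemma strip_denom: "0 < Im w \<Longrightarrow> Im w < pi \<Longrightarrow> \<i> + exp w \<noteq> 0"
  using strip_exp_Im[of w] by (metis add_strict_increasing2 complex_eq_iff imaginary_unit.simps(2) less_irrefl plus_complex.simps(2) zero_complex.simps(2) zero_less_one_class.zero_le_one)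

text \<open>The exponential of a point of the strip lies in the upper half-plane, so it is closer to
  \<open>\<i>\<close> than to \<open>-\<i>\<close>.\<close>

lemma strip_to_disc_norm:
  assumes "0 < Im w" "Im w < pi" shows "norm (strip_to_disc w) < 1"
proof -
  have "norm (\<i> - exp w) < norm (\<i> + exp w)"
  proof (rule power2_less_imp_less)
    show "(norm (\<i> - exp w))\<^sup>2 < (norm (\<i> + exp w))\<^sup>2"
      using strip_exp_Im[OF assms] by (simp add: cmod_power2) (simp add: power2_eq_square algebra_simps)
  qed simp
  then show ?thesis using strip_denom[OF assms] by (simp add: strip_to_disc_def norm_divide)
qed

lemma strip_to_disc_inverse:
  assumes "0 < Im w" "Im w < pi"
  shows "\<i> * (1 - strip_to_disc w) / (1 + strip_to_disc w) = exp w"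
proof -
  have "1 - strip_to_disc w = 2 * exp w / (\<i> + exp w)" "1 + strip_to_disc w = 2 * \<i> / (\<i> + exp w)"
    using strip_denom[OF assms] by (auto simp: strip_to_disc_def field_simps)
  then show ?thesis using strip_denom[OF assms] by simp
qed

lemma strip_to_disc_inj: "inj_on strip_to_disc {w. 0 < Im w \<and> Im w < pi}"
proof (rule inj_onI)
  fix x y assume x: "x \<in> {w. 0 < Im w \<and> Im w < pi}" and y: "y \<in> {w. 0 < Im w \<and> Im w < pi}" and eq: "strip_to_disc x = strip_to_disc y"
  have "exp x = exp y" using strip_to_disc_inverse x y eq by (metis mem_Collect_eq)
  then have "Ln (exp x) = Ln (exp y)" by simp
  then show "x = y" using x y by (simp add: Ln_exp)
qed

lemma strip_to_disc_holomorphic: "strip_to_disc holomorphic_on {w. 0 < Im w \<and> Im w < pi}"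
  unfolding strip_to_disc_def using strip_denom by (intro holomorphic_intros) auto

lemma strip_to_disc_ratio:
  assumes "0 < Im w" "Im w < pi"
  shows "norm (strip_to_disc w - 1) = exp (Re w) * norm (strip_to_disc w + 1)"
proof -
  have "1 + strip_to_disc w \<noteq> 0"
    using strip_to_disc_norm[OF assms] by (metis add_eq_0_iff less_irrefl norm_minus_cancel norm_one)
  moreover have "norm (\<i> * (1 - strip_to_disc w) / (1 + strip_to_disc w)) = exp (Re w)"
    unfolding strip_to_disc_inverse[OF assms] by simp
  ultimately show ?thesis by (simp add: norm_divide norm_mult norm_minus_commute add.commute divide_eq_eq)
qed

text \<open>The Cayley image \<open>v\<close> of \<open>z\<close> is in the upper half-plane with
  modulus \<open>exp u\<close>, so its logarithm lies on the vertical segment over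
  \<open>u\<close>.\<close>

lemma crosscut_preimage:
  assumes z: "norm z < 1" and ratio: "norm (z - 1) = exp u * norm (z + 1)"
  obtains t where "t \<in> {0<..<pi}" "strip_to_disc (Complex u t) = z"
proof -
  have nz: "1 + z \<noteq> 0" "z \<noteq> 1" using z by (auto simp: add_eq_0_iff)
  define v where "v = \<i> * (1 - z) / (1 + z)"
  have "Im v = (1 - (norm z)\<^sup>2) / (norm (1 + z))\<^sup>2"
  proof -
    have "v = \<i> * (1 - z) * cnj (1 + z) / (norm (1 + z))\<^sup>2"
      unfolding v_def by (subst complex_div_cnj) simp
    moreover have "Im (\<i> * (1 - z) * cnj (1 + z)) = 1 - (norm z)\<^sup>2"
      by (simp add: cmod_power2) (simp add: power2_eq_square algebra_simps)
    ultimately show ?thesis by (metis Im_divide_of_real of_real_power)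
  qed
  moreover have "(norm z)\<^sup>2 < 1" using z by (simp add: abs_square_less_1)
  ultimately have Imv: "Im v > 0" using nz by simp
  have v0: "v \<noteq> 0" using Imv by auto
  have "norm v = exp u" using ratio nz by (simp add: v_def norm_mult norm_divide norm_minus_commute add.commute)
  then have "Re (Ln v) = u" using v0 by (simp add: Re_Ln)
  then have "Ln v = Complex u (Im (Ln v))" by (simp add: complex_eq_iff)
  then have ex: "exp (Complex u (Im (Ln v))) = v" using v0 by (metis exp_Ln)
  have "\<i> + v = 2 * \<i> / (1 + z)" "\<i> - v = 2 * \<i> * z / (1 + z)"
    using nz by (auto simp: v_def field_simps)
  then have "strip_to_disc (Complex u (Im (Ln v))) = z"
    unfolding strip_to_disc_def ex using nz by simp
  moreover have "Im (Ln v) \<in> {0<..<pi}" using Im_Ln_pos_lt_imp[OF Imv] by simp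
  ultimately show ?thesis using that by blast
qed

lemma short_crosscut_in_disc:
  fixes f :: "complex \<Rightarrow> complex"
  assumes f: "f holomorphic_on ball 0 1" "inj_on f (ball 0 1)" "f ` ball 0 1 \<subseteq> ball a M"
    and \<zeta>: "norm \<zeta> = 1" and e: "e > 0" and d: "d > 0"
  obtains c where "0 < c" "c < 1" "c \<le> d"
    "\<And>x y. norm x < 1 \<Longrightarrow> norm y < 1 \<Longrightarrow> norm (x - \<zeta>) = c * norm (x + \<zeta>) \<Longrightarrow> norm (y - \<zeta>) = c * norm (y + \<zeta>) \<Longrightarrow>
       norm (f x - f y) \<le> e"
    "\<exists>x. norm x < 1 \<and> norm (x - \<zeta>) = c * norm (x + \<zeta>)"
proof -
  let ?S = "{w. 0 < Im w \<and> Im w < pi}"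
  define F where "F = f \<circ> (\<lambda>w. \<zeta> * strip_to_disc w)"
  have \<zeta>0: "\<zeta> \<noteq> 0" using \<zeta> by auto
  have img: "(\<lambda>w. \<zeta> * strip_to_disc w) ` ?S \<subseteq> ball 0 1" using strip_to_disc_norm \<zeta> by (auto simp: norm_mult)
  have holF: "F holomorphic_on ?S" unfolding F_def
    using img by (intro holomorphic_on_compose_gen[OF _ f(1)] holomorphic_intros strip_to_disc_holomorphic)
  have "inj_on (\<lambda>w. \<zeta> * strip_to_disc w) ?S"
    using strip_to_disc_inj \<zeta>0 by (auto simp: inj_on_def)
  then have injF: "inj_on F ?S" unfolding F_def using inj_on_subset[OF f(2) img] by (rule comp_inj_on)
  have imF: "F ` ?S \<subseteq> ball a M" unfolding F_def image_comp[symmetric] using img f(3) by blast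
  \<comment> \<open>\<open>-1\<close> makes the ratio \<open>c = exp u\<close> less than 1, and
    \<open>ln d\<close> makes it at most \<open>d\<close>.\<close>
  obtain u where u: "u \<le> min (-1) (ln d)"
    "\<And>s t. s \<in> {0<..<pi} \<Longrightarrow> t \<in> {0<..<pi} \<Longrightarrow> norm (F (Complex u s) - F (Complex u t)) \<le> e"
    using short_crosscut_in_strip[OF holF injF imF e] by blast
  have pre: "\<exists>t\<in>{0<..<pi}. f x = F (Complex u t)" if x: "norm x < 1" "norm (x - \<zeta>) = exp u * norm (x + \<zeta>)" for x
  proof -
    have "x / \<zeta> - 1 = (x - \<zeta>) / \<zeta>" "x / \<zeta> + 1 = (x + \<zeta>) / \<zeta>" using \<zeta>0 by (auto simp: field_simps)
    then have "norm (x / \<zeta> - 1) = norm (x - \<zeta>)" "norm (x / \<zeta> + 1) = norm (x + \<zeta>)" "norm (x / \<zeta>) = norm x"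
      using \<zeta> by (simp_all add: norm_divide)
    then obtain t where "t \<in> {0<..<pi}" "strip_to_disc (Complex u t) = x / \<zeta>"
      using crosscut_preimage[of "x / \<zeta>" u] x by metis
    then show ?thesis using \<zeta>0 by (intro bexI[of _ t]) (auto simp: F_def)
  qed
  show ?thesis
  proof (rule that[of "exp u"])
    show "0 < exp u" "exp u < 1" using u by auto
    have "exp u \<le> exp (ln d)" using u(1) by simp
    then show "exp u \<le> d" using d by simp
    fix x y :: complex
    assume "norm x < 1" "norm y < 1" "norm (x - \<zeta>) = exp u * norm (x + \<zeta>)" "norm (y - \<zeta>) = exp u * norm (y + \<zeta>)"
    then show "norm (f x - f y) \<le> e" using pre u(2) by metis
  next
    let ?w = "Complex u (pi/2)"
    let ?x = "strip_to_disc ?w"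
    have w: "0 < Im ?w" "Im ?w < pi" by auto
    have "\<zeta> * ?x - \<zeta> = \<zeta> * (?x - 1)" "\<zeta> * ?x + \<zeta> = \<zeta> * (?x + 1)" by (auto simp: algebra_simps)
    then have "norm (\<zeta> * ?x - \<zeta>) = norm (?x - 1)" "norm (\<zeta> * ?x + \<zeta>) = norm (?x + 1)"
      using \<zeta> by (simp_all add: norm_mult)
    then show "\<exists>x. norm x < 1 \<and> norm (x - \<zeta>) = exp u * norm (x + \<zeta>)"
      using strip_to_disc_norm[OF w] strip_to_disc_ratio[OF w] \<zeta> by (intro exI[of _ "\<zeta> * ?x"]) (auto simp: norm_mult)
  qed
qed

section \<open>Boundary behaviour of Riemann maps\<close>

text \<open>If the limit were in \<open>G\<close>, the continuous inverse \<open>g\<close> would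
  carry the sequence to a limit in the open disc, but the \<open>x n\<close> tend to the
  circle.\<close>

lemma disc_map_boundary_limit:
  fixes f g :: "complex \<Rightarrow> complex"
  assumes g: "continuous_on G g" "\<And>w. w \<in> G \<Longrightarrow> norm (g w) < 1"
    and f: "\<And>z. norm z < 1 \<Longrightarrow> f z \<in> G \<and> g (f z) = z" and cl: "closure G \<subseteq> G \<union> X"
    and x: "\<And>n. norm (x n) < 1" "x \<longlonglongrightarrow> \<zeta>" "norm \<zeta> = 1" and lim: "(\<lambda>n. f (x n)) \<longlonglongrightarrow> s"
  shows "s \<in> X"
proof -
  have fG: "f (x n) \<in> G" for n using f x(1) by blast
  then have "s \<in> closure G" using lim unfolding closure_sequential by (intro exI[of _ "\<lambda>n. f (x n)"]) auto
  moreover have "s \<notin> G"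
  proof
    assume "s \<in> G"
    then have "(\<lambda>n. g (f (x n))) \<longlonglongrightarrow> g s"
      using fG by (intro continuous_on_tendsto_compose[OF g(1) lim]) auto
    moreover have "g (f (x n)) = x n" for n using f x(1) by blast
    ultimately have "x \<longlonglongrightarrow> g s" by simp
    then have "g s = \<zeta>" using x(2) LIMSEQ_unique by blast
    then show False using g(2)[OF \<open>s \<in> G\<close>] x(3) by simp
  qed
  ultimately show ?thesis using cl by blast
qed

text \<open>A short crosscut near \<open>\<zeta>\<close> has its image near a boundary point \<open>s\<close>; together with a small
  connected piece of the boundary the image cuts off the image of a neighbourhood of \<open>\<zeta>\<close>,
  which therefore stays near \<open>s\<close>, by Janiszewski's theorem.\<close>

lemma disc_map_small_oscillation:
  fixes f g :: "complex \<Rightarrow> complex"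
  assumes X: "compact X" "connected X" "G \<in> components (- X)" "bounded G"
    and cik: "\<And>s. s \<in> X \<Longrightarrow> connected_im_kleinen X s"
    and hol: "f holomorphic_on ball 0 1" and g: "continuous_on G g" "\<And>w. w \<in> G \<Longrightarrow> norm (g w) < 1 \<and> f (g w) = w"
    and f: "\<And>z. norm z < 1 \<Longrightarrow> f z \<in> G \<and> g (f z) = z"
    and \<zeta>: "norm \<zeta> = 1" and e: "e > 0"
  obtains d s where "d > 0" "\<And>z. norm z < 1 \<Longrightarrow> dist z \<zeta> < d \<Longrightarrow> f z \<in> cball s e"
proof -
  have clX: "closed X" using X(1) by (rule compact_imp_closed)
  have GX: "G \<subseteq> - X" using X(3) in_components_subset by blast
  have clG: "closure G \<subseteq> G \<union> X" using component_simply_connected[OF clX X(2-4)] by blast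
  have inj: "inj_on f (ball 0 1)" using f by (intro inj_on_inverseI[of _ g]) auto
  obtain M where M: "M > 0" "G \<subseteq> ball 0 M" using X(4) bounded_subset_ballD[of G 0] by blast
  have fM: "f ` ball 0 1 \<subseteq> ball 0 M" using f M by auto
  define Q where "Q c = {z. norm z < 1 \<and> norm (z - \<zeta>) = c * norm (z + \<zeta>)}" for c
  have "\<exists>c q. 0 < c \<and> c < 1 \<and> c \<le> 1 / Suc n \<and> q \<in> Q c \<and> (\<forall>x\<in>Q c. \<forall>y\<in>Q c. norm (f x - f y) \<le> 1 / Suc n)" for n :: nat
  proof -
    have "1 / real (Suc n) > 0" by simp
    then obtain c where "0 < c" "c < 1" "c \<le> 1 / Suc n"
      "\<And>x y. norm x < 1 \<Longrightarrow> norm y < 1 \<Longrightarrow> norm (x - \<zeta>) = c * norm (x + \<zeta>) \<Longrightarrow> norm (y - \<zeta>) = c * norm (y + \<zeta>) \<Longrightarrow>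
       norm (f x - f y) \<le> 1 / Suc n"
      "\<exists>x. norm x < 1 \<and> norm (x - \<zeta>) = c * norm (x + \<zeta>)"
      using short_crosscut_in_disc[OF hol inj fM \<zeta>, of "1 / Suc n" "1 / Suc n"] by metis
    then show ?thesis unfolding Q_def by blast
  qed
  then obtain c q where cq: "\<And>n::nat. 0 < c n \<and> c n < 1 \<and> c n \<le> 1 / Suc n \<and> q n \<in> Q (c n) \<and>
      (\<forall>x\<in>Q (c n). \<forall>y\<in>Q (c n). norm (f x - f y) \<le> 1 / Suc n)"
    by metis
  have q1: "norm (q n) < 1" for n using cq[of n] by (simp add: Q_def)
  have inv0: "(\<lambda>n. 1 / real (Suc n)) \<longlonglongrightarrow> 0"
    using LIMSEQ_inverse_real_of_nat by (simp add: inverse_eq_divide)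
  have qlim: "q \<longlonglongrightarrow> \<zeta>"
  proof -
    have le: "norm (q n - \<zeta>) \<le> 2 * (1 / Suc n)" for n
    proof -
      have "norm (q n - \<zeta>) = c n * norm (q n + \<zeta>)" using cq[of n] by (simp add: Q_def)
      also have "\<dots> \<le> (1 / Suc n) * 2"
        using cq[of n] norm_triangle_ineq[of "q n" \<zeta>] q1[of n] \<zeta> by (intro mult_mono) auto
      finally show ?thesis by simp
    qed
    have "(\<lambda>n. q n - \<zeta>) \<longlonglongrightarrow> 0"
      using always_eventually[OF allI[OF le]] tendsto_mult_right_zero[OF inv0] by (rule Lim_null_comparison)
    then show ?thesis by (simp add: LIM_zero_iff)
  qed
  have "compact (closure G)" using X(4) by simp
  moreover have "f (q n) \<in> closure G" for n using f q1 closure_subset by blast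
  ultimately obtain s k where sk: "strict_mono k" "((\<lambda>n. f (q n)) \<circ> k) \<longlonglongrightarrow> s"
    unfolding compact_def by metis
  have sX: "s \<in> X"
  proof (rule disc_map_boundary_limit[OF g(1) _ f clG])
    show "(q \<circ> k) \<longlonglongrightarrow> \<zeta>" using qlim sk(1) by (rule LIMSEQ_subseq_LIMSEQ)
    show "(\<lambda>n. f ((q \<circ> k) n)) \<longlonglongrightarrow> s" using sk(2) by (simp add: o_def)
  qed (use q1 g \<zeta> in auto)
  have f0: "f 0 \<notin> X" using f[of 0] GX by auto
  then have "dist (f 0) s > 0" using sX by auto
  \<comment> \<open>\<open>f 0\<close> serves as the reference point beyond the crosscut, so the
    disc around \<open>s\<close> has to exclude it.\<close>
  define \<epsilon> where "\<epsilon> = min e (dist (f 0) s / 2)"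
  have \<epsilon>: "\<epsilon> > 0" "\<epsilon> \<le> e" "f 0 \<notin> cball s \<epsilon>" using e \<open>dist (f 0) s > 0\<close> by (auto simp: \<epsilon>_def dist_commute)
  obtain d Y where Y: "d > 0" "d \<le> \<epsilon>" "closed Y" "connected Y" "X \<inter> ball s d \<subseteq> Y" "Y \<subseteq> X" "Y \<subseteq> cball s \<epsilon>"
    using connected_im_kleinen_closedE[OF cik[OF sX] clX \<epsilon>(1)] by blast
  \<comment> \<open>One third of \<open>d\<close> for the distance of \<open>f (q n)\<close> from
    \<open>s\<close> and one third for the oscillation along the crosscut put its image into
    \<open>cball s (2 * d / 3)\<close>, strictly within \<open>ball s d\<close>.\<close>
  obtain n where n: "dist (f (q n)) s < d/3" "1 / Suc n < d/3"
  proof -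
    have "\<forall>\<^sub>F n in sequentially. dist (((\<lambda>n. f (q n)) \<circ> k) n) s < d/3"
      by (rule tendstoD[OF sk(2)]) (use Y(1) in simp)
    moreover have "(\<lambda>n. 1 / real (Suc (k n))) \<longlonglongrightarrow> 0" using LIMSEQ_subseq_LIMSEQ[OF inv0 sk(1)] by (simp add: o_def)
    then have "\<forall>\<^sub>F n in sequentially. 1 / real (Suc (k n)) < d/3" using Y(1) by (intro order_tendstoD) auto
    ultimately have "\<forall>\<^sub>F n in sequentially. dist (f (q (k n))) s < d/3 \<and> 1 / real (Suc (k n)) < d/3"
      by eventually_elim simp
    then show ?thesis using that eventually_happens by fastforce
  qed
  define C where "C = f ` Q (c n)"
  have CG: "C \<subseteq> G" using f by (auto simp: C_def Q_def)
  have "C \<subseteq> cball s (2 * d / 3)"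
  proof
    fix w assume "w \<in> C"
    then obtain x where "x \<in> Q (c n)" "w = f x" by (auto simp: C_def)
    then have "dist w (f (q n)) \<le> 1 / Suc n" using cq[of n] by (simp add: dist_norm)
    then show "w \<in> cball s (2 * d / 3)" using n dist_triangle[of w s "f (q n)"] by (simp add: dist_commute)
  qed
  then have cC: "closure C \<subseteq> cball s (2 * d / 3)" by (simp add: closure_minimal)
  define T where "T = Y \<union> closure C"
  have T: "closed T" using Y by (simp add: T_def closed_Un)
  have XT: "X \<inter> T = Y"
  proof
    have "X \<inter> closure C \<subseteq> X \<inter> ball s d" using cC Y(1) by auto
    then show "X \<inter> T \<subseteq> Y" using Y(5) unfolding T_def by blast
  qed (use Y in \<open>auto simp: T_def\<close>)
  have Tc: "T \<subseteq> cball s \<epsilon>" using Y cC subset_cball[of "2 * d / 3" \<epsilon> s] unfolding T_def by auto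
  have inside: "f z \<in> cball s \<epsilon>" if z: "norm z < 1" "norm (z - \<zeta>) < c n * norm (z + \<zeta>)" for z
  proof (rule ccontr)
    assume out: "f z \<notin> cball s \<epsilon>"
    have cG: "connected G" using X(3) in_components_connected by blast
    have "connected_component (- X) (f z) (f 0)"
      using cG GX f[OF z(1)] f[of 0] unfolding connected_component_def by auto
    then have "connected_component (- (X \<union> T)) (f z) (f 0)"
      using Janiszewski_small[OF X(1) T _ Tc out \<epsilon>(3)] XT Y by simp
    then obtain W where W: "connected W" "W \<subseteq> - (X \<union> T)" "f z \<in> W" "f 0 \<in> W" unfolding connected_component_def by blast
    have "W \<subseteq> connected_component_set (- X) (f z)" using W by (intro connected_component_maximal) auto
    also have "\<dots> = G" using X(3) f[OF z(1)] by (metis components_iff connected_component_eq)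
    finally have WG: "W \<subseteq> G" .
    \<comment> \<open>The sign of \<open>\<psi>\<close> tells the sides of the crosscut apart: it is
      negative at \<open>z\<close> and equals \<open>1 - c n > 0\<close> at 0. So a connected set in
      \<open>G\<close> containing \<open>f z\<close> and \<open>f 0\<close> meets \<open>C\<close>,
      whereas \<open>W\<close> avoids it.\<close>
    define \<psi> where "\<psi> z = norm (z - \<zeta>) - c n * norm (z + \<zeta>)" for z
    have "continuous_on W (\<lambda>w. \<psi> (g w))" unfolding \<psi>_def
      using continuous_on_subset[OF g(1) WG] by (intro continuous_intros)
    then have "connected ((\<lambda>w. \<psi> (g w)) ` W)" using W(1) by (rule connected_continuous_image)
    moreover have "\<psi> z \<in> (\<lambda>w. \<psi> (g w)) ` W" using W(3) f[OF z(1)] by (intro image_eqI[of _ _ "f z"]) auto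
    moreover have "\<psi> 0 \<in> (\<lambda>w. \<psi> (g w)) ` W" using W(4) f[of 0] by (intro image_eqI[of _ _ "f 0"]) auto
    moreover have "\<psi> z \<le> 0" "0 \<le> \<psi> 0" using z cq[of n] \<zeta> by (auto simp: \<psi>_def)
    ultimately have "0 \<in> (\<lambda>w. \<psi> (g w)) ` W" by (meson connectedD_interval)
    then obtain w where w: "w \<in> W" "\<psi> (g w) = 0" by auto
    then have "g w \<in> Q (c n)" using g(2)[of w] WG by (auto simp: Q_def \<psi>_def)
    then have "w \<in> C" using g(2)[of w] w WG unfolding C_def by (metis image_eqI subsetD)
    then show False using w W closure_subset unfolding T_def by blast
  qed
  show ?thesis
  proof (rule that[of "c n" s])
    show "c n > 0" using cq by blast
    fix z assume z: "norm z < 1" "dist z \<zeta> < c n"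
    \<comment> \<open>Since \<open>c n < 1\<close>, points within \<open>c n\<close> of
      \<open>\<zeta>\<close> satisfy \<open>norm (z + \<zeta>) > 1\<close> and therefore lie on the
      side of \<open>\<zeta>\<close>.\<close>
    have "2 = norm (2 * \<zeta>)" using \<zeta> by (simp add: norm_mult)
    also have "2 * \<zeta> = (z + \<zeta>) - (z - \<zeta>)" by simp
    also have "norm \<dots> \<le> norm (z + \<zeta>) + norm (z - \<zeta>)" by (rule norm_triangle_ineq4)
    finally have "norm (z + \<zeta>) > 1" using z cq[of n] by (simp add: dist_norm)
    then have "c n * 1 < c n * norm (z + \<zeta>)" using cq[of n] by (intro mult_strict_left_mono) auto
    then have "norm (z - \<zeta>) < c n * norm (z + \<zeta>)" using z by (simp add: dist_norm)
    then show "f z \<in> cball s e" using inside[OF z(1)] \<epsilon>(2) by auto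
  qed
qed

text \<open>A Lebesgue number for the neighbourhoods of oscillation at most
  \<open>2 * e / 3\<close>. The centre \<open>s\<close> may change with \<open>x\<close> and
  \<open>e\<close>, so no boundary values have to be known beforehand.\<close>

lemma uniformly_continuous_on_small_oscillation:
  fixes f :: "'a::metric_space \<Rightarrow> 'b::metric_space"
  assumes "compact (closure D)"
    and osc: "\<And>x e. x \<in> closure D \<Longrightarrow> e > 0 \<Longrightarrow> \<exists>d>0. \<exists>s. \<forall>z\<in>D. dist z x < d \<longrightarrow> f z \<in> cball s e"
  shows "uniformly_continuous_on D f"
  unfolding uniformly_continuous_on_def
proof (intro allI impI)
  fix e :: real assume e: "e > 0"
  define \<G> where "\<G> = {ball x d | x d. \<exists>s. \<forall>z\<in>D. dist z x < d \<longrightarrow> f z \<in> cball s (e/3)}"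
  have "closure D \<subseteq> \<Union>\<G>"
  proof
    fix x assume "x \<in> closure D"
    then obtain d s where "d > 0" "\<forall>z\<in>D. dist z x < d \<longrightarrow> f z \<in> cball s (e/3)"
      using osc[of x "e/3"] e by auto
    then have "ball x d \<in> \<G>" "x \<in> ball x d" by (auto simp: \<G>_def)
    then show "x \<in> \<Union>\<G>" by blast
  qed
  moreover have "open G" if "G \<in> \<G>" for G using that by (auto simp: \<G>_def)
  ultimately obtain \<epsilon> where \<epsilon>: "0 < \<epsilon>" "\<And>x. x \<in> closure D \<Longrightarrow> \<exists>G \<in> \<G>. ball x \<epsilon> \<subseteq> G"
    using Heine_Borel_lemma[OF assms(1)] by metis
  show "\<exists>d>0. \<forall>x\<in>D. \<forall>x'\<in>D. dist x' x < d \<longrightarrow> dist (f x') (f x) < e"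
  proof (intro exI[of _ \<epsilon>] conjI ballI impI)
    fix x x' assume x: "x \<in> D" "x' \<in> D" "dist x' x < \<epsilon>"
    obtain G where G: "G \<in> \<G>" "ball x \<epsilon> \<subseteq> G" using \<epsilon>(2) x(1) closure_subset by blast
    then obtain y d s where y: "G = ball y d" "\<forall>z\<in>D. dist z y < d \<longrightarrow> f z \<in> cball s (e/3)"
      unfolding \<G>_def by blast
    have "x \<in> ball x \<epsilon>" "x' \<in> ball x \<epsilon>" using x \<epsilon> by (auto simp: dist_commute)
    then have "x \<in> ball y d" "x' \<in> ball y d" using G y by blast+
    then have "f x \<in> cball s (e/3)" "f x' \<in> cball s (e/3)" using y(2) x by (auto simp: dist_commute)
    then show "dist (f x') (f x) < e" using dist_triangle2[of "f x'" "f x" s] e by (auto simp: dist_commute)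
  qed (rule \<epsilon>)
qed

text \<open>Small oscillation at every boundary point makes the Riemann map uniformly continuous, so
  it extends to the closed disc. The \<open>f\<close> that is returned is this extension, and its
  values on the circle are limits along radii, which lie in \<open>X\<close>.\<close>

theorem Caratheodory_extension:
  fixes X :: "complex set"
  assumes X: "compact X" "connected X" "G \<in> components (- X)" "bounded G"
    and cik: "\<And>s. s \<in> X \<Longrightarrow> connected_im_kleinen X s"
  obtains f g where "f holomorphic_on ball 0 1" "continuous_on (cball 0 1) f" "continuous_on G g"
    "\<And>z. norm z < 1 \<Longrightarrow> f z \<in> G \<and> g (f z) = z" "\<And>w. w \<in> G \<Longrightarrow> norm (g w) < 1 \<and> f (g w) = w"
    "\<And>z. norm z = 1 \<Longrightarrow> f z \<in> X"
proof -
  have clX: "closed X" using X(1) by (rule compact_imp_closed)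
  note G = component_simply_connected[OF clX X(2-4)]
  have "G \<noteq> {}" "G \<noteq> UNIV" using X(3,4) in_components_nonempty by auto
  then obtain g f where gf: "g holomorphic_on G" "f holomorphic_on ball 0 1"
     "\<And>w. w \<in> G \<Longrightarrow> g w \<in> ball 0 1 \<and> f (g w) = w" "\<And>z. z \<in> ball 0 1 \<Longrightarrow> f z \<in> G \<and> g (f z) = z"
    using Riemann_mapping_theorem[of G] G(1,3) by metis
  have contg: "continuous_on G g" using gf(1) by (rule holomorphic_on_imp_continuous_on)
  have contf: "continuous_on (ball 0 1) f" using gf(2) by (rule holomorphic_on_imp_continuous_on)
  have g: "norm (g w) < 1 \<and> f (g w) = w" if "w \<in> G" for w using gf(3)[OF that] by simp
  have f: "f z \<in> G \<and> g (f z) = z" if "norm z < 1" for z using gf(4)[of z] that by simp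
  have "uniformly_continuous_on (ball 0 1) f"
  proof (rule uniformly_continuous_on_small_oscillation)
    show "compact (closure (ball (0::complex) 1))" by simp
    fix x :: complex and e :: real assume x: "x \<in> closure (ball 0 1)" and e: "e > 0"
    show "\<exists>d>0. \<exists>s. \<forall>z\<in>ball 0 1. dist z x < d \<longrightarrow> f z \<in> cball s e"
    proof (cases "norm x = 1")
      case True
      obtain d s where "d > 0" "\<And>z. norm z < 1 \<Longrightarrow> dist z x < d \<Longrightarrow> f z \<in> cball s e"
        using disc_map_small_oscillation[OF X cik gf(2) contg g f True e] by blast
      then show ?thesis by (intro exI[of _ d] conjI exI[of _ s]) auto
    next
      case False
      then have "x \<in> ball 0 1" using x by simp
      then obtain d where "d > 0" "\<And>z. z \<in> ball 0 1 \<Longrightarrow> dist z x < d \<Longrightarrow> dist (f z) (f x) < e"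
        using contf e unfolding continuous_on_iff by meson
      then show ?thesis by (intro exI[of _ d] conjI exI[of _ "f x"]) (auto simp: dist_commute less_imp_le)
    qed
  qed
  then obtain h where h: "uniformly_continuous_on (closure (ball 0 1)) h" "\<And>z. z \<in> ball 0 1 \<Longrightarrow> f z = h z"
    using uniformly_continuous_on_extension_on_closure by metis
  have conth: "continuous_on (cball 0 1) h" using h(1) uniformly_continuous_imp_continuous by auto
  show ?thesis
  proof (rule that[of h g])
    show "h holomorphic_on ball 0 1" using gf(2) h(2) by (rule holomorphic_transform)
    show "h z \<in> G \<and> g (h z) = z" if "norm z < 1" for z using f[OF that] h(2)[of z] that by simp
    show "norm (g w) < 1 \<and> h (g w) = w" if "w \<in> G" for w using g[OF that] h(2)[of "g w"] by simp
    fix \<zeta> :: complex assume \<zeta>: "norm \<zeta> = 1"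
    define x where "x n = of_real (1 - 1 / real (Suc n)) * \<zeta>" for n
    have x1: "norm (x n) < 1" for n
      using \<zeta> unfolding x_def norm_mult norm_of_real by simp
    have lim1: "(\<lambda>n. 1 - 1 / real (Suc n)) \<longlonglongrightarrow> 1 - 0"
      using LIMSEQ_inverse_real_of_nat unfolding inverse_eq_divide by (intro tendsto_intros)
    have "x \<longlonglongrightarrow> of_real (1 - 0) * \<zeta>"
      unfolding x_def by (rule tendsto_mult[OF tendsto_of_real[OF lim1] tendsto_const])
    then have xlim: "x \<longlonglongrightarrow> \<zeta>" by simp
    have "(\<lambda>n. h (x n)) \<longlonglongrightarrow> h \<zeta>"
      using x1 \<zeta> by (intro continuous_on_tendsto_compose[OF conth xlim]) (auto simp: less_imp_le)
    then have "(\<lambda>n. f (x n)) \<longlonglongrightarrow> h \<zeta>" using h(2) x1 by simp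
    then show "h \<zeta> \<in> X"
      using g f by (intro disc_map_boundary_limit[OF contg _ _ G(5) x1 xlim \<zeta>]) auto
  qed (use conth contg in auto)
qed

subsection \<open>Boundary discs and local connectivity\<close>

lemma arc_near_one:
  assumes x: "norm x1 = 1" "norm x2 = 1" "x1 \<noteq> 1" "x2 \<noteq> 1" and e: "e > 0"
  obtains d Y where "d > 0" "connected Y" "sphere 0 1 \<inter> ball 1 d \<subseteq> Y" "Y \<subseteq> open_arc x1 x2 \<inter> ball 1 e" "Y \<subseteq> sphere 0 1"
proof -
  define e' where "e' = min e (min (dist 1 x1) (dist 1 x2))"
  have e': "e' > 0" "e' \<le> e" "e' \<le> dist 1 x1" "e' \<le> dist 1 x2" using x e by (auto simp: e'_def)
  have "connected_im_kleinen (sphere 0 1) (1::complex)"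
    by (rule cik_locally_connected[OF locally_connected_sphere]) simp
  then obtain d Y where Y: "d > 0" "connected Y" "sphere 0 1 \<inter> ball 1 d \<subseteq> Y" "Y \<subseteq> sphere 0 1 \<inter> ball (1::complex) e'"
    using e'(1) unfolding connected_im_kleinen_def by meson
  have "Y \<subseteq> sphere 0 1 - {x1, x2}" using Y(4) e' by auto
  moreover have "1 \<in> Y" using Y by auto
  ultimately have "Y \<subseteq> open_arc x1 x2" unfolding open_arc_def using Y(2) by (intro connected_component_maximal)
  moreover have "Y \<subseteq> ball 1 e" "Y \<subseteq> sphere 0 1" using Y(4) e'(2) by auto
  ultimately show ?thesis using that[of d Y] Y by simp
qed

text \<open>Boundary uniqueness is applied to the product of \<open>\<phi> z - p\<close> with the
  conjugate of \<open>\<phi> (cnj z) - p\<close>, which is holomorphic. The product form provides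
  one circle around 1 both of whose intersections with the unit circle, \<open>x\<close> and
  \<open>cnj x\<close>, avoid the value \<open>p\<close>.\<close>

lemma boundary_values_nonconstant:
  fixes \<phi> :: "complex \<Rightarrow> complex"
  assumes cont: "continuous_on (cball 0 1) \<phi>" and hol: "\<phi> holomorphic_on ball 0 1"
    and p: "\<phi> 0 \<noteq> p" and d: "d > 0"
  obtains x where "norm x = 1" "dist x 1 < d" "\<phi> x \<noteq> p" "\<phi> (cnj x) \<noteq> p"
proof -
  define f where "f z = (\<phi> z - p) * cnj (\<phi> (cnj z) - p)" for z
  have "continuous_on (cball 0 1) (\<lambda>z. \<phi> (cnj z))"
    by (rule continuous_on_compose2[OF cont]) (auto intro: continuous_intros)
  then have cf: "continuous_on (cball 0 1) f" unfolding f_def using cont by (intro continuous_intros)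
  have "cnj ` ball 0 1 = ball 0 1"
  proof
    show "ball 0 1 \<subseteq> cnj ` ball 0 1"
    proof
      fix z :: complex assume "z \<in> ball 0 1"
      then show "z \<in> cnj ` ball 0 1" by (intro image_eqI[of _ _ "cnj z"]) auto
    qed
  qed auto
  then have "(cnj \<circ> \<phi> \<circ> cnj) holomorphic_on ball 0 1"
    using hol by (intro holomorphic_on_compose_cnj_cnj) auto
  then have "(\<lambda>z. cnj (\<phi> (cnj z)) - cnj p) holomorphic_on ball 0 1"
    by (intro holomorphic_intros) (simp add: o_def)
  then have hf: "f holomorphic_on ball 0 1" unfolding f_def complex_cnj_diff
    by (rule holomorphic_on_mult[OF holomorphic_on_diff[OF hol holomorphic_on_const]])
  have "f 0 \<noteq> 0" using p by (simp add: f_def)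
  then obtain x where "norm x = 1" "dist x 1 < d" "f x \<noteq> 0"
    using zero_on_boundary_arc[OF cf hf d, of 0] by auto
  then show ?thesis using that[of x] by (simp add: f_def)
qed

text \<open>A small half-disc at 1 is mapped onto an open set whose frontier near \<open>p\<close> lies on the image
  of the arc, so a segment that leaves this set near \<open>p\<close> meets the component of \<open>p\<close>.\<close>

lemma boundary_arc_cuts_segments:
  fixes \<phi> :: "complex \<Rightarrow> complex"
  assumes \<Omega>: "open \<Omega>" and hol: "\<phi> holomorphic_on ball 0 1" and inj: "inj_on \<phi> (ball 0 1)"
    and im: "\<phi> ` ball 0 1 \<subseteq> \<Omega>" and cont: "continuous_on (cball 0 1) \<phi>"
    and x: "norm x1 = 1" "norm x2 = 1" "x1 \<noteq> 1" "x2 \<noteq> 1"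
    and p: "\<phi> 1 = p" and arc: "\<phi> ` open_arc x1 x2 \<subseteq> frontier \<Omega>" and r: "r > 0"
  obtains \<epsilon> \<delta> where "\<epsilon> > 0" "\<delta> > 0"
    "\<And>\<zeta> q. norm \<zeta> < 1 \<Longrightarrow> dist \<zeta> 1 < \<epsilon> \<Longrightarrow> q \<in> frontier \<Omega> \<Longrightarrow> \<phi> \<zeta> \<in> ball p \<delta> \<Longrightarrow> q \<in> ball p \<delta> \<Longrightarrow>
       \<exists>c\<in>connected_component_set (frontier \<Omega> \<inter> cball p r) p. dist q c \<le> dist q (\<phi> \<zeta>)"
proof -
  let ?C = "connected_component_set (frontier \<Omega> \<inter> cball p r) p"
  have disj: "\<Omega> \<inter> frontier \<Omega> = {}" using \<Omega> by (auto simp: frontier_def interior_open)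
  obtain e where e: "e > 0" "\<And>y. y \<in> cball 0 1 \<Longrightarrow> dist y 1 < e \<Longrightarrow> dist (\<phi> y) p < r"
    using cont r p unfolding continuous_on_iff by (metis mem_cball_0 norm_one order_refl)
  obtain d Y where Y: "d > 0" "connected Y" "sphere 0 1 \<inter> ball 1 d \<subseteq> Y" "Y \<subseteq> open_arc x1 x2 \<inter> ball 1 e" "Y \<subseteq> sphere 0 1"
    using arc_near_one[OF x e(1)] by blast
  have Y1: "1 \<in> Y" and Ycb: "Y \<subseteq> cball 0 1" using Y by auto
  have YC: "\<phi> ` Y \<subseteq> ?C"
  proof (rule connected_component_maximal)
    show "p \<in> \<phi> ` Y" using Y1 p by blast
    show "connected (\<phi> ` Y)" by (rule connected_continuous_image[OF continuous_on_subset[OF cont Ycb] Y(2)])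
    have "dist (\<phi> y) p < r" if "y \<in> Y" for y
    proof -
      have "y \<in> cball 0 1" "y \<in> ball 1 e" using that Ycb Y(4) by blast+
      then show ?thesis using e(2)[of y] by (simp add: dist_commute)
    qed
    then show "\<phi> ` Y \<subseteq> frontier \<Omega> \<inter> cball p r"
      using arc Y(4) by (auto simp: dist_commute less_imp_le)
  qed
  have pF: "p \<in> frontier \<Omega>" using arc Y1 Y(4) p by blast
  have "\<phi> 0 \<in> \<Omega>" by (intro subsetD[OF im] imageI) simp
  then have "\<phi> 0 \<noteq> p" using pF disj by blast
  then obtain x where x: "norm x = 1" "dist x 1 < d" "\<phi> x \<noteq> p" "\<phi> (cnj x) \<noteq> p"
    using boundary_values_nonconstant[OF cont hol _ Y(1)] by blast
  \<comment> \<open>With this radius the crosscut has its ends at \<open>x\<close> and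
    \<open>cnj x\<close>, where \<open>\<phi>\<close> is not \<open>p\<close>; in the open disc
    \<open>\<phi>\<close> takes values in \<open>\<Omega>\<close>. So its compact image
    \<open>K\<close> keeps a distance \<open>\<delta>\<close> from \<open>p\<close>.\<close>
  define \<epsilon> where "\<epsilon> = dist x 1"
  have \<epsilon>: "\<epsilon> > 0" "\<epsilon> < d" using x p by (auto simp: \<epsilon>_def)
  define K where "K = \<phi> ` (cball 0 1 \<inter> sphere 1 \<epsilon>)"
  have compK: "compact K" unfolding K_def
    using cont by (intro compact_continuous_image compact_Int) (auto intro: continuous_on_subset)
  have "p \<notin> K"
  proof
    assume "p \<in> K"
    then obtain y where y: "norm y \<le> 1" "dist 1 y = \<epsilon>" "\<phi> y = p" by (auto simp: K_def)
    show False
    proof (cases "norm y = 1")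
      case True
      have sq: "(norm (z - 1))\<^sup>2 = 2 - 2 * Re z" if "norm z = 1" for z :: complex
      proof -
        have "(Re z)\<^sup>2 + (Im z)\<^sup>2 = 1" using that by (metis cmod_power2 one_power2)
        moreover have "(norm (z - 1))\<^sup>2 = (Re z)\<^sup>2 + (Im z)\<^sup>2 - 2 * Re z + 1"
          by (simp add: cmod_power2 power2_diff)
        ultimately show ?thesis by simp
      qed
      have "norm (y - 1) = norm (x - 1)" using y(2) unfolding \<epsilon>_def dist_norm by (metis norm_minus_commute)
      then have Re: "Re y = Re x" using sq[OF True] sq[OF x(1)] by simp
      have "(Re y)\<^sup>2 + (Im y)\<^sup>2 = (Re x)\<^sup>2 + (Im x)\<^sup>2" using True x(1) by (metis cmod_power2)
      then have "Im y = Im x \<or> Im y = - Im x" using Re by (simp add: power2_eq_iff)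
      then have "y = x \<or> y = cnj x" using Re by (auto simp: complex_eq_iff)
      then show False using x y by auto
    next
      case False
      then have "y \<in> ball 0 1" using y(1) by simp
      then have "\<phi> y \<in> \<Omega>" using im by blast
      then show False using y(3) pF disj by blast
    qed
  qed
  then obtain \<delta> where \<delta>: "\<delta> > 0" "ball p \<delta> \<subseteq> - K"
    using compK by (metis ComplI compact_imp_closed open_Compl open_contains_ball)
  \<comment> \<open>\<open>V\<close> is open by invariance of domain. By compactness its frontier
    comes from points at distance \<open>\<epsilon>\<close> from 1, which give \<open>K\<close>, or
    from points of the unit circle closer to 1, which lie in \<open>Y\<close>.\<close>
  define V where "V = \<phi> ` (ball 0 1 \<inter> ball 1 \<epsilon>)"
  have "open V" unfolding V_def
    using hol inj by (intro invariance_of_domain) (auto intro: holomorphic_on_imp_continuous_on holomorphic_on_subset inj_on_subset)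
  have "compact (\<phi> ` (cball 0 1 \<inter> cball 1 \<epsilon>))"
    using cont by (intro compact_continuous_image compact_Int) (auto intro: continuous_on_subset)
  moreover have "V \<subseteq> \<phi> ` (cball 0 1 \<inter> cball 1 \<epsilon>)" unfolding V_def by (intro image_mono) auto
  ultimately have clV: "closure V \<subseteq> \<phi> ` (cball 0 1 \<inter> cball 1 \<epsilon>)"
    by (simp add: closure_minimal compact_imp_closed)
  have frV: "frontier V \<subseteq> K \<union> ?C"
  proof
    fix v assume v: "v \<in> frontier V"
    then have "v \<in> closure V" "v \<notin> V" using \<open>open V\<close> by (auto simp: frontier_def interior_open)
    then obtain y where y: "v = \<phi> y" "y \<in> cball 0 1" "y \<in> cball 1 \<epsilon>" "y \<notin> ball 0 1 \<inter> ball 1 \<epsilon>"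
      using clV unfolding V_def by blast
    show "v \<in> K \<union> ?C"
    proof (cases "dist 1 y = \<epsilon>")
      case True
      then show ?thesis using y unfolding K_def by auto
    next
      case False
      then have "y \<in> sphere 0 1 \<inter> ball 1 d" using y \<epsilon> by auto
      then show ?thesis using Y(3) YC y(1) by blast
    qed
  qed
  show ?thesis
  proof (rule that[OF \<epsilon>(1) \<delta>(1)])
    fix \<zeta> q assume \<zeta>: "norm \<zeta> < 1" "dist \<zeta> 1 < \<epsilon>" "\<phi> \<zeta> \<in> ball p \<delta>" and q: "q \<in> frontier \<Omega>" "q \<in> ball p \<delta>"
    have "\<phi> \<zeta> \<in> V" using \<zeta> unfolding V_def by (auto simp: dist_commute)
    moreover have "V \<subseteq> \<Omega>" using im unfolding V_def by auto
    then have "q \<notin> V" using q disj by blast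
    ultimately have "closed_segment (\<phi> \<zeta>) q \<inter> V \<noteq> {}" "closed_segment (\<phi> \<zeta>) q - V \<noteq> {}" by auto
    then have "closed_segment (\<phi> \<zeta>) q \<inter> frontier V \<noteq> {}"
      by (intro connected_Int_frontier) auto
    then obtain c where c: "c \<in> closed_segment (\<phi> \<zeta>) q" "c \<in> frontier V" by blast
    have "closed_segment (\<phi> \<zeta>) q \<subseteq> ball p \<delta>" using \<zeta> q by (intro closed_segment_subset convex_ball)
    then have "c \<in> ?C" using c frV \<delta>(2) by blast
    moreover have "dist q c \<le> dist q (\<phi> \<zeta>)" using dist_in_closed_segment[OF c(1)] by (simp add: dist_commute)
    ultimately show "\<exists>c\<in>?C. dist q c \<le> dist q (\<phi> \<zeta>)" by blast
  qed
qed

text \<open>The part of Condition 2 that follows the choice of a subsequence; here \<open>z\<close>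
  is already the subsequence.\<close>

definition boundary_disc :: "complex set \<Rightarrow> complex \<Rightarrow> (nat \<Rightarrow> complex) \<Rightarrow> (complex \<Rightarrow> complex) \<Rightarrow> complex \<Rightarrow> complex \<Rightarrow> bool" where
  "boundary_disc \<Omega> p z \<phi> x1 x2 \<longleftrightarrow>
     \<phi> holomorphic_on ball 0 1 \<and> inj_on \<phi> (ball 0 1) \<and> \<phi> ` ball 0 1 \<subseteq> \<Omega> \<and>
     continuous_on (cball 0 1) \<phi> \<and>
     x1 \<in> sphere 0 1 - {1} \<and> x2 \<in> sphere 0 1 - {1} \<and> x1 \<noteq> x2 \<and>
     \<phi> 1 = p \<and> \<phi> ` open_arc x1 x2 \<subseteq> frontier \<Omega> \<and>
     (\<forall>n. z n \<in> \<phi> ` Reg x1 x2) \<and>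
     (\<lambda>n. inv_into (ball 0 1) \<phi> (z n)) \<longlonglongrightarrow> 1"

lemma condition2_altdef:
  "condition2 \<Omega> \<longleftrightarrow>
     (\<exists>S \<subseteq> frontier \<Omega>. closed S \<and> totally_disconnected S \<and>
        (\<forall>p \<in> frontier \<Omega> - S. \<forall>z. (\<forall>n. z n \<in> \<Omega>) \<and> z \<longlonglongrightarrow> p \<longrightarrow>
           (\<exists>k \<phi> x1 x2. strict_mono k \<and> boundary_disc \<Omega> p (z \<circ> k) \<phi> x1 x2)))"
  unfolding condition2_def boundary_disc_def comp_def by simp

lemma boundary_discD:
  assumes "boundary_disc \<Omega> p z \<phi> x1 x2"
  shows "\<phi> holomorphic_on ball 0 1" "inj_on \<phi> (ball 0 1)" "\<phi> ` ball 0 1 \<subseteq> \<Omega>"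
     "continuous_on (cball 0 1) \<phi>" "norm x1 = 1" "norm x2 = 1" "x1 \<noteq> 1" "x2 \<noteq> 1" "\<phi> 1 = p"
     "\<phi> ` open_arc x1 x2 \<subseteq> frontier \<Omega>"
     "norm (inv_into (ball 0 1) \<phi> (z n)) < 1" "\<phi> (inv_into (ball 0 1) \<phi> (z n)) = z n"
     "(\<lambda>n. inv_into (ball 0 1) \<phi> (z n)) \<longlonglongrightarrow> 1"
proof -
  show *: "\<phi> holomorphic_on ball 0 1" "inj_on \<phi> (ball 0 1)" "\<phi> ` ball 0 1 \<subseteq> \<Omega>"
     "continuous_on (cball 0 1) \<phi>" "norm x1 = 1" "norm x2 = 1" "x1 \<noteq> 1" "x2 \<noteq> 1" "\<phi> 1 = p"
     "\<phi> ` open_arc x1 x2 \<subseteq> frontier \<Omega>"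
     "(\<lambda>n. inv_into (ball 0 1) \<phi> (z n)) \<longlonglongrightarrow> 1"
    using assms by (auto simp: boundary_disc_def)
  have "z n \<in> \<phi> ` ball 0 1"
    using assms image_mono[OF Reg_subset_ball[OF *(5,6)], of \<phi>] unfolding boundary_disc_def by blast
  then show "norm (inv_into (ball 0 1) \<phi> (z n)) < 1" "\<phi> (inv_into (ball 0 1) \<phi> (z n)) = z n"
    using inv_into_into[of "z n" \<phi> "ball 0 1"] f_inv_into_f[of "z n" \<phi> "ball 0 1"] by auto
qed

lemma boundary_discs_imp_cik:
  fixes \<Omega> :: "complex set"
  assumes \<Omega>: "open \<Omega>" and p: "p \<in> frontier \<Omega>"
    and H: "\<And>z. (\<forall>n. z n \<in> \<Omega>) \<Longrightarrow> z \<longlonglongrightarrow> p \<Longrightarrow> \<exists>k \<phi> x1 x2. strict_mono k \<and> boundary_disc \<Omega> p (z \<circ> k) \<phi> x1 x2"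
  shows "connected_im_kleinen (frontier \<Omega>) p"
  unfolding connected_im_kleinen_def
proof (intro allI impI)
  fix e :: real assume e: "e > 0"
  \<comment> \<open>With a closed disc of radius less than \<open>e\<close>, the component
    \<open>?C\<close> is closed, so points off it have positive distance to it, and still lies in
    \<open>ball p e\<close>.\<close>
  define r where "r = e / 2"
  have r: "r > 0" "r < e" using e by (auto simp: r_def)
  let ?C = "connected_component_set (frontier \<Omega> \<inter> cball p r) p"
  have pC: "p \<in> ?C" using p r by simp
  have "\<exists>d>0. frontier \<Omega> \<inter> ball p d \<subseteq> ?C"
  proof (rule ccontr)
    assume "\<not> ?thesis"
    then have "\<exists>q. q \<in> frontier \<Omega> \<and> q \<in> ball p (1 / Suc n) \<and> q \<notin> ?C" for n :: nat
      by (metis IntE of_nat_0_less_iff subsetI zero_less_Suc zero_less_divide_1_iff)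
    then obtain q where q: "\<And>n::nat. q n \<in> frontier \<Omega> \<and> q n \<in> ball p (1 / Suc n) \<and> q n \<notin> ?C" by metis
    have cl: "closed ?C" by (intro closed_connected_component closed_Int) auto
    have ne: "?C \<noteq> {}" using pC by blast
    have inf: "infdist (q n) ?C > 0" for n
      using infdist_pos_not_in_closed[OF cl ne, of "q n"] q[of n] by blast
    have "\<exists>z. z \<in> \<Omega> \<and> dist z (q n) < min (1 / Suc n) (infdist (q n) ?C)" for n
    proof -
      have "q n \<in> closure \<Omega>" using q[of n] by (simp add: frontier_def)
      moreover have "min (1 / Suc n) (infdist (q n) ?C) > 0" using inf[of n] by simp
      ultimately show ?thesis unfolding closure_approachable by blast
    qed
    then obtain z where z: "\<And>n. z n \<in> \<Omega> \<and> dist (z n) (q n) < min (1 / Suc n) (infdist (q n) ?C)" by metis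
    have inv0: "(\<lambda>n. 1 / real (Suc n)) \<longlonglongrightarrow> 0"
      using LIMSEQ_inverse_real_of_nat by (simp add: inverse_eq_divide)
    have qp: "norm (dist (q n) p) \<le> 1 / Suc n" for n using q[of n] by (simp add: dist_commute less_imp_le)
    have "(\<lambda>n. dist (q n) p) \<longlonglongrightarrow> 0"
      using always_eventually[OF allI[OF qp]] inv0 by (rule Lim_null_comparison)
    then have qlim: "q \<longlonglongrightarrow> p" by (rule tendsto_dist_iff[THEN iffD2])
    have zp: "norm (dist (z n) p) \<le> 2 * (1 / Suc n)" for n
      using z[of n] qp[of n] dist_triangle[of "z n" p "q n"] by simp
    have "(\<lambda>n. dist (z n) p) \<longlonglongrightarrow> 0"
      using always_eventually[OF allI[OF zp]] tendsto_mult_right_zero[OF inv0] by (rule Lim_null_comparison)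
    then have zlim: "z \<longlonglongrightarrow> p" by (rule tendsto_dist_iff[THEN iffD2])
    then obtain k \<phi> x1 x2 where k: "strict_mono k" and bd: "boundary_disc \<Omega> p (z \<circ> k) \<phi> x1 x2"
      using H[of z] z by blast
    note b = boundary_discD[OF bd]
    obtain \<epsilon> \<delta> where cut: "\<epsilon> > 0" "\<delta> > 0"
      "\<And>\<zeta> q. norm \<zeta> < 1 \<Longrightarrow> dist \<zeta> 1 < \<epsilon> \<Longrightarrow> q \<in> frontier \<Omega> \<Longrightarrow> \<phi> \<zeta> \<in> ball p \<delta> \<Longrightarrow> q \<in> ball p \<delta> \<Longrightarrow>
       \<exists>c\<in>?C. dist q c \<le> dist q (\<phi> \<zeta>)"
      using boundary_arc_cuts_segments[OF \<Omega> b(1-10) r(1)] by blast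
    let ?\<zeta> = "\<lambda>n. inv_into (ball 0 1) \<phi> ((z \<circ> k) n)"
    have "\<forall>\<^sub>F n in sequentially. dist (?\<zeta> n) 1 < \<epsilon>" by (rule tendstoD[OF b(13) cut(1)])
    moreover have "\<forall>\<^sub>F n in sequentially. dist ((z \<circ> k) n) p < \<delta>"
      by (rule tendstoD[OF LIMSEQ_subseq_LIMSEQ[OF zlim k] cut(2)])
    moreover have "\<forall>\<^sub>F n in sequentially. dist ((q \<circ> k) n) p < \<delta>"
      by (rule tendstoD[OF LIMSEQ_subseq_LIMSEQ[OF qlim k] cut(2)])
    ultimately have "\<forall>\<^sub>F n in sequentially. dist (?\<zeta> n) 1 < \<epsilon> \<and> dist ((z \<circ> k) n) p < \<delta> \<and> dist ((q \<circ> k) n) p < \<delta>"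
      by eventually_elim simp
    then obtain n where n: "dist (?\<zeta> n) 1 < \<epsilon>" "dist ((z \<circ> k) n) p < \<delta>" "dist ((q \<circ> k) n) p < \<delta>"
      using eventually_happens by fastforce
    obtain c where c: "c \<in> ?C" "dist (q (k n)) c \<le> dist (q (k n)) (\<phi> (?\<zeta> n))"
      using cut(3)[OF b(11) n(1), of "q (k n)"] b(12)[of n] n q[of "k n"] by (auto simp: dist_commute)
    then have "dist (q (k n)) c \<le> dist (z (k n)) (q (k n))" using b(12)[of n] by (simp add: dist_commute)
    also have "\<dots> < infdist (q (k n)) ?C" using z[of "k n"] by simp
    also have "\<dots> \<le> dist (q (k n)) c" using c(1) by (rule infdist_le)
    finally show False by simp
  qed
  then obtain d where d: "d > 0" "frontier \<Omega> \<inter> ball p d \<subseteq> ?C" by blast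
  have "?C \<subseteq> frontier \<Omega> \<inter> cball p r" by (rule connected_component_subset)
  then have "?C \<subseteq> frontier \<Omega> \<inter> ball p e" using r by auto
  then show "\<exists>d>0. \<exists>Y. connected Y \<and> frontier \<Omega> \<inter> ball p d \<subseteq> Y \<and> Y \<subseteq> frontier \<Omega> \<inter> ball p e"
    using d connected_connected_component by blast
qed

text \<open>The boundary values of \<open>\<phi>\<close> near 1 are not all \<open>p\<close>, so the
  image of a small arc is a connected subset of the frontier with a second point.\<close>

lemma boundary_disc_imp_nonsingleton:
  assumes \<Omega>: "open \<Omega>" and bd: "boundary_disc \<Omega> p z \<phi> x1 x2"
  shows "\<not> is_singleton (connected_component_set (frontier \<Omega>) p)"
proof -
  note b = boundary_discD[OF bd]
  have disj: "\<Omega> \<inter> frontier \<Omega> = {}" using \<Omega> by (auto simp: frontier_def interior_open)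
  obtain d Y where Y: "d > 0" "connected Y" "sphere 0 1 \<inter> ball 1 d \<subseteq> Y" "Y \<subseteq> open_arc x1 x2 \<inter> ball 1 1" "Y \<subseteq> sphere 0 1"
    using arc_near_one[OF b(5-8), of 1] by auto
  have Y1: "1 \<in> Y" and Ycb: "Y \<subseteq> cball 0 1" using Y by auto
  have "p \<in> frontier \<Omega>" using Y1 Y(4) b(9,10) by blast
  moreover have "\<phi> 0 \<in> \<Omega>" by (intro subsetD[OF b(3)] imageI) simp
  ultimately have "\<phi> 0 \<noteq> p" using disj by blast
  then obtain x where x: "norm x = 1" "dist x 1 < d" "\<phi> x \<noteq> p"
    using boundary_values_nonconstant[OF b(4,1) _ Y(1)] by blast
  show ?thesis
  proof (rule is_singleton_connected_component)
    show "\<phi> ` Y \<subseteq> frontier \<Omega>" using Y(4) b(10) by blast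
    show "connected (\<phi> ` Y)" by (rule connected_continuous_image[OF continuous_on_subset[OF b(4) Ycb] Y(2)])
    show "p \<in> \<phi> ` Y" using Y1 b(9) by blast
    show "\<phi> x \<in> \<phi> ` Y" using x Y(3) by (intro imageI) (auto simp: dist_commute)
    show "p \<noteq> \<phi> x" using x by simp
  qed
qed

lemma boundary_disc_exists:
  fixes \<Omega> :: "complex set"
  assumes \<Omega>: "open \<Omega>" "connected \<Omega>" and pF: "p \<in> frontier \<Omega>"
    and U: "openin (top_of_set (frontier \<Omega>)) U" "connected U" "p \<in> U" "u \<in> U" "u \<noteq> p"
    and r1: "r1 > 0" and cik: "\<And>q. q \<in> frontier \<Omega> \<inter> ball p r1 \<Longrightarrow> connected_im_kleinen (frontier \<Omega>) q"
    and z: "\<And>n. z n \<in> \<Omega>" "z \<longlonglongrightarrow> p"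
  shows "\<exists>k \<phi> x1 x2. strict_mono k \<and> boundary_disc \<Omega> p (z \<circ> k) \<phi> x1 x2"
proof -
  let ?F = "frontier \<Omega>"
  have disj: "\<Omega> \<inter> ?F = {}" using \<Omega> by (auto simp: frontier_def interior_open)
  have UF: "U \<subseteq> ?F" using U(1) openin_imp_subset by blast
  obtain e0 where e0: "e0 > 0" "?F \<inter> ball p e0 \<subseteq> U"
    using U(1,3) unfolding openin_contains_ball by (metis Int_commute)
  have "p \<noteq> z 0" using z(1)[of 0] pF disj by auto
  \<comment> \<open>\<open>e0\<close> puts the trace of the frontier inside \<open>U\<close>,
    \<open>r1\<close> gives connectedness im kleinen there, \<open>dist p u\<close> makes
    \<open>U\<close> leave the disc, so that the trace is connected, and \<open>dist p (z 0)\<close>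
    makes \<open>\<Omega>\<close> leave it.\<close>
  define R where "R = min (min e0 r1) (min (dist p u) (dist p (z 0)))"
  have R: "R > 0" "R \<le> e0" "R \<le> r1" "R \<le> dist p u" "R \<le> dist p (z 0)"
    using e0(1) r1 U(5) \<open>p \<noteq> z 0\<close> by (auto simp: R_def)
  define r where "r = R / 2"
  have r: "r > 0" "r < e0" "r < r1" "r < dist p u" "r < dist p (z 0)" using R by (auto simp: r_def)
  define X where "X = disc_trace ?F p r"
  have compX: "compact X" unfolding X_def by (rule compact_disc_trace) simp
  have connX: "connected X" unfolding X_def
    using e0 r UF by (intro connected_disc_trace[OF r(1) U(2) _ UF U(4)]) auto
  have cikX: "connected_im_kleinen X s" if "s \<in> X" for s
    using that cik r unfolding X_def by (intro cik_disc_trace) auto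
  have "\<not> \<Omega> \<subseteq> cball p r" using z(1)[of 0] r(5) by auto
  then obtain G where G: "G \<in> components (- X)" "G \<subseteq> \<Omega>" "G \<subseteq> ball p r" "infinite {n. z n \<in> G}"
    using infinitely_many_in_one_component[OF \<Omega> _ r(1)] connX cikX z unfolding X_def by blast
  have "bounded G" using G(3) bounded_ball bounded_subset by blast
  then obtain f g where f: "f holomorphic_on ball 0 1" "continuous_on (cball 0 1) f" "continuous_on G g"
    "\<And>z. norm z < 1 \<Longrightarrow> f z \<in> G \<and> g (f z) = z" "\<And>w. w \<in> G \<Longrightarrow> norm (g w) < 1 \<and> f (g w) = w"
    "\<And>z. norm z = 1 \<Longrightarrow> f z \<in> X"
    using Caratheodory_extension[OF compX connX G(1) _ cikX] by blast
  obtain k0 :: "nat \<Rightarrow> nat" where k0: "strict_mono k0" "\<And>n. z (k0 n) \<in> G"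
    using infinite_enumerate[OF G(4)] by auto
  define w where "w n = g (z (k0 n))" for n
  have w: "norm (w n) < 1" "f (w n) = z (k0 n)" for n using f(5)[OF k0(2)] by (auto simp: w_def)
  have "w n \<in> cball 0 1" for n using w(1)[of n] by simp
  then obtain \<zeta> k1 where k1: "\<zeta> \<in> cball 0 1" "strict_mono k1" "(w \<circ> k1) \<longlonglongrightarrow> \<zeta>"
    using compact_cball[of "0::complex" 1] unfolding compact_def by metis
  have "(\<lambda>n. f ((w \<circ> k1) n)) \<longlonglongrightarrow> f \<zeta>"
    using w(1) k1(1) by (intro continuous_on_tendsto_compose[OF f(2) k1(3)]) (auto simp: less_imp_le)
  moreover have "(\<lambda>n. f ((w \<circ> k1) n)) = z \<circ> (k0 \<circ> k1)" using w(2) by (auto simp: o_def)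
  moreover have "(z \<circ> (k0 \<circ> k1)) \<longlonglongrightarrow> p"
    using z(2) strict_mono_o[OF k0(1) k1(2)] by (rule LIMSEQ_subseq_LIMSEQ)
  ultimately have f\<zeta>: "f \<zeta> = p" using LIMSEQ_unique by metis
  have \<zeta>: "norm \<zeta> = 1"
  proof (rule ccontr)
    assume "norm \<zeta> \<noteq> 1"
    then have "p \<in> \<Omega>" using f(4)[of \<zeta>] k1(1) f\<zeta> G(2) by auto
    then show False using pF disj by blast
  qed
  then have \<zeta>0: "\<zeta> \<noteq> 0" by auto
  obtain \<delta> where \<delta>: "\<delta> > 0" "\<And>y. y \<in> cball 0 1 \<Longrightarrow> dist y \<zeta> < \<delta> \<Longrightarrow> dist (f y) p < r"
    using f(2) r(1) k1(1) f\<zeta> unfolding continuous_on_iff by metis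
  \<comment> \<open>With this \<open>a\<close>, the right half-circle is taken into the
    \<open>\<delta>\<close>-neighbourhood of \<open>\<zeta>\<close> and then by \<open>f\<close>
    into the open disc \<open>ball p r\<close>, where the trace consists of frontier points of
    \<open>\<Omega>\<close> and the added circle is out of reach.\<close>
  define a where "a = max 0 (1 - \<delta> / 4)"
  have a: "0 \<le> a" "a < 1" "2 * (1 - a) < \<delta>" using \<delta>(1) by (auto simp: a_def max_def)
  let ?m = "hyp_translation a"
  define \<phi> where "\<phi> = f \<circ> (\<lambda>y. \<zeta> * ?m y)"
  have m1: "(\<lambda>y. \<zeta> * ?m y) ` ball 0 1 \<subseteq> ball 0 1" using hyp_translation_in_ball[OF a(1,2)] \<zeta> by (auto simp: norm_mult)
  have m2: "(\<lambda>y. \<zeta> * ?m y) ` cball 0 1 \<subseteq> cball 0 1" using hyp_translation_in_cball[OF a(1,2)] \<zeta> by (auto simp: norm_mult)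
  have injf: "inj_on f (ball 0 1)" using f(4) by (intro inj_on_inverseI[of _ g]) auto
  have hol: "\<phi> holomorphic_on ball 0 1" unfolding \<phi>_def
    using m1 by (intro holomorphic_on_compose_gen[OF _ f(1)] holomorphic_intros hyp_translation_holomorphic[OF a(1,2)])
  have "inj_on (\<lambda>y. \<zeta> * ?m y) (ball 0 1)"
    using inj_on_subset[OF hyp_translation_inj[OF a(1,2)] ball_subset_cball] \<zeta>0 by (auto simp: inj_on_def)
  then have inj: "inj_on \<phi> (ball 0 1)" unfolding \<phi>_def using inj_on_subset[OF injf m1] by (rule comp_inj_on)
  have im: "\<phi> ` ball 0 1 \<subseteq> \<Omega>"
  proof
    fix v assume "v \<in> \<phi> ` ball 0 1"
    then obtain y where y: "y \<in> ball 0 1" "v = f (\<zeta> * ?m y)" by (auto simp: \<phi>_def)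
    then have "\<zeta> * ?m y \<in> ball 0 1" using m1 by blast
    then show "v \<in> \<Omega>" using f(4) G(2) y(2) by auto
  qed
  have cont: "continuous_on (cball 0 1) \<phi>" unfolding \<phi>_def
    using m2 continuous_on_subset[OF f(2)] by (intro continuous_on_compose continuous_intros hyp_translation_continuous[OF a(1,2)]) auto
  have one: "\<phi> 1 = p" using hyp_translation_one[OF a(1,2)] f\<zeta> by (simp add: \<phi>_def)
  have arc: "\<phi> ` open_arc (-\<i>) \<i> \<subseteq> ?F"
  proof
    fix v assume "v \<in> \<phi> ` open_arc (-\<i>) \<i>"
    then obtain y where y: "y \<in> open_arc (-\<i>) \<i>" "v = \<phi> y" by blast
    then have y1: "norm y = 1" "Re y > 0" using open_arc_i by auto
    have nm: "norm (\<zeta> * ?m y) = 1" using hyp_translation_in_sphere[OF a(1,2) y1(1)] \<zeta> by (simp add: norm_mult)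
    then have vX: "v \<in> X" using f(6) y(2) by (simp add: \<phi>_def)
    have "\<zeta> * ?m y - \<zeta> = \<zeta> * (?m y - 1)" by (simp add: algebra_simps)
    then have "dist (\<zeta> * ?m y) \<zeta> = norm (?m y - 1)" using \<zeta> by (simp add: dist_norm norm_mult)
    also have "\<dots> \<le> 2 * (1 - a)" using hyp_translation_near_one[OF a(1,2), of y] y1 by simp
    finally have "dist (f (\<zeta> * ?m y)) p < r" using \<delta>(2)[of "\<zeta> * ?m y"] nm a(3) by simp
    then have "v \<in> ball p r" using y(2) by (simp add: \<phi>_def dist_commute)
    then show "v \<in> ?F" using vX by (auto simp: X_def disc_trace_def)
  qed
  define y where "y n = hyp_translation_inv a ((w \<circ> k1) n / \<zeta>)" for n
  have wn: "norm ((w \<circ> k1) n / \<zeta>) < 1" for n using w(1) \<zeta> by (simp add: norm_divide)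
  have y1: "norm (y n) < 1" for n unfolding y_def by (rule hyp_translation_inv_in_ball[OF a(1,2) wn])
  have \<phi>y: "\<phi> (y n) = z (k0 (k1 n))" for n
  proof -
    have "\<zeta> * ?m (y n) = (w \<circ> k1) n"
      using hyp_translation_inverse(2)[OF a(1,2), of "(w \<circ> k1) n / \<zeta>"] wn[of n] \<zeta>0 by (simp add: y_def)
    then show ?thesis using w(2) by (simp add: \<phi>_def)
  qed
  have inv: "inv_into (ball 0 1) \<phi> (z (k0 (k1 n))) = y n" for n
    using inv_into_f_f[OF inj, of "y n"] y1[of n] \<phi>y[of n] by simp
  have "(\<lambda>n. (w \<circ> k1) n / \<zeta>) \<longlonglongrightarrow> \<zeta> / \<zeta>" using \<zeta>0 by (intro tendsto_intros k1(3))
  then have "(\<lambda>n. (w \<circ> k1) n / \<zeta>) \<longlonglongrightarrow> 1" using \<zeta>0 by simp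
  then have "(\<lambda>n. hyp_translation_inv a ((w \<circ> k1) n / \<zeta>)) \<longlonglongrightarrow> hyp_translation_inv a 1"
  proof (rule continuous_on_tendsto_compose[OF hyp_translation_inv_continuous[OF a(1,2)]])
    show "\<forall>\<^sub>F n in sequentially. (w \<circ> k1) n / \<zeta> \<in> cball 0 1"
    proof (rule always_eventually, rule allI)
      show "(w \<circ> k1) n / \<zeta> \<in> cball 0 1" for n using wn[of n] by (simp only: mem_cball_0 less_imp_le)
    qed
  qed simp
  then have ylim: "y \<longlonglongrightarrow> 1" using hyp_translation_inv_one[OF a(1,2)] by (simp add: y_def[abs_def])
  then have "(\<lambda>n. Re (y n)) \<longlonglongrightarrow> Re 1" by (rule tendsto_Re)
  then have "\<forall>\<^sub>F n in sequentially. Re (y n) > 0" by (rule order_tendstoD) simp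
  \<comment> \<open>Dropping the first \<open>N\<close> terms leaves preimages in the right
    half-disc, hence in the region.\<close>
  then obtain N where N: "\<And>n. n \<ge> N \<Longrightarrow> Re (y n) > 0" unfolding eventually_sequentially by blast
  define k where "k n = k0 (k1 (n + N))" for n
  have "strict_mono k"
    using k0(1) k1(2) unfolding k_def strict_mono_def by simp
  moreover have "boundary_disc \<Omega> p (z \<circ> k) \<phi> (-\<i>) \<i>"
    unfolding boundary_disc_def
  proof (intro conjI hol inj im cont one arc allI)
    show "(-\<i>) \<in> sphere 0 1 - {1}" "\<i> \<in> sphere 0 1 - {1}" "-\<i> \<noteq> \<i>" by (auto simp: complex_eq_iff)
    show "(z \<circ> k) n \<in> \<phi> ` Reg (-\<i>) \<i>" for n
    proof -
      have "y (n + N) \<in> Reg (-\<i>) \<i>" using half_disc_subset_Reg y1 N by simp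
      then show ?thesis using \<phi>y[of "n + N"] by (intro image_eqI[of _ _ "y (n + N)"]) (auto simp: k_def)
    qed
    show "(\<lambda>n. inv_into (ball 0 1) \<phi> ((z \<circ> k) n)) \<longlonglongrightarrow> 1"
      using LIMSEQ_ignore_initial_segment[OF ylim, of N] inv by (simp add: k_def)
  qed
  ultimately show ?thesis by blast
qed

theorem theorem4p13:
  fixes \<Omega> :: "complex set"
  assumes "hyperbolic_domain \<Omega>"
  shows "condition2 \<Omega> \<longleftrightarrow>
    (\<exists>S \<subseteq> frontier \<Omega>. totally_disconnected S \<and>
       (\<forall>p \<in> frontier \<Omega> - S.
          locally_connected_at p (top_of_set (frontier \<Omega>)) \<and>
          \<not> is_singleton (connected_component_set (frontier \<Omega>) p)))"
    (is "?L \<longleftrightarrow> ?R")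
proof
  have \<Omega>: "open \<Omega>" "connected \<Omega>" using assms by (auto simp: hyperbolic_domain_def)
  let ?F = "frontier \<Omega>"
  show ?R if ?L
  proof -
    from that obtain S where S: "S \<subseteq> ?F" "closed S" "totally_disconnected S"
      and H0: "\<forall>p \<in> ?F - S. \<forall>z. (\<forall>n. z n \<in> \<Omega>) \<and> z \<longlonglongrightarrow> p \<longrightarrow>
           (\<exists>k \<phi> x1 x2. strict_mono k \<and> boundary_disc \<Omega> p (z \<circ> k) \<phi> x1 x2)"
      unfolding condition2_altdef by (elim exE conjE)
    have H: "\<exists>k \<phi> x1 x2. strict_mono k \<and> boundary_disc \<Omega> p (z \<circ> k) \<phi> x1 x2"
      if "p \<in> ?F - S" "\<forall>n. z n \<in> \<Omega>" "z \<longlonglongrightarrow> p" for p z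
      using spec[OF bspec[OF H0 that(1)], of z] that(2,3) by blast
    have cik: "connected_im_kleinen ?F q" if "q \<in> ?F \<inter> - S" for q
    proof (rule boundary_discs_imp_cik[OF \<Omega>(1)])
      show "q \<in> ?F" using that by blast
      fix z assume z: "\<forall>n. z n \<in> \<Omega>" "z \<longlonglongrightarrow> q"
      show "\<exists>k \<phi> x1 x2. strict_mono k \<and> boundary_disc \<Omega> q (z \<circ> k) \<phi> x1 x2"
        by (rule H[OF _ z]) (use that in blast)
    qed
    have "locally_connected_at p (top_of_set ?F) \<and> \<not> is_singleton (connected_component_set ?F p)"
      if p: "p \<in> ?F - S" for p
    proof
      show "locally_connected_at p (top_of_set ?F)"
        using S(2) p cik by (intro cik_on_open_imp_locally_connected_at[of "- S"]) auto
      \<comment> \<open>Condition 2 yields a disc only for a given sequence, so some sequence in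
        \<open>\<Omega>\<close> tending to \<open>p\<close> is supplied.\<close>
      have "p \<in> closure \<Omega>" using p by (simp add: frontier_def)
      then obtain z where "\<forall>n. z n \<in> \<Omega>" "z \<longlonglongrightarrow> p" unfolding closure_sequential by blast
      then show "\<not> is_singleton (connected_component_set ?F p)"
        using H[OF p, of z] boundary_disc_imp_nonsingleton[OF \<Omega>(1)] by metis
    qed
    then show ?thesis using S by blast
  qed
  show ?L if ?R
  proof -
    from that obtain S where S: "S \<subseteq> ?F" "totally_disconnected S"
      and "\<forall>p \<in> ?F - S. locally_connected_at p (top_of_set ?F) \<and> \<not> is_singleton (connected_component_set ?F p)"
      by (elim exE conjE)
    note good = bspec[OF this(3)]
    obtain S' where S': "S' \<subseteq> S" "closed S'" "totally_disconnected S'"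
      and nhd: "\<And>p. p \<in> ?F - S' \<Longrightarrow> connected_im_kleinen ?F p \<and>
           (\<exists>U. openin (top_of_set ?F) U \<and> connected U \<and> p \<in> U \<and> (\<exists>u\<in>U. u \<noteq> p))"
      using closed_exceptional_set[OF frontier_closed S(2,1) good] by blast
    have "\<exists>k \<phi> x1 x2. strict_mono k \<and> boundary_disc \<Omega> p (z \<circ> k) \<phi> x1 x2"
      if p: "p \<in> ?F - S'" and z: "\<And>n. z n \<in> \<Omega>" "z \<longlonglongrightarrow> p" for p z
    proof -
      obtain U u where U: "openin (top_of_set ?F) U" "connected U" "p \<in> U" "u \<in> U" "u \<noteq> p" using nhd[OF p] by blast
      obtain r1 where r1: "r1 > 0" "ball p r1 \<subseteq> - S'" using S'(2) p by (metis ComplI DiffD2 open_Compl open_contains_ball)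
      have "connected_im_kleinen ?F q" if "q \<in> ?F \<inter> ball p r1" for q using nhd r1(2) that by blast
      then show ?thesis using boundary_disc_exists[OF \<Omega> _ U r1(1) _ z] p by blast
    qed
    then have "\<forall>p \<in> ?F - S'. \<forall>z. (\<forall>n. z n \<in> \<Omega>) \<and> z \<longlonglongrightarrow> p \<longrightarrow>
           (\<exists>k \<phi> x1 x2. strict_mono k \<and> boundary_disc \<Omega> p (z \<circ> k) \<phi> x1 x2)"
      by (intro ballI allI impI) (elim conjE, simp)
    then show ?thesis unfolding condition2_altdef
      by (intro exI[of _ S'] conjI S'(2,3) subset_trans[OF S'(1) S(1)])
  qed
qed

end
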